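(* Let $\alpha>1$, $\beta>2$, and suppose that for every $n$ the bi-degree sequence $(\mathbf N_n,\mathbf D_n)=\{(N_i,D_i):1\le i\le n\}$ is constructed by Algorithm 1 (described in the context) from target distributions $F^{\mathrm{in}},F^{\mathrm{out}}$ satisfying the standing assumptions given in the context with these $\alpha,\beta$. Let $\mathscr N\sim F^{\mathrm{in}}$, $\mathscr D\sim F^{\mathrm{out}}$, let $\mu=E[\mathscr N]=E[\mathscr D]>1$, let $c\in(0,1)$, and let $r_0\ge 0$ be the initial value of the PageRank iterations. Let $R_1^{(n,\infty)}$ be the scale-free PageRank, with damping factor $c$, of the uniformly chosen node (called node 1) of the directed configuration model $\mathcal G(n)$ with bi-degree sequence $(\mathbf N_n,\mathbf D_n)$, and let $\hat R_1^{(n,k)}$ be the PageRank, after $k$ iterations, of the root node of the coupled thorny branching tree. Then, for any $\epsilon>0$, any $0<h<1/(2\log\mu)$ and any integers $k=k_n$ with $1\le k\le h\log n$ (for all sufficiently large $n$), there exists $\delta>0$ such that $$P\left(\left|R_1^{(n,\infty)}-\hat R_1^{(n,k)}\right|>\epsilon\right)\le (r_0+1)\,\epsilon^{-1}c^k+O\left(n^{-\delta}\right)\qquad\text{as } n\to\infty .$$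
   Context: **Target distributions.** $F^{\mathrm{in}}$ and $F^{\mathrm{out}}$ are probability distributions on $\{0,1,2,\dots\}$ with $f^{\mathrm{in}}_k=P(\mathscr N=k)$, $f^{\mathrm{out}}_k=P(\mathscr D=k)$, $E[\mathscr N]=E[\mathscr D]$, and $$\sum_{k>x}f^{\mathrm{in}}_k\le x^{-\alpha}L_{\mathrm{in}}(x),\qquad \sum_{k>x}f^{\mathrm{out}}_k\le x^{-\beta}L_{\mathrm{out}}(x)$$ for some slowly varying functions $L_{\mathrm{in}},L_{\mathrm{out}}$ (where $L$ is slowly varying if $\lim_{x\to\infty}L(tx)/L(x)=1$ for all $t>0$). Put $\kappa_0=\min\{1-\alpha^{-1},1-\beta^{-1},1/2\}$. **Algorithm 1 (bi-degree sequence).** 1. Fix $0<\delta_0<\kappa_0$. 2. Sample $\mathscr N_1,\dots,\mathscr N_n$ i.i.d. from $F^{\mathrm{in}}$. 3. Sample $\mathscr D_1,\dots,\mathscr D_n$ i.i.d. from $F^{\mathrm{out}}$, independent of $\{\mathscr N_i\}$. 4. Let $\Delta_n=\sum_{i=1}^n(\mathscr N_i-\mathscr D_i)$. If $|\Delta_n|\le n^{1-\kappa_0+\delta_0}$ go to step 5; otherwise repeat from step 2. 5. Choose uniformly at random $|\Delta_n|$ nodes $\{i_1,\dots,i_{|\Delta_n|}\}$ without replacement. Set $N_i=\mathscr N_i+1$ if $\Delta_n<0$ and $i\in\{i_1,\dots,i_{|\Delta_n|}\}$, and $N_i=\mathscr N_i$ otherwise; set $D_i=\mathscr D_i+1$ if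 $\Delta_n\ge0$ and $i\in\{i_1,\dots,i_{|\Delta_n|}\}$, and $D_i=\mathscr D_i$ otherwise. Then $L_n:=\sum_{i=1}^nN_i=\sum_{i=1}^nD_i$. Let $\mathcal F_n=\sigma((\mathbf N_n,\mathbf D_n))$. **Directed configuration model $\mathcal G(n)$.** Node $i$ gets $N_i$ inbound stubs (half-edges) and $D_i$ outbound stubs. Each inbound stub is successively paired with an outbound stub chosen uniformly at random among the unpaired outbound stubs; pairing an inbound stub of $i$ with an outbound stub of $j$ creates a directed edge from $j$ to $i$. Self-loops and multiple edges are allowed. **PageRank on the graph.** Let $M=M(n)\in\mathbb R^{n\times n}$, $M_{i,j}=s_{ij}c/D_i$ if there are $s_{ij}\ge1$ edges from $i$ to $j$, and $M_{i,j}=0$ otherwise; $\mathbf 1$ is the row vector of ones. The scale-free PageRank $\mathbf R^{(n,\infty)}=(R^{(n,\infty)}_1,\dots,R^{(n,\infty)}_n)$ is the unique solution of $\mathbf R=\mathbf RM+(1-c)\mathbf 1$, i.e. $\mathbf R^{(n,\infty)}=(1-c)\mathbf 1\sum_{i=0}^\infty M^i$. It is the limit of the power iterations $\mathbf R^{(n,0)}=r_0\mathbf 1$, $\mathbf R^{(n,k)}=\mathbf R^{(n,k-1)}M+(1-c)\mathbf 1$, $k\ge1$, where $r_0\ge 0$. **Thorny branching tree (TBT) $\mathcal T$.** A node is chosen uniformly at random and called node 1. It is the root (generation 0) of $\mathcal T$ and has $N_1$ offspring. Conditionally on $\mathcal F_n$, every non-root individual independently is a copy of a node $j$ obtained by drawing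 one of the $L_n$ outbound stubs uniformly at random with replacement, $j$ being the owner of the stub; that is, it has in-/out-degree $(i,d)$ with probability $\sum_{m=1}^n 1(N_m=i,D_m=d)D_m/L_n$. Such an individual has $N_j$ offspring and total out-degree $D_j$: one edge to its parent and $D_j-1$ outbound stubs pointing outside the tree (to an auxiliary node). **Coupling of $\mathcal G(n)$ and $\mathcal T$.** Both are built simultaneously, breadth-first from node 1. Outbound stubs carry label 1 (owner not yet attached to the explored graph), 2 (owner already in the explored graph, stub unpaired) or 3 (stub already paired). Initially the stubs of node 1 have label 2 and all others label 1. Inbound stubs are processed generation by generation; for each, one of the $L_n$ outbound stubs is drawn uniformly at random with replacement. - Label 1 drawn, owner $j$: both graph and tree attach the node ($N_j$ inbound stubs/offspring, $D_j-1$ remaining outbound stubs); the drawn stub gets label 3 and the other outbound stubs of $j$ get label 2. - Label 2 drawn: the graph pairs the two stubs (creating a cycle, self-loop or multiple edge, and the drawn stub gets label 3), while in $\mathcal T$ a new node that is a copy of the owner is created; the coupling breaks. - Label 3 drawn: $\mathcal T$ proceeds as if the label had been 1 (a copy of the owner is created), while the graph redraws until a stub with label 1 or 2 is obtained; the coupling breaks. After the coupling breaks, both constructions continue according to their own laws: in $\mathcal G(n)$, each remaining unpaired inbound stub is successively paired with an outbound stub chosen uniformly at random among the unpaired outbound stubs, until all $L_n$ inbound stubs are paired; in $\mathcal T$, conditionally on $\mathcal F_n$, each new individual is independently a copy of the owner $j$ of an outbound stub drawn uniformly at random with replacement from all $L_n$ outbound stubs, with $N_j$ offspring and $D_j-1$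 outbound stubs pointing outside the tree. **PageRank on the tree.** For a node $i$ of $\mathcal T$, put $\hat R_i^{(n,0)}=r_0$ and, for $k\ge1$, $$\hat R_i^{(n,k)}=\sum_{j\to i}\frac{c}{D_j}\hat R_j^{(n,k-1)}+(1-c),$$ where the sum is over the offspring $j$ of $i$ and $D_j$ is the total out-degree of $j$ (including the edge to its parent). $\hat R_1^{(n,k)}$ is this quantity at the root. $P$ is the overall probability over the bi-degree sequence, the choice of node 1, the pairing and the tree. *)

theory Defs
  imports "HOL-Probability.Probability" "HOL-Library.Landau_Symbols"
begin

definition slowly_varying :: "(real \<Rightarrow> real) \<Rightarrow> bool" where
  "slowly_varying L \<longleftrightarrow> (\<forall>t>0. ((\<lambda>x. L (t * x) / L x) \<longlongrightarrow> 1) at_top)"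

definition tail_bound :: "nat pmf \<Rightarrow> real \<Rightarrow> (real \<Rightarrow> real) \<Rightarrow> bool" where
  "tail_bound F a L \<longleftrightarrow> (\<forall>x>0. measure_pmf.prob F {j. real j > x} \<le> x powr (- a) * L x)"

definition kappa0 :: "real \<Rightarrow> real \<Rightarrow> real" where
  "kappa0 \<alpha> \<beta> = min (1 - 1 / \<alpha>) (min (1 - 1 / \<beta>) (1 / 2))"


section \<open>The bi-degree sequence\<close>

text \<open>The nodes are \<open>0, \<dots>, n - 1\<close>; degree sequences are functions on \<open>nat\<close> of which only the
  values below \<open>n\<close> matter.\<close>

definition degree_gap :: "nat \<Rightarrow> (nat \<Rightarrow> nat) \<Rightarrow> (nat \<Rightarrow> nat) \<Rightarrow> int" where
  "degree_gap n x y = (\<Sum>i<n. int (x i) - int (y i))"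

text \<open>Resampling the two i.i.d. sequences until their sums are close produces the conditional law
  of a sample given acceptance. For the finitely many \<open>n\<close> for which acceptance may
  be impossible the value of \<open>cond_pmf\<close>, and hence the law below, is unspecified.\<close>

definition accepted_sample :: "real \<Rightarrow> real \<Rightarrow> nat pmf \<Rightarrow> nat pmf \<Rightarrow> nat
    \<Rightarrow> ((nat \<Rightarrow> nat) \<times> (nat \<Rightarrow> nat)) pmf" where
  "accepted_sample \<kappa> \<delta>\<^sub>0 Fin Fout n =
     cond_pmf (pair_pmf (Pi_pmf {..<n} 0 (\<lambda>_. Fin)) (Pi_pmf {..<n} 0 (\<lambda>_. Fout)))
       {(x, y). real_of_int \<bar>degree_gap n x y\<bar> \<le> real n powr (1 - \<kappa> + \<delta>\<^sub>0)}"

definition bi_degree :: "real \<Rightarrow> real \<Rightarrow> nat pmf \<Rightarrow> nat pmf \<Rightarrow> nat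
    \<Rightarrow> ((nat \<Rightarrow> nat) \<times> (nat \<Rightarrow> nat)) pmf" where
  "bi_degree \<kappa> \<delta>\<^sub>0 Fin Fout n =
     bind_pmf (accepted_sample \<kappa> \<delta>\<^sub>0 Fin Fout n) (\<lambda>(x, y).
     bind_pmf (pmf_of_set {I. I \<subseteq> {..<n} \<and> card I = nat \<bar>degree_gap n x y\<bar>}) (\<lambda>I.
     return_pmf
       (\<lambda>i. if degree_gap n x y < 0 \<and> i \<in> I then x i + 1 else x i,
        \<lambda>i. if degree_gap n x y \<ge> 0 \<and> i \<in> I then y i + 1 else y i)))"


section \<open>Pairings of stubs and PageRank on the graph\<close>

text \<open>A stub is a pair \<open>(i, a)\<close> of its owner \<open>i\<close> and a running number \<open>a\<close>. A (partial) multigraph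
  is a (partial) map \<open>G\<close> from inbound to outbound stubs: \<open>G (i, a) = Some (j, b)\<close>
  is an edge from \<open>j\<close> to \<open>i\<close>.\<close>

type_synonym stub = "nat \<times> nat"
type_synonym pairing = "stub \<rightharpoonup> stub"

definition in_stubs :: "nat \<Rightarrow> (nat \<Rightarrow> nat) \<Rightarrow> stub list" where
  "in_stubs n N = [(i, a). i \<leftarrow> [0..<n], a \<leftarrow> [0..<N i]]"

definition out_stubs :: "nat \<Rightarrow> (nat \<Rightarrow> nat) \<Rightarrow> stub set" where
  "out_stubs n D = (SIGMA j:{..<n}. {..<D j})"

primrec pair_stubs :: "stub set \<Rightarrow> stub list \<Rightarrow> pairing \<Rightarrow> pairing pmf" where
  "pair_stubs S [] G = return_pmf G"
| "pair_stubs S (x # xs) G =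
     bind_pmf (pmf_of_set (S - ran G)) (\<lambda>s. pair_stubs S xs (G(x \<mapsto> s)))"

definition complete_pairing :: "nat \<Rightarrow> (nat \<Rightarrow> nat) \<Rightarrow> (nat \<Rightarrow> nat) \<Rightarrow> pairing \<Rightarrow> pairing pmf" where
  "complete_pairing n N D G =
     pair_stubs (out_stubs n D) (filter (\<lambda>x. x \<notin> dom G) (in_stubs n N)) G"

definition edge_count :: "pairing \<Rightarrow> nat \<Rightarrow> nat \<Rightarrow> nat" where
  "edge_count G i j = card {a. \<exists>b. G (j, a) = Some (i, b)}"

definition pagerank_matrix :: "(nat \<Rightarrow> nat) \<Rightarrow> real \<Rightarrow> pairing \<Rightarrow> nat \<Rightarrow> nat \<Rightarrow> real" where
  "pagerank_matrix D c G i j =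
     (if edge_count G i j \<ge> 1 then real (edge_count G i j) * c / real (D i) else 0)"

text \<open>Extending the vectors by \<open>0\<close> outside \<open>{..<n}\<close> makes the solution unique as a function on
  \<open>nat\<close>.\<close>

definition pagerank_solution :: "nat \<Rightarrow> real \<Rightarrow> (nat \<Rightarrow> nat \<Rightarrow> real) \<Rightarrow> (nat \<Rightarrow> real) \<Rightarrow> bool" where
  "pagerank_solution n c M R \<longleftrightarrow>
     (\<forall>i<n. R i = (\<Sum>j<n. R j * M j i) + (1 - c)) \<and> (\<forall>i\<ge>n. R i = 0)"

definition pagerank :: "nat \<Rightarrow> (nat \<Rightarrow> nat) \<Rightarrow> real \<Rightarrow> pairing \<Rightarrow> nat \<Rightarrow> real" where
  "pagerank n D c G = (THE R. pagerank_solution n c (pagerank_matrix D c G) R)"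

lemma pagerank_solution_ex1:
  fixes M :: "nat \<Rightarrow> nat \<Rightarrow> real"
  assumes c: "0 < c" "c < 1"
    and nonneg: "\<And>i j. i < n \<Longrightarrow> j < n \<Longrightarrow> M i j \<ge> 0"
    and row: "\<And>i. i < n \<Longrightarrow> (\<Sum>j<n. M i j) \<le> c"
  shows "\<exists>!R. pagerank_solution n c M R"
proof -
  have contr: "(\<Sum>i<n. \<bar>\<Sum>j<n. w j * M j i\<bar>) \<le> c * (\<Sum>j<n. \<bar>w j\<bar>)" for w :: "nat \<Rightarrow> real"
  proof -
    have "(\<Sum>i<n. \<bar>\<Sum>j<n. w j * M j i\<bar>) \<le> (\<Sum>i<n. \<Sum>j<n. \<bar>w j\<bar> * M j i)"
      using nonneg by (intro sum_mono order_trans[OF sum_abs]) (auto simp: abs_mult intro!: sum_mono)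
    also have "\<dots> = (\<Sum>j<n. \<bar>w j\<bar> * (\<Sum>i<n. M j i))"
      by (subst sum.swap) (simp add: sum_distrib_left)
    also have "\<dots> \<le> (\<Sum>j<n. \<bar>w j\<bar> * c)"
      using row by (intro sum_mono mult_left_mono) auto
    finally show ?thesis by (simp add: sum_distrib_left mult.commute)
  qed
  define w where "w m = ((\<lambda>v i. \<Sum>j<n. v j * M j i) ^^ m) (\<lambda>_. 1 - c)" for m
  have w0: "w 0 i = 1 - c" and wS: "w (Suc m) i = (\<Sum>j<n. w m j * M j i)" for m i
    by (simp_all add: w_def)
  have norm_w: "(\<Sum>i<n. \<bar>w m i\<bar>) \<le> c ^ m * (\<Sum>i<n. \<bar>1 - c\<bar>)" for m
  proof (induction m)
    case (Suc m)
    have "(\<Sum>i<n. \<bar>w (Suc m) i\<bar>) \<le> c * (\<Sum>i<n. \<bar>w m i\<bar>)" by (simp only: wS contr)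
    also have "\<dots> \<le> c * (c ^ m * (\<Sum>i<n. \<bar>1 - c\<bar>))" using Suc c by (intro mult_left_mono) auto
    finally show ?case by (simp add: mult.assoc)
  qed (simp add: w0)
  have summ: "summable (\<lambda>m. w m i)" if "i < n" for i
  proof (rule summable_comparison_test')
    show "summable (\<lambda>m. c ^ m * (\<Sum>i<n. \<bar>1 - c\<bar>))"
      using c by (intro summable_mult2 summable_geometric) auto
    show "norm (w m i) \<le> c ^ m * (\<Sum>i<n. \<bar>1 - c\<bar>)" if "m \<ge> 0" for m
      using norm_w[of m] member_le_sum[of i "{..<n}" "\<lambda>i. \<bar>w m i\<bar>"] \<open>i < n\<close> by auto
  qed
  define R where "R i = (if i < n then \<Sum>m. w m i else 0)" for i
  have "R i = (\<Sum>j<n. R j * M j i) + (1 - c)" if "i < n" for i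
  proof -
    have "(\<Sum>j<n. R j * M j i) = (\<Sum>j<n. \<Sum>m. w m j * M j i)"
      by (intro sum.cong) (auto simp: R_def suminf_mult2 summ)
    also have "\<dots> = (\<Sum>m. w (Suc m) i)"
      unfolding wS by (rule suminf_sum [symmetric]) (auto intro: summable_mult2 summ)
    finally show ?thesis using suminf_split_head[OF summ[OF that]] that by (simp add: R_def w0)
  qed
  hence ex: "pagerank_solution n c M R" by (simp add: pagerank_solution_def R_def)
  have uniq: "R1 = R2" if "pagerank_solution n c M R1" "pagerank_solution n c M R2" for R1 R2
  proof
    fix i
    let ?d = "\<lambda>i. R1 i - R2 i"
    have d: "?d i = (\<Sum>j<n. ?d j * M j i)" if "i < n" for i
    proof -
      have "R1 i = (\<Sum>j<n. R1 j * M j i) + (1 - c)" "R2 i = (\<Sum>j<n. R2 j * M j i) + (1 - c)"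
        using \<open>pagerank_solution n c M R1\<close> \<open>pagerank_solution n c M R2\<close> that
        unfolding pagerank_solution_def by blast+
      thus ?thesis unfolding left_diff_distrib sum_subtractf by linarith
    qed
    have "(\<Sum>i<n. \<bar>?d i\<bar>) = (\<Sum>i<n. \<bar>\<Sum>j<n. ?d j * M j i\<bar>)"
    proof (rule sum.cong)
      fix i assume "i \<in> {..<n}"
      thus "\<bar>?d i\<bar> = \<bar>\<Sum>j<n. ?d j * M j i\<bar>" using d[of i] by (metis lessThan_iff)
    qed simp
    hence "(\<Sum>i<n. \<bar>?d i\<bar>) \<le> c * (\<Sum>i<n. \<bar>?d i\<bar>)" using contr[of ?d] by simp
    moreover have "(\<Sum>i<n. \<bar>?d i\<bar>) \<ge> 0" by (simp add: sum_nonneg)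
    moreover have "x = 0" if "x \<le> c * x" "0 \<le> x" for x :: real
      using that c mult_strict_right_mono[of c 1 x] by (cases "x = 0") auto
    ultimately have "(\<Sum>i<n. \<bar>?d i\<bar>) = 0" by blast
    hence "\<forall>i<n. ?d i = 0" by (simp add: sum_nonneg_eq_0_iff)
    thus "R1 i = R2 i" using that by (cases "i < n") (auto simp: pagerank_solution_def)
  qed
  show ?thesis using ex uniq by blast
qed


section \<open>Trees and PageRank on them\<close>

text \<open>The individuals of a tree are addressed by lists: \<open>[]\<close> is the root and \<open>u @ [a]\<close> is the
  offspring number \<open>a\<close> of \<open>u\<close>, so that \<open>length u\<close> is the generation of \<open>u\<close>.
  The tree itself maps the address of each individual to the node of which it is a copy.\<close>

type_synonym labelled_tree = "nat list \<rightharpoonup> nat"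

definition offspring :: "(nat \<Rightarrow> nat) \<Rightarrow> labelled_tree \<Rightarrow> nat \<Rightarrow> nat list set" where
  "offspring N T g = {u @ [a] | u a i. length u = g \<and> T u = Some i \<and> a < N i}"

text \<open>The law of the thorny branching tree down to generation \<open>k\<close>, given that the individuals in
  \<open>T\<close> have already been created. Every individual that is still missing is
  a copy of the owner of an independent, uniformly drawn outbound stub.\<close>

primrec grow_tree :: "nat \<Rightarrow> (nat \<Rightarrow> nat) \<Rightarrow> (nat \<Rightarrow> nat) \<Rightarrow> nat \<Rightarrow> labelled_tree
    \<Rightarrow> labelled_tree pmf" where
  "grow_tree n N D 0 T = return_pmf T"
| "grow_tree n N D (Suc g) T =
     bind_pmf (grow_tree n N D g T) (\<lambda>T'.
     bind_pmf (Pi_pmf (offspring N T' g - dom T') None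
                 (\<lambda>_. map_pmf (\<lambda>s. Some (fst s)) (pmf_of_set (out_stubs n D)))) (\<lambda>X.
     return_pmf (T' ++ X)))"

text \<open>\<open>tree_pagerank N D c r\<^sub>0 T k u\<close> is the PageRank of \<open>u\<close> after \<open>k\<close> iterations; it depends
  on the individuals up to \<open>k\<close> generations below \<open>u\<close> only.\<close>

primrec tree_pagerank :: "(nat \<Rightarrow> nat) \<Rightarrow> (nat \<Rightarrow> nat) \<Rightarrow> real \<Rightarrow> real \<Rightarrow> labelled_tree
    \<Rightarrow> nat \<Rightarrow> nat list \<Rightarrow> real" where
  "tree_pagerank N D c r\<^sub>0 T 0 u = r\<^sub>0"
| "tree_pagerank N D c r\<^sub>0 T (Suc k) u =
     (\<Sum>a<N (the (T u)). c / real (D (the (T (u @ [a])))) * tree_pagerank N D c r\<^sub>0 T k (u @ [a]))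
       + (1 - c)"


section \<open>The coupling\<close>

text \<open>An outbound stub is \<open>Fresh\<close> (label 1) if its owner is not attached to the explored graph,
  \<open>Active\<close> (label 2) if its owner is attached but the stub is unpaired, and \<open>Paired\<close> (label 3)
  if it has been paired.\<close>

datatype stub_label = Fresh | Active | Paired

text \<open>The breadth-first queue lists the inbound stubs that are still to be processed,
  each preceded by the address of the corresponding tree individual.\<close>

record exploration =
  graph_of :: pairing
  tree_of :: labelled_tree
  label_of :: "stub \<Rightarrow> stub_label"
  queue_of :: "(nat list \<times> stub) list"
  broken :: bool

definition enqueue :: "(nat \<Rightarrow> nat) \<Rightarrow> nat list \<Rightarrow> nat \<Rightarrow> (nat list \<times> stub) list" where
  "enqueue N u i = map (\<lambda>a. (u @ [a], (i, a))) [0..<N i]"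

definition init_exploration :: "(nat \<Rightarrow> nat) \<Rightarrow> nat \<Rightarrow> exploration" where
  "init_exploration N v =
     \<lparr> graph_of = Map.empty, tree_of = [[] \<mapsto> v],
       label_of = (\<lambda>s. if fst s = v then Active else Fresh),
       queue_of = enqueue N [] v, broken = False \<rparr>"

text \<open>In the case \<open>Paired\<close>, redrawing until the label is 1 or 2 amounts to a uniform choice
  among the stubs with these labels.\<close>

definition explore_step :: "nat \<Rightarrow> (nat \<Rightarrow> nat) \<Rightarrow> (nat \<Rightarrow> nat) \<Rightarrow> exploration \<Rightarrow> exploration pmf" where
  "explore_step n N D E =
     (if broken E then return_pmf E else
      case queue_of E of
        [] \<Rightarrow> return_pmf E
      | (u, x) # q \<Rightarrow>
          bind_pmf (pmf_of_set (out_stubs n D)) (\<lambda>s.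
          let T = (tree_of E)(u \<mapsto> fst s) in
          case label_of E s of
            Fresh \<Rightarrow> return_pmf
              \<lparr> graph_of = (graph_of E)(x \<mapsto> s), tree_of = T,
                label_of = (\<lambda>t. if t = s then Paired else if fst t = fst s then Active
                                else label_of E t),
                queue_of = q @ enqueue N u (fst s), broken = False \<rparr>
          | Active \<Rightarrow> return_pmf
              \<lparr> graph_of = (graph_of E)(x \<mapsto> s), tree_of = T,
                label_of = (label_of E)(s := Paired),
                queue_of = q, broken = True \<rparr>
          | Paired \<Rightarrow>
              bind_pmf (pmf_of_set {t \<in> out_stubs n D. label_of E t \<noteq> Paired}) (\<lambda>t. return_pmf
              \<lparr> graph_of = (graph_of E)(x \<mapsto> t), tree_of = T,
                label_of = (label_of E)(t := Paired),
                queue_of = q, broken = True \<rparr>)))"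

primrec explore_steps :: "nat \<Rightarrow> nat \<Rightarrow> (nat \<Rightarrow> nat) \<Rightarrow> (nat \<Rightarrow> nat) \<Rightarrow> exploration
    \<Rightarrow> exploration pmf" where
  "explore_steps 0 n N D E = return_pmf E"
| "explore_steps (Suc m) n N D E = bind_pmf (explore_step n N D E) (explore_steps m n N D)"

text \<open>As each step processes another one of the inbound stubs, their total number many steps
  suffice for the coupling to break or for the queue to run empty.\<close>

definition explore :: "nat \<Rightarrow> (nat \<Rightarrow> nat) \<Rightarrow> (nat \<Rightarrow> nat) \<Rightarrow> nat \<Rightarrow> exploration pmf" where
  "explore n N D v = explore_steps (\<Sum>i<n. N i) n N D (init_exploration N v)"

text \<open>After the joint exploration, graph and tree continue according to their own laws.
  A continuation is any joint law of the final graph and the first \<open>k\<close> generations of the final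
  tree, given the exploration, that has the prescribed marginals.\<close>

type_synonym continuation =
  "(nat \<Rightarrow> nat) \<Rightarrow> (nat \<Rightarrow> nat) \<Rightarrow> exploration \<Rightarrow> (pairing \<times> labelled_tree) pmf"

definition is_continuation :: "nat \<Rightarrow> nat \<Rightarrow> continuation \<Rightarrow> bool" where
  "is_continuation n k K \<longleftrightarrow>
     (\<forall>N D E. map_pmf fst (K N D E) = complete_pairing n N D (graph_of E) \<and>
              map_pmf snd (K N D E) = grow_tree n N D k (tree_of E))"

lemma is_continuation_independent:
  "is_continuation n k
     (\<lambda>N D E. pair_pmf (complete_pairing n N D (graph_of E)) (grow_tree n N D k (tree_of E)))"
  by (simp add: is_continuation_def map_fst_pair_pmf map_snd_pair_pmf)

text \<open>The components of an outcome are the bi-degree sequence \<open>N, D\<close>, the uniformly chosen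
  node \<open>v\<close> (``node 1''), the graph \<open>G\<close> and the tree \<open>T\<close>.\<close>

definition coupled_model :: "real \<Rightarrow> real \<Rightarrow> nat pmf \<Rightarrow> nat pmf \<Rightarrow> nat \<Rightarrow> continuation
    \<Rightarrow> ((nat \<Rightarrow> nat) \<times> (nat \<Rightarrow> nat) \<times> nat \<times> pairing \<times> labelled_tree) pmf" where
  "coupled_model \<kappa> \<delta>\<^sub>0 Fin Fout n K =
     bind_pmf (bi_degree \<kappa> \<delta>\<^sub>0 Fin Fout n) (\<lambda>(N, D).
     bind_pmf (pmf_of_set {..<n}) (\<lambda>v.
     bind_pmf (explore n N D v) (\<lambda>E.
     bind_pmf (K N D E) (\<lambda>(G, T).
     return_pmf (N, D, v, G, T)))))"

end

(* The first k generations of the coupled exploration agree with high probability, and on that event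
   the PageRank of the root of the tree is the k-th power iteration at node 1. A coupling step that
   meets A stubs of attached nodes breaks with probability A / L_n. With x steps allowed the total
   break probability is of order x^2 / n, and the number of steps needed has mean of order mu^k <=
   n^(h log mu), so any x strictly between n^(h log mu) and n^(1/2) works. The required bounds on the
   sums of N_i, N_i D_i and D_i^2 come from moments of order p in (1, 2) (and E D^2 < infinity) via a
   von Bahr-Esseen inequality, which also shows that Algorithm 1 accepts with probability at least 1/2.
   The term (r_0 + 1) c^k / epsilon is the truncation error of the power iteration, which contracts
   the l1-norm by c: since the graph is independent of the uniform node 1, the expected error at
   node 1 is the average over all nodes. *)

theory Submission
  imports Defs
begin

section \<open>Moments of the degree distributions\<close>

text \<open>In-degrees may have infinite variance, yet every exceptional event has to fit into
  O(n^(-\<delta>)), so laws of large numbers are needed with a polynomial rate. A moment of order p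
  bounds the rejection probability at the threshold n^\<theta> of Algorithm 1 by a multiple of n^(1
  - p \<theta>), and \<open>kappa0\<close> is chosen so that some available p has p \<theta> > 1.
  In- and out-degrees are sampled independently, so the mean offspring number of a tree individual,
  the sum of N_i D_i over L_n, is near \<mu>^2 / \<mu> = \<mu>. It is only kept below some m >
  \<mu>; the strict bound on h leaves room for such an m. After a break the joint law of graph and
  tree is arbitrary. The error event is therefore covered by one event on node and graph and one on
  node and exploration, whose laws are determined. The graph is independent of node 1 by deferred
  decisions: each exploration step pairs an inbound stub with a uniform unpaired outbound stub, and
  the order of pairing does not influence the law.\<close>

lemma slowly_varying_ratio:
  assumes "slowly_varying L" "q > 1"
  shows "\<exists>m0. \<forall>m\<ge>m0. L (2 ^ Suc m) \<le> q * \<bar>L (2 ^ m)\<bar>"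
proof -
  have "((\<lambda>x. L (2 * x) / L x) \<longlongrightarrow> 1) at_top"
    using assms by (auto simp: slowly_varying_def)
  moreover have "filterlim (\<lambda>m::nat. (2::real) ^ m) at_top sequentially"
    by (simp add: filterlim_at_top_dense Archimedean_eventually_pow)
  ultimately have "(\<lambda>m. L (2 * 2 ^ m) / L (2 ^ m)) \<longlonglongrightarrow> 1"
    by (rule filterlim_compose)
  hence lim: "(\<lambda>m. L (2 ^ Suc m) / L (2 ^ m)) \<longlonglongrightarrow> 1" by simp
  have "eventually (\<lambda>m. L (2 ^ Suc m) / L (2 ^ m) < q) sequentially"
    using order_tendstoD(2)[OF lim assms(2)] .
  moreover have "eventually (\<lambda>m. L (2 ^ Suc m) / L (2 ^ m) > 0) sequentially"
    using order_tendstoD(1)[OF lim] by simp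
  ultimately have "eventually (\<lambda>m. L (2 ^ Suc m) \<le> q * \<bar>L (2 ^ m)\<bar>) sequentially"
  proof eventually_elim
    case (elim m)
    \<comment> \<open>A quotient by 0 would be 0, so the positive ratio excludes a zero of
      \<open>L\<close>. Its sign stays open, whence the absolute value in the bound.\<close>
    have "L (2 ^ m) \<noteq> 0" using elim by auto
    have "L (2 ^ Suc m) = L (2 ^ Suc m) / L (2 ^ m) * L (2 ^ m)" using \<open>L (2 ^ m) \<noteq> 0\<close> by simp
    also have "\<dots> \<le> L (2 ^ Suc m) / L (2 ^ m) * \<bar>L (2 ^ m)\<bar>"
      using elim by (intro mult_left_mono) auto
    also have "\<dots> \<le> q * \<bar>L (2 ^ m)\<bar>" using elim by (intro mult_right_mono) auto
    finally show ?case .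
  qed
  thus ?thesis by (simp add: eventually_sequentially)
qed

text \<open>The slowly varying factor need not be measurable, so Potter bounds are not available; it is
  only compared along the powers of two.\<close>

lemma tail_bound_moment:
  assumes "slowly_varying L" "tail_bound F a L" "0 < p" "p < a"
  shows "integrable (measure_pmf F) (\<lambda>j. real j powr p)"
proof -
  define b where "b m = 2 powr (real (Suc m) * p) * measure_pmf.prob F {j. real j > 2 ^ m}" for m :: nat
  define b' where "b' m = 2 powr (real (Suc m) * p) * ((2 ^ m) powr (- a) * L (2 ^ m))" for m :: nat
  \<comment> \<open>From one dyadic level to the next \<open>b'\<close> changes by the factor 2 powr
    (p - a) times the ratio of \<open>L\<close>. Half of the exponent is spent on that ratio, which
    leaves 2 powr ((p - a) / 2) < 1.\<close>
  define q where "q = (2::real) powr ((a - p) / 2)"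
  have q: "q > 1" using assms by (simp add: q_def)
  have bb': "b m \<le> b' m" for m
    using assms(2)[unfolded tail_bound_def, rule_format, of "2 ^ m"]
    unfolding b_def b'_def by (intro mult_left_mono) simp_all
  have b0: "b m \<ge> 0" for m by (simp add: b_def)
  have b'0: "b' m \<ge> 0" for m using bb' b0 order_trans by blast
  \<comment> \<open>A probability lies below the tail bound, which forces \<open>L\<close> to be
    nonnegative at the powers of two and removes the absolute value.\<close>
  have L0: "L (2 ^ m) \<ge> 0" for m
    using b'0[of m] by (auto simp: b'_def zero_le_mult_iff)
  obtain m0 where m0: "\<And>m. m \<ge> m0 \<Longrightarrow> L (2 ^ Suc m) \<le> q * \<bar>L (2 ^ m)\<bar>"
    using slowly_varying_ratio[OF assms(1) q] by blast
  have "summable b'"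
  proof (rule summable_ratio_test[of "2 powr ((p - a) / 2)" m0])
    show "2 powr ((p - a) / 2) < 1" using assms by (simp add: powr_less_one)
    fix m assume "m \<ge> m0"
    have "b' (Suc m) = 2 powr (real (Suc (Suc m)) * p) * (2 ^ Suc m) powr (- a) * L (2 ^ Suc m)"
      by (simp add: b'_def)
    also have "\<dots> \<le> 2 powr (real (Suc (Suc m)) * p) * (2 ^ Suc m) powr (- a) * (q * \<bar>L (2 ^ m)\<bar>)"
      using m0[OF \<open>m \<ge> m0\<close>] by (intro mult_left_mono) auto
    also have "\<dots> = (2 powr ((p - a)/2)) * b' m"
    proof -
      have "2 powr (real (Suc (Suc m)) * p) * (2 ^ Suc m) powr (- a) * q
          = 2 powr ((p - a)/2) * 2 powr (real (Suc m) * p) * (2 ^ m) powr (- a)"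
        by (simp add: q_def powr_realpow[symmetric] powr_powr powr_add[symmetric] del: power_Suc of_nat_Suc)
           (simp add: field_simps)
      thus ?thesis using L0[of m] by (simp add: b'_def mult_ac)
    qed
    finally show "norm (b' (Suc m)) \<le> 2 powr ((p - a)/2) * norm (b' m)"
      using b'0 by simp
  qed
  hence sb: "summable b" using bb' b0 by (intro summable_comparison_test'[of b' 0 b]) auto
  \<comment> \<open>The summand 1 pays for j \<le> 1. Any other j lies in one block 2^m < j \<le>
    2^(m+1), and the term of that block alone dominates.\<close>
  have pt: "ennreal (real j powr p) \<le> 1 + (\<Sum>m. ennreal (2 powr (real (Suc m) * p)) * indicator {j. real j > 2 ^ m} j)" for j
  proof (cases "j \<le> 1")
    case True
    hence "real j powr p \<le> 1" using assms by (cases "j = 0") (auto simp: le_Suc_eq)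
    hence "ennreal (real j powr p) \<le> 1" by simp
    thus ?thesis by (rule order_trans) simp
  next
    case False
    define m where "m = (LEAST m. real j \<le> 2 ^ Suc m)"
    have ex: "\<exists>m. real j \<le> 2 ^ Suc m"
      by (rule exI[of _ j]) (metis less_imp_le nat_less_le of_nat_le_numeral_power_cancel_iff less_exp le_SucI power_Suc lessI less_trans power_strict_increasing one_less_numeral_iff semiring_norm(76))
    have m1: "real j \<le> 2 ^ Suc m" unfolding m_def using ex by (rule LeastI_ex)
    have m2: "real j > 2 ^ m"
    proof (cases m)
      case 0 thus ?thesis using False by simp
    next
      case (Suc m')
      hence "m' < m" by simp
      hence "\<not> real j \<le> 2 ^ Suc m'" unfolding m_def by (rule not_less_Least)
      thus ?thesis using Suc by simp
    qed
    have "real j powr p \<le> (2 ^ Suc m) powr p" using m1 assms by (intro powr_mono2) auto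
    also have "\<dots> = 2 powr (real (Suc m) * p)"
      by (simp add: powr_realpow[symmetric] powr_powr del: power_Suc of_nat_Suc)
    finally have "ennreal (real j powr p) \<le> ennreal (2 powr (real (Suc m) * p)) * indicator {j. real j > 2 ^ m} j"
      using m2 by (simp add: ennreal_leI)
    also have "\<dots> = (\<Sum>i\<in>{m}. ennreal (2 powr (real (Suc i) * p)) * indicator {j. real j > 2 ^ i} j)"
      by (simp only: sum.insert sum.empty finite.emptyI empty_iff not_False_eq_True add_0_right)
    also have "\<dots> \<le> (\<Sum>i. ennreal (2 powr (real (Suc i) * p)) * indicator {j. real j > 2 ^ i} j)"
      by (rule sum_le_suminf) auto
    also have "\<dots> \<le> 1 + \<dots>" by simp
    finally show ?thesis .
  qed
  have "(\<integral>\<^sup>+j. ennreal (real j powr p) \<partial>F) \<le>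
      (\<integral>\<^sup>+j. 1 + (\<Sum>m. ennreal (2 powr (real (Suc m) * p)) * indicator {j. real j > 2 ^ m} j) \<partial>F)"
    by (intro nn_integral_mono pt)
  also have "\<dots> = 1 + (\<Sum>m. ennreal (2 powr (real (Suc m) * p)) * emeasure F {j. real j > 2 ^ m})"
    by (simp add: nn_integral_add nn_integral_suminf nn_integral_cmult)
  also have "\<dots> = 1 + (\<Sum>m. ennreal (b m))"
    by (simp add: b_def ennreal_mult measure_pmf.emeasure_eq_measure)
  also have "\<dots> < \<infinity>"
    using sb b0 by (simp add: suminf_ennreal2)
  finally show ?thesis by (intro integrableI_nonneg) auto
qed

section \<open>A law of large numbers with a polynomial rate\<close>

text \<open>After division by x + y the claim reduces to t \<le> t powr q on the unit
  interval.\<close>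

lemma powr_diff_le:
  fixes x y q :: real
  assumes "0 \<le> x" "0 \<le> y" "0 < q" "q \<le> 1"
  shows "(x + y) powr q \<le> x powr q + y powr q"
proof (cases "x + y = 0")
  case False
  hence s: "x + y > 0" using assms by linarith
  have a: "t \<le> t powr q" if "0 \<le> t" "t \<le> 1" for t :: real
    using that assms powr_mono'[of q 1 t] by (cases "t = 0") auto
  have "1 = x / (x+y) + y / (x+y)" using s by (simp add: add_divide_distrib[symmetric])
  also have "\<dots> \<le> (x / (x+y)) powr q + (y / (x+y)) powr q"
    using s assms by (intro add_mono a) auto
  also have "\<dots> = (x powr q + y powr q) / (x+y) powr q"
    using assms by (simp add: powr_divide add_divide_distrib)
  finally show ?thesis using s by (simp add: field_simps)
qed (use assms in auto)

text \<open>For q = p - 1 this is, up to the factor p, the Hoelder continuity of the derivative of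
  |x| powr p. The factor 2 is due to arguments of opposite sign, where |x - y| is the sum of both
  absolute values; equal signs need only the factor 1.\<close>

lemma sgn_powr_Hoelder:
  fixes x y q :: real
  assumes "0 < q" "q \<le> 1"
  shows "\<bar>sgn x * \<bar>x\<bar> powr q - sgn y * \<bar>y\<bar> powr q\<bar> \<le> 2 * \<bar>x - y\<bar> powr q"
proof -
  have same: "\<bar>u powr q - v powr q\<bar> \<le> \<bar>u - v\<bar> powr q" if "0 \<le> u" "0 \<le> v" for u v :: real
  proof (cases "u \<le> v")
    case True
    have "v powr q \<le> u powr q + (v - u) powr q" using powr_diff_le[of u "v - u" q] assms that True by simp
    moreover have "u powr q \<le> v powr q" using True that assms by (intro powr_mono2) auto
    ultimately show ?thesis using True by simp
  next
    case False
    have "u powr q \<le> v powr q + (u - v) powr q" using powr_diff_le[of v "u - v" q] assms that False by simp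
    moreover have "v powr q \<le> u powr q" using False that assms by (intro powr_mono2) auto
    ultimately show ?thesis using False by simp
  qed
  have diff: "u powr q + v powr q \<le> 2 * (u + v) powr q" if "0 \<le> u" "0 \<le> v" for u v :: real
    using that assms powr_mono2[of q u "u+v"] powr_mono2[of q v "u+v"] by auto
  have nn: "\<bar>x - y\<bar> powr q \<ge> 0" by simp
  consider "x > 0" "y > 0" | "x > 0" "y < 0" | "x < 0" "y > 0" | "x < 0" "y < 0" | "x = 0" | "y = 0" by linarith
  thus ?thesis
  proof cases
    case 1 thus ?thesis using same[of x y] nn by simp
  next
    case 2 thus ?thesis using diff[of x "-y"] by simp
  next
    case 3 thus ?thesis using diff[of "-x" y] by (simp add: abs_minus_commute)
  next
    case 4 thus ?thesis using same[of "-x" "-y"] nn by (simp add: abs_minus_commute)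
  qed (auto simp: sgn_if)
qed

lemma DERIV_abs_powr:
  fixes x p :: real
  assumes "p > 1"
  shows "((\<lambda>x. \<bar>x\<bar> powr p) has_real_derivative p * (sgn x * \<bar>x\<bar> powr (p - 1))) (at x)"
proof -
  consider "x > 0" | "x < 0" | "x = 0" by linarith
  thus ?thesis
  proof cases
    case 1
    have "((\<lambda>x. x powr p) has_real_derivative p * x powr (p - 1)) (at x)"
      using 1 by (auto intro!: derivative_eq_intros)
    hence "((\<lambda>x. \<bar>x\<bar> powr p) has_real_derivative p * x powr (p - 1)) (at x)"
      by (rule has_field_derivative_transform_within[where d = x]) (use 1 in \<open>auto simp: dist_real_def\<close>)
    thus ?thesis using 1 by simp
  next
    case 2
    have "((\<lambda>x. (-x) powr p) has_real_derivative - (p * (-x) powr (p - 1))) (at x)"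
      using 2 by (auto intro!: derivative_eq_intros)
    hence "((\<lambda>x. \<bar>x\<bar> powr p) has_real_derivative - (p * (-x) powr (p - 1))) (at x)"
      by (rule has_field_derivative_transform_within[where d = "-x"]) (use 2 in \<open>auto simp: dist_real_def\<close>)
    thus ?thesis using 2 by simp
  next
    case 3
    have "((\<lambda>h. \<bar>h\<bar> powr (p - 1)) \<longlongrightarrow> \<bar>0::real\<bar> powr (p - 1)) (at 0)"
      using assms by (intro tendsto_powr' tendsto_intros) auto
    hence lim: "((\<lambda>h. \<bar>h\<bar> powr (p - 1)) \<longlongrightarrow> 0) (at (0::real))" by simp
    have "((\<lambda>h. \<bar>h\<bar> powr p / h) \<longlongrightarrow> 0) (at (0::real))"
    proof (rule Lim_null_comparison[OF _ lim])
      show "\<forall>\<^sub>F h in at (0::real). norm (\<bar>h\<bar> powr p / h) \<le> \<bar>h\<bar> powr (p - 1)"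
        by (auto simp: eventually_at_filter powr_diff abs_divide intro!: always_eventually)
    qed
    thus ?thesis using 3 by (simp add: has_field_derivative_iff)
  qed
qed

text \<open>A first-order Taylor estimate whose remainder has order |b| powr p: the mean value
  theorem yields the derivative at some a + z b, and Hoelder continuity compares it with the
  derivative at a. It replaces the expansion of the square in the computation of a variance.\<close>

lemma abs_powr_add_le:
  fixes a b p :: real
  assumes "1 < p" "p \<le> 2"
  shows "\<bar>a + b\<bar> powr p \<le> \<bar>a\<bar> powr p + p * (sgn a * \<bar>a\<bar> powr (p - 1)) * b + 2 * p * \<bar>b\<bar> powr p"
proof (cases "b = 0")
  case False
  define g where "g x = p * (sgn x * \<bar>x\<bar> powr (p - 1))" for x :: real
  define f where "f t = \<bar>a + t * b\<bar> powr p" for t :: real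
  have der: "(f has_real_derivative b * g (a + t * b)) (at t)" for t
  proof -
    have "((\<lambda>x. \<bar>x\<bar> powr p) has_real_derivative g (a + t * b)) (at (a + t * b))"
      unfolding g_def by (rule DERIV_abs_powr[OF assms(1)])
    moreover have "((\<lambda>t. a + t * b) has_real_derivative b) (at t)"
      by (auto intro!: derivative_eq_intros)
    ultimately have "((\<lambda>t. \<bar>a + t * b\<bar> powr p) has_real_derivative g (a + t * b) * b) (at t)"
      by (rule DERIV_chain2[where f = "\<lambda>x. \<bar>x\<bar> powr p" and g = "\<lambda>t. a + t * b"])
    thus ?thesis unfolding f_def by (simp add: mult.commute)
  qed
  obtain z where z: "0 < z" "z < 1" "f 1 - f 0 = (1 - 0) * (b * g (a + z * b))"
    using MVT2[of 0 1 f "\<lambda>t. b * g (a + t * b)"] der by auto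
  have "\<bar>g (a + z * b) - g a\<bar> \<le> p * (2 * \<bar>z * b\<bar> powr (p - 1))"
    using sgn_powr_Hoelder[of "p - 1" "a + z * b" a] assms
    by (simp add: g_def right_diff_distrib[symmetric] abs_mult)
  also have "\<dots> \<le> p * (2 * \<bar>b\<bar> powr (p - 1))"
    using assms z by (intro mult_left_mono powr_mono2) (auto simp: abs_mult mult_left_le_one_le)
  finally have "\<bar>b\<bar> * \<bar>g (a + z * b) - g a\<bar> \<le> \<bar>b\<bar> * (p * (2 * \<bar>b\<bar> powr (p - 1)))"
    by (intro mult_left_mono) auto
  also have "\<dots> = 2 * p * \<bar>b\<bar> powr p"
    using False by (simp add: powr_diff)
  finally have "b * (g (a + z * b) - g a) \<le> 2 * p * \<bar>b\<bar> powr p"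
    using abs_ge_self[of "b * (g (a + z * b) - g a)"] by (simp add: abs_mult)
  moreover have "\<bar>a + b\<bar> powr p = \<bar>a\<bar> powr p + b * g (a + z * b)"
    using z by (simp add: f_def)
  moreover have "p * (sgn a * \<bar>a\<bar> powr (p - 1)) * b = b * g a" by (simp add: g_def)
  ultimately show ?thesis unfolding right_diff_distrib by linarith
qed simp

text \<open>As \<open>X\<close> is centred, the term linear in \<open>b\<close> of the preceding inequality disappears when it is
  integrated over the newest summand.\<close>

lemma von_Bahr_Esseen:
  fixes X :: "'a \<Rightarrow> real" and F :: "'a pmf"
  assumes p: "1 < p" "p \<le> 2" and I: "finite I"
    and int: "integrable (measure_pmf F) X" and mean: "measure_pmf.expectation F X = 0"
    and intp: "integrable (measure_pmf F) (\<lambda>x. \<bar>X x\<bar> powr p)"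
  shows "(\<integral>\<^sup>+f. ennreal (\<bar>\<Sum>i\<in>I. X (f i)\<bar> powr p) \<partial>Pi_pmf I d (\<lambda>_. F))
      \<le> ennreal (real (card I) * (2 * p * measure_pmf.expectation F (\<lambda>x. \<bar>X x\<bar> powr p)))"
  using I
proof (induction I rule: finite_induct)
  case (insert i I)
  let ?m = "measure_pmf.expectation F (\<lambda>x. \<bar>X x\<bar> powr p)"
  have m0: "?m \<ge> 0" by (rule integral_nonneg_AE) auto
  have inner: "(\<integral>\<^sup>+y. ennreal (\<bar>s + X y\<bar> powr p) \<partial>F) \<le> ennreal (\<bar>s\<bar> powr p + 2 * p * ?m)" for s
  proof -
    let ?R = "\<lambda>y. \<bar>s\<bar> powr p + p * (sgn s * \<bar>s\<bar> powr (p - 1)) * X y + 2 * p * \<bar>X y\<bar> powr p"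
    have le: "\<bar>s + X y\<bar> powr p \<le> ?R y" for y by (rule abs_powr_add_le[OF p])
    have ir: "integrable (measure_pmf F) ?R" using int intp by auto
    have "(\<integral>\<^sup>+y. ennreal (\<bar>s + X y\<bar> powr p) \<partial>F) \<le> (\<integral>\<^sup>+y. ennreal (?R y) \<partial>F)"
      by (intro nn_integral_mono ennreal_leI le)
    also have "\<dots> = ennreal (measure_pmf.expectation F ?R)"
      by (rule nn_integral_eq_integral[OF ir]) (intro AE_I2 order_trans[OF _ le], simp)
    also have "measure_pmf.expectation F ?R = \<bar>s\<bar> powr p + 2 * p * ?m"
      using int intp mean by simp
    finally show ?thesis .
  qed
  have "(\<integral>\<^sup>+f. ennreal (\<bar>\<Sum>j\<in>insert i I. X (f j)\<bar> powr p) \<partial>Pi_pmf (insert i I) d (\<lambda>_. F))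
     = (\<integral>\<^sup>+f. (\<integral>\<^sup>+y. ennreal (\<bar>(\<Sum>j\<in>I. X (f j)) + X y\<bar> powr p) \<partial>F) \<partial>Pi_pmf I d (\<lambda>_. F))"
  proof -
    have *: "(\<Sum>j\<in>I. X (if j = i then y else f j)) = (\<Sum>j\<in>I. X (f j))" for f y
      using insert.hyps by (intro sum.cong) auto
    show ?thesis
      using insert.hyps
      by (subst Pi_pmf_insert, simp, simp, subst pair_commute_pmf)
         (simp add: nn_integral_pair_pmf' case_prod_unfold fun_upd_def * add.commute)
  qed
  also have "\<dots> \<le> (\<integral>\<^sup>+f. ennreal (\<bar>\<Sum>j\<in>I. X (f j)\<bar> powr p + 2 * p * ?m) \<partial>Pi_pmf I d (\<lambda>_. F))"
    by (intro nn_integral_mono inner)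
  also have "\<dots> = (\<integral>\<^sup>+f. ennreal (\<bar>\<Sum>j\<in>I. X (f j)\<bar> powr p) \<partial>Pi_pmf I d (\<lambda>_. F)) + ennreal (2 * p * ?m)"
    using m0 p by (simp add: ennreal_plus nn_integral_add)
  also have "\<dots> \<le> ennreal (real (card I) * (2 * p * ?m)) + ennreal (2 * p * ?m)"
    using insert.IH by (rule add_right_mono)
  also have "\<dots> = ennreal (real (card (insert i I)) * (2 * p * ?m))"
    using m0 p insert.hyps by (simp add: ennreal_plus[symmetric] algebra_simps del: ennreal_plus)
  finally show ?case .
qed simp

text \<open>Markov's inequality, phrased with the nonnegative integral because the moment bounds
  arrive in that form.\<close>

lemma prob_le_of_nn_integral:
  fixes M :: "'a pmf" and Y :: "'a \<Rightarrow> real"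
  assumes "(\<integral>\<^sup>+x. ennreal (Y x) \<partial>M) \<le> ennreal b" "t > 0" "b \<ge> 0"
  shows "measure_pmf.prob M {x. Y x \<ge> t} \<le> b / t"
proof -
  have "emeasure M {x. Y x \<ge> t} = (\<integral>\<^sup>+x. indicator {x. Y x \<ge> t} x \<partial>M)" by simp
  also have "\<dots> \<le> (\<integral>\<^sup>+x. ennreal (inverse t) * ennreal (Y x) \<partial>M)"
  proof (rule nn_integral_mono)
    fix x
    show "indicator {x. Y x \<ge> t} x \<le> ennreal (inverse t) * ennreal (Y x)"
      using assms(2) by (auto simp: indicator_def ennreal_mult''[symmetric] field_simps)
  qed
  also have "\<dots> = ennreal (inverse t) * (\<integral>\<^sup>+x. ennreal (Y x) \<partial>M)" by (simp add: nn_integral_cmult)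
  also have "\<dots> \<le> ennreal (inverse t) * ennreal b" using assms(1) by (intro mult_left_mono) auto
  also have "\<dots> = ennreal (b / t)" using assms by (simp add: ennreal_mult''[symmetric] field_simps)
  finally show ?thesis using assms by (simp add: measure_pmf.emeasure_eq_measure)
qed

text \<open>Markov's inequality for the p-th power of the centred sum. The constant is uniform in n
  and t, so that t can be taken linear in n as well as equal to the sublinear acceptance
  threshold.\<close>

lemma weak_law_rate:
  fixes X :: "'a \<Rightarrow> real" and F :: "'a pmf"
  assumes p: "1 < p" "p \<le> 2"
    and intp: "integrable (measure_pmf F) (\<lambda>x. \<bar>X x\<bar> powr p)"
    and int: "integrable (measure_pmf F) X" and mean: "measure_pmf.expectation F X = m"
  obtains C where "C \<ge> 0" "\<And>(n::nat) t. t > 0 \<Longrightarrow>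
     measure_pmf.prob (Pi_pmf {..<n} d (\<lambda>_. F)) {f. \<bar>(\<Sum>i<n. X (f i)) - real n * m\<bar> > t} \<le> C * real n * t powr (- p)"
proof -
  define Y where "Y x = X x - m" for x
  have intY: "integrable (measure_pmf F) Y" unfolding Y_def using int by auto
  have meanY: "measure_pmf.expectation F Y = 0" unfolding Y_def using int mean by simp
  have bd: "\<bar>Y x\<bar> powr p \<le> 2 powr p * (\<bar>X x\<bar> powr p + \<bar>m\<bar> powr p)" for x
  proof -
    have "\<bar>Y x\<bar> powr p \<le> (2 * max \<bar>X x\<bar> \<bar>m\<bar>) powr p"
      using p by (intro powr_mono2) (auto simp: Y_def)
    also have "\<dots> = 2 powr p * (max \<bar>X x\<bar> \<bar>m\<bar>) powr p" by (simp add: powr_mult)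
    also have "\<dots> \<le> 2 powr p * (\<bar>X x\<bar> powr p + \<bar>m\<bar> powr p)"
      by (intro mult_left_mono) (auto simp: max_def)
    finally show ?thesis .
  qed
  have intYp: "integrable (measure_pmf F) (\<lambda>x. \<bar>Y x\<bar> powr p)"
    by (rule Bochner_Integration.integrable_bound[where f = "\<lambda>x. 2 powr p * (\<bar>X x\<bar> powr p + \<bar>m\<bar> powr p)"])
       (use intp bd in auto)
  define C where "C = 2 * p * measure_pmf.expectation F (\<lambda>x. \<bar>Y x\<bar> powr p)"
  have C0: "C \<ge> 0" unfolding C_def using p by (auto intro!: mult_nonneg_nonneg integral_nonneg_AE)
  show thesis
  proof (rule that[of C])
    fix n :: nat and t :: real assume t: "t > 0"
    let ?P = "Pi_pmf {..<n} d (\<lambda>_. F)"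
    have "(\<integral>\<^sup>+f. ennreal (\<bar>\<Sum>i<n. Y (f i)\<bar> powr p) \<partial>?P) \<le> ennreal (real n * C)"
      using von_Bahr_Esseen[OF p _ intY meanY intYp, of "{..<n}" d] by (simp add: C_def)
    hence "measure_pmf.prob ?P {f. \<bar>\<Sum>i<n. Y (f i)\<bar> powr p \<ge> t powr p} \<le> real n * C / t powr p"
      using C0 t by (intro prob_le_of_nn_integral) auto
    moreover have "measure_pmf.prob ?P {f. \<bar>(\<Sum>i<n. X (f i)) - real n * m\<bar> > t}
        \<le> measure_pmf.prob ?P {f. \<bar>\<Sum>i<n. Y (f i)\<bar> powr p \<ge> t powr p}"
      using t p by (intro measure_pmf.finite_measure_mono) (auto simp: Y_def sum_subtractf intro!: powr_mono2)
    ultimately show "measure_pmf.prob ?P {f. \<bar>(\<Sum>i<n. X (f i)) - real n * m\<bar> > t} \<le> C * real n * t powr (- p)"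
      by (simp add: powr_minus field_simps)
  qed (rule C0)
qed

text \<open>Turns the two independent sequences into one i.i.d. sequence of pairs, so that the mixed
  sums of \<open>x i * y i\<close> also fall under the weak law.\<close>

lemma pair_Pi_pmf:
  assumes "finite I"
  shows "pair_pmf (Pi_pmf I d1 p) (Pi_pmf I d2 q)
       = map_pmf (\<lambda>f. (\<lambda>i. fst (f i), \<lambda>i. snd (f i))) (Pi_pmf I (d1, d2) (\<lambda>i. pair_pmf (p i) (q i)))"
proof (rule pmf_eqI)
  fix z :: "('a \<Rightarrow> 'b) \<times> ('a \<Rightarrow> 'c)"
  obtain x y where z: "z = (x, y)" by (cases z)
  have inj: "inj (\<lambda>f::'a \<Rightarrow> 'b \<times> 'c. (\<lambda>i. fst (f i), \<lambda>i. snd (f i)))"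
    by (auto simp: inj_def fun_eq_iff prod_eq_iff)
  have "pmf (map_pmf (\<lambda>f. (\<lambda>i. fst (f i), \<lambda>i. snd (f i))) (Pi_pmf I (d1, d2) (\<lambda>i. pair_pmf (p i) (q i)))) z
     = pmf (Pi_pmf I (d1, d2) (\<lambda>i. pair_pmf (p i) (q i))) (\<lambda>i. (x i, y i))"
    using pmf_map_inj'[OF inj, of _ "\<lambda>i. (x i, y i)"] by (simp add: z)
  also have "\<dots> = pmf (Pi_pmf I d1 p) x * pmf (Pi_pmf I d2 q) y"
    using assms by (simp add: pmf_Pi pmf_pair prod.distrib) blast
  finally show "pmf (pair_pmf (Pi_pmf I d1 p) (Pi_pmf I d2 q)) z = pmf (map_pmf (\<lambda>f. (\<lambda>i. fst (f i), \<lambda>i. snd (f i))) (Pi_pmf I (d1, d2) (\<lambda>i. pair_pmf (p i) (q i)))) z"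
    by (simp add: z pmf_pair)
qed

section \<open>Uniform pairings\<close>

lemma prob_bind_pmf:
  "measure_pmf.prob (bind_pmf p f) B = measure_pmf.expectation p (\<lambda>x. measure_pmf.prob (f x) B)"
proof -
  have *: "measure_pmf.prob q B = pmf (map_pmf (\<lambda>x. x \<in> B) q) True" for q
    by (subst pmf_map) (simp add: vimage_def)
  show ?thesis by (simp only: * map_bind_pmf pmf_bind)
qed

lemma prob_bind_pmf_of_set:
  assumes "A \<noteq> {}" "finite A"
  shows "measure_pmf.prob (bind_pmf (pmf_of_set A) f) B
       = (\<Sum>a\<in>A. measure_pmf.prob (f a) B) / real (card A)"
  using assms by (simp add: prob_bind_pmf integral_pmf_of_set)

text \<open>Both sides average \<open>f\<close> over the ordered pairs off the diagonal. This
  exchange of two draws is the elementary step behind the irrelevance of the pairing order; two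
  elements are required so that the second draw has a nonempty range.\<close>

lemma bind_pmf_of_set_swap:
  assumes "finite A" "card A \<ge> 2"
  shows "bind_pmf (pmf_of_set A) (\<lambda>s. bind_pmf (pmf_of_set (A - {s})) (\<lambda>t. f s t))
       = bind_pmf (pmf_of_set A) (\<lambda>t. bind_pmf (pmf_of_set (A - {t})) (\<lambda>s. f s t))"
proof (rule pmf_eqI)
  fix z
  have ne: "A \<noteq> {}" using assms by auto
  have ne': "A - {s} \<noteq> {}" if "s \<in> A" for s
  proof -
    have "card (A - {s}) \<noteq> 0" using assms that by (simp add: card_Diff_singleton)
    thus ?thesis by (metis card.empty)
  qed
  have "(\<Sum>s\<in>A. \<Sum>t\<in>A - {s}. pmf (f s t) z) = (\<Sum>s\<in>A. \<Sum>t\<in>A. if s = t then 0 else pmf (f s t) z)"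
    using assms by (intro sum.cong refl sum.mono_neutral_cong_left) auto
  also have "\<dots> = (\<Sum>t\<in>A. \<Sum>s\<in>A. if s = t then 0 else pmf (f s t) z)" by (rule sum.swap)
  also have "\<dots> = (\<Sum>t\<in>A. \<Sum>s\<in>A - {t}. pmf (f s t) z)"
    using assms by (intro sum.cong refl sum.mono_neutral_cong_right) auto
  finally have eq: "(\<Sum>s\<in>A. \<Sum>t\<in>A - {s}. pmf (f s t) z) = (\<Sum>t\<in>A. \<Sum>s\<in>A - {t}. pmf (f s t) z)" .
  have *: "pmf (bind_pmf (pmf_of_set A) (\<lambda>s. bind_pmf (pmf_of_set (A - {s})) (g s))) z
      = (\<Sum>s\<in>A. \<Sum>t\<in>A - {s}. pmf (g s t) z) / real (card A - 1) / real (card A)" for g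
  proof -
    have "pmf (bind_pmf (pmf_of_set A) (\<lambda>s. bind_pmf (pmf_of_set (A - {s})) (g s))) z
        = (\<Sum>s\<in>A. pmf (bind_pmf (pmf_of_set (A - {s})) (g s)) z) / real (card A)"
      using assms ne by (simp add: pmf_bind_pmf_of_set)
    also have "(\<Sum>s\<in>A. pmf (bind_pmf (pmf_of_set (A - {s})) (g s)) z)
        = (\<Sum>s\<in>A. (\<Sum>t\<in>A - {s}. pmf (g s t) z) / real (card A - 1))"
      using assms ne' by (intro sum.cong refl) (simp add: pmf_bind_pmf_of_set card_Diff_singleton)
    finally show ?thesis by (simp only: sum_divide_distrib)
  qed
  show "pmf (bind_pmf (pmf_of_set A) (\<lambda>s. bind_pmf (pmf_of_set (A - {s})) (\<lambda>t. f s t))) z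
      = pmf (bind_pmf (pmf_of_set A) (\<lambda>t. bind_pmf (pmf_of_set (A - {t})) (\<lambda>s. f s t))) z"
    unfolding * eq ..
qed

text \<open>Rejection sampling: given a hit the element is uniform on \<open>B\<close>, and a miss
  is replaced by a fresh uniform draw from \<open>B\<close>. It describes the treatment of label 3
  in the graph.\<close>

lemma bind_pmf_of_set_redraw:
  assumes "finite A" "B \<subseteq> A" "B \<noteq> {}"
  shows "bind_pmf (pmf_of_set A) (\<lambda>s. if s \<in> B then f s else bind_pmf (pmf_of_set B) f)
       = bind_pmf (pmf_of_set B) f"
proof (rule pmf_eqI)
  fix z
  have fB: "finite B" and ne: "A \<noteq> {}" using assms finite_subset[OF assms(2,1)] by blast+
  define p where "p = (\<Sum>s\<in>B. pmf (f s) z)"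
  have cB: "card B > 0" "card A > 0" using fB assms ne by (auto simp: card_gt_0_iff)
  have "(\<Sum>s\<in>A. pmf (if s \<in> B then f s else bind_pmf (pmf_of_set B) f) z)
     = (\<Sum>s\<in>B. pmf (f s) z) + (\<Sum>s\<in>A - B. p / real (card B))"
    using assms fB by (subst sum.subset_diff[OF assms(2,1)]) (simp add: pmf_bind_pmf_of_set p_def)
  also have "\<dots> = p + (real (card A) - real (card B)) * (p / real (card B))"
    using assms fB card_mono[OF assms(1,2)] by (simp add: card_Diff_subset p_def of_nat_diff)
  also have "\<dots> = real (card A) * (p / real (card B))"
    using cB by (simp add: field_simps)
  finally show "pmf (bind_pmf (pmf_of_set A) (\<lambda>s. if s \<in> B then f s else bind_pmf (pmf_of_set B) f)) z
     = pmf (bind_pmf (pmf_of_set B) f) z"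
    using assms fB ne cB by (simp add: pmf_bind_pmf_of_set p_def)
qed

lemma ran_upd: "x \<notin> dom G \<Longrightarrow> ran (G(x \<mapsto> s)) = insert s (ran G)"
  by (simp add: domIff)

text \<open>Any waiting inbound stub may be paired first: by induction it moves to the front of the
  tail, and then the two leading draws are exchanged. The length condition ensures that outbound
  stubs remain for every draw.\<close>

lemma pair_stubs_remove1:
  assumes "finite S" "distinct xs" "set xs \<inter> dom G = {}" "length xs \<le> card (S - ran G)" "x \<in> set xs"
  shows "pair_stubs S xs G
       = bind_pmf (pmf_of_set (S - ran G)) (\<lambda>s. pair_stubs S (remove1 x xs) (G(x \<mapsto> s)))"
  using assms
proof (induction xs arbitrary: G)
  case (Cons y ys)
  show ?case
  proof (cases "x = y")
    case False
    hence x: "x \<in> set ys" using Cons.prems by simp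
    hence y: "y \<notin> dom G" "x \<notin> dom G" "ys \<noteq> []" using Cons.prems by auto
    let ?A = "S - ran G"
    have fA: "finite ?A" and cA: "card ?A \<ge> 2"
      using Cons.prems y by (auto simp: neq_Nil_conv)
    have ne: "?A \<noteq> {}" using cA by (metis card.empty not_numeral_le_zero)
    have "pair_stubs S (y # ys) G = bind_pmf (pmf_of_set ?A) (\<lambda>s. pair_stubs S ys (G(y \<mapsto> s)))" by simp
    also have "\<dots> = bind_pmf (pmf_of_set ?A) (\<lambda>s. bind_pmf (pmf_of_set (?A - {s}))
        (\<lambda>t. pair_stubs S (remove1 x ys) (G(y \<mapsto> s, x \<mapsto> t))))"
    proof (rule bind_pmf_cong[OF refl])
      fix s assume "s \<in> set_pmf (pmf_of_set ?A)"
      hence s: "s \<in> ?A" using fA ne by simp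
      have r: "S - ran (G(y \<mapsto> s)) = ?A - {s}" using y by (auto simp: ran_upd)
      show "pair_stubs S ys (G(y \<mapsto> s)) = bind_pmf (pmf_of_set (?A - {s}))
        (\<lambda>t. pair_stubs S (remove1 x ys) (G(y \<mapsto> s, x \<mapsto> t)))"
        unfolding r[symmetric]
      proof (rule Cons.IH)
        show "length ys \<le> card (S - ran (G(y \<mapsto> s)))"
          unfolding r using Cons.prems s fA by (simp add: card_Diff_singleton)
        show "set ys \<inter> dom (G(y \<mapsto> s)) = {}" using Cons.prems by simp
      qed (use Cons.prems x in simp_all)
    qed
    also have "\<dots> = bind_pmf (pmf_of_set ?A) (\<lambda>t. bind_pmf (pmf_of_set (?A - {t}))
        (\<lambda>s. pair_stubs S (remove1 x ys) (G(y \<mapsto> s, x \<mapsto> t))))"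
      by (rule bind_pmf_of_set_swap[OF fA cA])
    also have "\<dots> = bind_pmf (pmf_of_set ?A) (\<lambda>t. pair_stubs S (remove1 x (y # ys)) (G(x \<mapsto> t)))"
    proof (rule bind_pmf_cong[OF refl])
      fix t
      have r: "S - ran (G(x \<mapsto> t)) = ?A - {t}" using y by (auto simp: ran_upd)
      show "bind_pmf (pmf_of_set (?A - {t})) (\<lambda>s. pair_stubs S (remove1 x ys) (G(y \<mapsto> s, x \<mapsto> t)))
        = pair_stubs S (remove1 x (y # ys)) (G(x \<mapsto> t))"
        using False by (simp add: r fun_upd_twist[of x y])
    qed
    finally show ?thesis .
  next
    case True
    thus ?thesis by (simp del: fun_upd_apply)
  qed
qed simp

lemma set_in_stubs: "set (in_stubs n N) = (SIGMA i:{..<n}. {..<N i})"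
  by (auto simp: in_stubs_def)

lemma distinct_in_stubs: "distinct (in_stubs n N)"
proof -
  have "distinct (concat (map (\<lambda>i. map (Pair i) [0..<N i]) [0..<n]))"
    by (induction n) (auto simp: distinct_map inj_on_def)
  thus ?thesis by (simp add: in_stubs_def)
qed

lemma length_in_stubs: "length (in_stubs n N) = (\<Sum>i<n. N i)"
  using distinct_card[OF distinct_in_stubs, of n N] by (simp add: set_in_stubs card_SigmaI)

lemma finite_out_stubs [simp]: "finite (out_stubs n D)"
  by (simp add: out_stubs_def)

lemma card_out_stubs: "card (out_stubs n D) = (\<Sum>i<n. D i)"
  by (simp add: out_stubs_def card_SigmaI)

lemma sum_out_stubs: "(\<Sum>s\<in>out_stubs n D. f (fst s)) = (\<Sum>i<n. real (D i) * f i)"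
proof -
  have "(\<Sum>s\<in>out_stubs n D. f (fst s)) = (\<Sum>(i, b)\<in>(SIGMA j:{..<n}. {..<D j}). f i)"
    by (simp add: out_stubs_def case_prod_unfold)
  also have "\<dots> = (\<Sum>i<n. \<Sum>b<D i. f i)" by (subst sum.Sigma) auto
  finally show ?thesis by simp
qed

text \<open>Equal sums leave as many unpaired inbound as outbound stubs. Hence the next draw is
  possible, and the stub chosen by the breadth-first order can be served now, whatever its place in
  \<open>in_stubs\<close>.\<close>

lemma complete_pairing_next:
  assumes "(\<Sum>i<n. N i) = (\<Sum>i<n. D i)"
    and "dom G \<subseteq> set (in_stubs n N)" "ran G \<subseteq> out_stubs n D" "card (ran G) = card (dom G)"
    and "x \<in> set (in_stubs n N)" "x \<notin> dom G"
  shows "complete_pairing n N D G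
       = bind_pmf (pmf_of_set (out_stubs n D - ran G)) (\<lambda>s. complete_pairing n N D (G(x \<mapsto> s)))"
    and "out_stubs n D - ran G \<noteq> {}"
proof -
  let ?xs = "filter (\<lambda>x. x \<notin> dom G) (in_stubs n N)"
  have fin: "finite (dom G)" "finite (ran G)"
    using finite_subset[OF assms(2)] finite_subset[OF assms(3)] by simp_all
  have "length ?xs = card (set ?xs)"
    by (rule distinct_card[symmetric]) (simp add: distinct_in_stubs)
  also have "set ?xs = set (in_stubs n N) - dom G" by auto
  also have "card \<dots> = (\<Sum>i<n. N i) - card (dom G)"
    using assms fin by (simp add: card_Diff_subset distinct_card[OF distinct_in_stubs] length_in_stubs)
  also have "\<dots> = card (out_stubs n D - ran G)"
    using assms fin by (simp add: card_Diff_subset card_out_stubs)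
  finally have len: "length ?xs = card (out_stubs n D - ran G)" .
  have x: "x \<in> set ?xs" using assms by simp
  have rem: "remove1 x ?xs = filter (\<lambda>z. z \<notin> dom (G(x \<mapsto> s))) (in_stubs n N)" for s
    using distinct_in_stubs[of n N]
    by (auto simp: distinct_remove1_removeAll removeAll_filter_not_eq intro!: filter_cong)
  have "pair_stubs (out_stubs n D) ?xs G = bind_pmf (pmf_of_set (out_stubs n D - ran G))
      (\<lambda>s. pair_stubs (out_stubs n D) (remove1 x ?xs) (G(x \<mapsto> s)))"
    by (rule pair_stubs_remove1) (use x len in \<open>auto simp: distinct_in_stubs\<close>)
  thus "complete_pairing n N D G
       = bind_pmf (pmf_of_set (out_stubs n D - ran G)) (\<lambda>s. complete_pairing n N D (G(x \<mapsto> s)))"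
    unfolding complete_pairing_def by (simp only: rem[symmetric])
  have "?xs \<noteq> []" using x by force
  thus "out_stubs n D - ran G \<noteq> {}" using len by (metis card.empty length_0_conv)
qed

lemma pair_stubs_extends:
  "set xs \<inter> dom G = {} \<Longrightarrow> G' \<in> set_pmf (pair_stubs S xs G) \<Longrightarrow> distinct xs \<Longrightarrow> G \<subseteq>\<^sub>m G'"
proof (induction xs arbitrary: G)
  case (Cons x xs)
  then obtain s where s: "G' \<in> set_pmf (pair_stubs S xs (G(x \<mapsto> s)))" by auto
  have "set xs \<inter> dom (G(x \<mapsto> s)) = {}" using Cons.prems by simp
  hence "G(x \<mapsto> s) \<subseteq>\<^sub>m G'" using Cons.prems s by (intro Cons.IH) (auto simp del: fun_upd_apply)
  moreover have "G \<subseteq>\<^sub>m G(x \<mapsto> s)" using Cons.prems(1) by (simp add: map_le_def dom_def)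
  ultimately show ?case using map_le_trans by blast
qed simp

lemma pair_stubs_support:
  assumes "G' \<in> set_pmf (pair_stubs S xs G)" "finite S" "distinct xs" "set xs \<inter> dom G = {}"
    "length xs \<le> card (S - ran G)" "ran G \<subseteq> S" "inj_on G (dom G)"
  shows "dom G' = dom G \<union> set xs \<and> ran G' \<subseteq> S \<and> inj_on G' (dom G')"
  using assms
proof (induction xs arbitrary: G)
  case (Cons x xs)
  have ne: "S - ran G \<noteq> {}" using Cons.prems by auto
  then obtain s where s: "s \<in> S - ran G" "G' \<in> set_pmf (pair_stubs S xs (G(x \<mapsto> s)))"
    using Cons.prems by (auto simp: set_pmf_of_set)
  have x: "x \<notin> dom G" using Cons.prems by auto
  have r: "S - ran (G(x \<mapsto> s)) = (S - ran G) - {s}" using x by (auto simp: ran_upd)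
  have "dom G' = dom (G(x \<mapsto> s)) \<union> set xs \<and> ran G' \<subseteq> S \<and> inj_on G' (dom G')"
  proof (rule Cons.IH[OF s(2)])
    show "length xs \<le> card (S - ran (G(x \<mapsto> s)))"
      unfolding r using Cons.prems s by (simp add: card_Diff_singleton)
    show "inj_on (G(x \<mapsto> s)) (dom (G(x \<mapsto> s)))"
    proof (rule inj_onI)
      fix y z assume "y \<in> dom (G(x \<mapsto> s))" "z \<in> dom (G(x \<mapsto> s))" "(G(x \<mapsto> s)) y = (G(x \<mapsto> s)) z"
      thus "y = z" using inj_onD[OF Cons.prems(7), of y z] s
        by (cases "y = x"; cases "z = x") (auto dest: ranI[of G] sym[of "Some s"])
    qed
    show "ran (G(x \<mapsto> s)) \<subseteq> S" using Cons.prems(6) s x by (simp add: ran_upd)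
    show "set xs \<inter> dom (G(x \<mapsto> s)) = {}" using Cons.prems by simp
  qed (use Cons.prems in simp_all)
  moreover have "dom (G(x \<mapsto> s)) \<union> set xs = dom G \<union> set (x # xs)" by simp
  ultimately show ?case by metis
qed simp

text \<open>Injectivity says that no outbound stub is used twice; it bounds the row sums of the
  PageRank matrix by c.\<close>

lemma complete_pairing_support:
  assumes "(\<Sum>i<n. N i) = (\<Sum>i<n. D i)" "G \<in> set_pmf (complete_pairing n N D Map.empty)"
  shows "dom G = (SIGMA i:{..<n}. {..<N i})" "ran G \<subseteq> out_stubs n D" "inj_on G (dom G)"
proof -
  have "dom G = dom (Map.empty :: pairing) \<union> set (in_stubs n N) \<and> ran G \<subseteq> out_stubs n D \<and> inj_on G (dom G)"
    using assms unfolding complete_pairing_def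
    by (intro pair_stubs_support[where xs = "in_stubs n N"])
       (simp_all add: distinct_in_stubs length_in_stubs card_out_stubs)
  thus "dom G = (SIGMA i:{..<n}. {..<N i})" "ran G \<subseteq> out_stubs n D" "inj_on G (dom G)"
    unfolding set_in_stubs dom_empty Un_empty_left by blast+
qed

lemma complete_pairing_extends:
  "G' \<in> set_pmf (complete_pairing n N D G) \<Longrightarrow> G \<subseteq>\<^sub>m G'"
  unfolding complete_pairing_def by (rule pair_stubs_extends) (auto simp: distinct_in_stubs)

section \<open>Growth of the tree beyond the joint exploration\<close>

lemma finite_offspring:
  assumes "finite (dom T)"
  shows "finite (offspring N T g)"
proof -
  have "offspring N T g \<subseteq> (\<Union>u\<in>dom T. (\<lambda>a. u @ [a]) ` {..<N (the (T u))})"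
  proof
    fix z assume "z \<in> offspring N T g"
    then obtain u a i where "z = u @ [a]" "T u = Some i" "a < N i" unfolding offspring_def by blast
    thus "z \<in> (\<Union>u\<in>dom T. (\<lambda>a. u @ [a]) ` {..<N (the (T u))})"
      by (intro UN_I[of u]) (simp_all add: domI)
  qed
  thus ?thesis by (rule finite_subset) (use assms in auto)
qed

text \<open>New individuals receive addresses outside the current domain, so the explored part
  survives in the final tree. Finiteness is carried along because the support of
  \<open>Pi_pmf\<close> is controlled through a finite index set.\<close>

lemma grow_tree_extends:
  "finite (dom T) \<Longrightarrow> T' \<in> set_pmf (grow_tree n N D g T) \<Longrightarrow> finite (dom T') \<and> T \<subseteq>\<^sub>m T'"
proof (induction g arbitrary: T')
  case (Suc g)
  then obtain T1 X where T1: "T1 \<in> set_pmf (grow_tree n N D g T)"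
    and X: "X \<in> set_pmf (Pi_pmf (offspring N T1 g - dom T1) None
                 (\<lambda>_. map_pmf (\<lambda>s. Some (fst s)) (pmf_of_set (out_stubs n D))))"
    and T': "T' = T1 ++ X"
    unfolding grow_tree.simps set_bind_pmf set_return_pmf by blast
  have T1': "finite (dom T1)" "T \<subseteq>\<^sub>m T1"
    using Suc.IH[OF Suc.prems(1) T1] by simp_all
  let ?I = "offspring N T1 g - dom T1"
  have fin: "finite ?I" using finite_offspring[OF T1'(1)] by simp
  have "X \<in> {f. \<forall>x. x \<notin> ?I \<longrightarrow> f x = None}"
    by (rule subsetD[OF set_Pi_pmf_subset[OF fin] X])
  hence X0: "dom X \<subseteq> ?I" unfolding mem_Collect_eq by (metis domIff subsetI)
  have "T1 \<subseteq>\<^sub>m T'" unfolding T'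
  proof (subst map_add_comm)
    show "dom T1 \<inter> dom X = {}" using X0 by blast
    show "T1 \<subseteq>\<^sub>m X ++ T1" by (rule map_le_map_add)
  qed
  moreover have "finite (dom X)" using X0 fin by (rule finite_subset)
  hence "finite (dom T')" using T1' by (simp add: T')
  ultimately show ?case using map_le_trans[OF T1'(2)] by simp
qed simp

section \<open>The joint exploration\<close>

text \<open>The states reached while the coupling is intact. Labels are determined by the attached
  nodes and the paired stubs; the queue is sorted by generation and spans at most two adjacent ones,
  which expresses breadth-first order. The payoff is \<open>processed\<close>: an inbound stub of a
  tree individual either still waits or is paired with a stub whose owner is the label of the
  corresponding child.\<close>

locale bfs_invariant =
  fixes n :: nat and N D :: "nat \<Rightarrow> nat" and E :: exploration
  assumes label_Fresh: "label_of E s = Fresh \<longleftrightarrow> fst s \<notin> ran (tree_of E)"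
    and label_Paired: "label_of E s = Paired \<longleftrightarrow> s \<in> ran (graph_of E)"
    and ran_graph: "ran (graph_of E) \<subseteq> out_stubs n D"
    and dom_graph: "dom (graph_of E) \<subseteq> set (in_stubs n N)"
    and card_graph: "card (ran (graph_of E)) = card (dom (graph_of E))"
    and ran_tree: "ran (tree_of E) \<subseteq> {..<n}"
    and owners: "fst ` dom (graph_of E) \<subseteq> ran (tree_of E)"
    and prefix_closed: "tree_of E (w @ [a]) \<noteq> None \<Longrightarrow> tree_of E w \<noteq> None"
    and distinct_queue: "distinct (map snd (queue_of E))"
    and queue: "(u, x) \<in> set (queue_of E) \<Longrightarrow> graph_of E x = None \<and> tree_of E u = None \<and>
        (\<exists>w i a. u = w @ [a] \<and> x = (i, a) \<and> tree_of E w = Some i \<and> a < N i)"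
    and sorted_queue: "sorted (map (length \<circ> fst) (queue_of E))"
    and queue_span: "p \<in> set (queue_of E) \<Longrightarrow> p' \<in> set (queue_of E) \<Longrightarrow> length (fst p') \<le> Suc (length (fst p))"
    and processed: "tree_of E w = Some i \<Longrightarrow> a < N i \<Longrightarrow>
        (w @ [a], (i, a)) \<in> set (queue_of E) \<or>
        (\<exists>j b. tree_of E (w @ [a]) = Some j \<and> graph_of E (i, a) = Some (j, b))"
begin

lemma head:
  assumes "queue_of E = (u, x) # q"
  obtains w i a where "u = w @ [a]" "x = (i, a)" "tree_of E w = Some i" "a < N i" "i < n"
    "graph_of E x = None" "tree_of E u = None" "x \<in> set (in_stubs n N)"
proof -
  have "(u, x) \<in> set (queue_of E)" using assms by simp
  then obtain w i a where *: "u = w @ [a]" "x = (i, a)" "tree_of E w = Some i" "a < N i"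
    "graph_of E x = None" "tree_of E u = None" using queue by meson
  have "i < n" using *(3) ran_tree by (auto dest: ranI)
  thus thesis using that * by (auto simp: set_in_stubs)
qed

text \<open>Preservation hinges on the owner j being new: by \<open>owners\<close> none of its
  inbound stubs is paired, and none can be queued, so its children enter without collision. As u is
  the head of a sorted queue, appending addresses one generation below u keeps order and
  span.\<close>

lemma attach:
  assumes q: "queue_of E = (u, x) # q" and s: "s \<in> out_stubs n D" "label_of E s = Fresh"
  shows "bfs_invariant n N D
    \<lparr> graph_of = (graph_of E)(x \<mapsto> s), tree_of = (tree_of E)(u \<mapsto> fst s),
      label_of = (\<lambda>t. if t = s then Paired else if fst t = fst s then Active else label_of E t),
      queue_of = q @ enqueue N u (fst s), broken = False \<rparr>"
proof -
  obtain w i a where h: "u = w @ [a]" "x = (i, a)" "tree_of E w = Some i" "a < N i" "i < n"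
    "graph_of E x = None" "tree_of E u = None" "x \<in> set (in_stubs n N)"
    using head[OF q] by blast
  define j where "j = fst s"
  have j: "j \<notin> ran (tree_of E)" using s label_Fresh by (simp add: j_def)
  have jn: "j < n" using s by (auto simp: j_def out_stubs_def)
  have rt: "ran ((tree_of E)(u \<mapsto> j)) = insert j (ran (tree_of E))" using h by simp
  have rg: "ran ((graph_of E)(x \<mapsto> s)) = insert s (ran (graph_of E))" using h by simp
  have sg: "s \<notin> ran (graph_of E)" using s label_Paired[of s] by simp
  have fin: "finite (dom (graph_of E))" "finite (ran (graph_of E))"
    using finite_subset[OF dom_graph] finite_subset[OF ran_graph] by simp_all
  have graph_j: "graph_of E (j, b) = None" for b
  proof (rule ccontr)
    assume "graph_of E (j, b) \<noteq> None"
    hence "(j, b) \<in> dom (graph_of E)" by blast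
    hence "fst (j, b) \<in> ran (tree_of E)" using owners by blast
    thus False using j by simp
  qed
  have ij: "i \<noteq> j" using h(3) j by (auto dest: ranI)
  have tree_child: "tree_of E (u @ [b]) = None" for b
    using prefix_closed[of u b] h(7) by blast
  have set_enq: "p \<in> set (enqueue N u j) \<longleftrightarrow> (\<exists>b<N j. p = (u @ [b], (j, b)))" for p
    by (auto simp: enqueue_def)
  have qE: "p \<in> set (queue_of E)" if "p \<in> set q" for p using that q by simp
  \<comment> \<open>An address determines its inbound stub: the owner is the label of the parent and
    the number is the last entry. A second occurrence of u would therefore repeat x.\<close>
  have uq: "(u, y) \<notin> set q" for y
  proof
    assume y: "(u, y) \<in> set q"
    from queue[OF qE[OF y]] have "y = x" using h by auto
    thus False using y distinct_queue q by (force simp: image_iff)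
  qed
  have lenq: "length (fst p) \<ge> length u" if "p \<in> set q" for p
    using sorted_queue that q by auto
  have lenq': "length (fst p) \<le> Suc (length u)" if "p \<in> set q" for p
    using queue_span[of "(u, x)" p] that q by auto
  show ?thesis
    unfolding j_def[symmetric]
  proof (unfold_locales, simp_all only: exploration.simps)
    fix t
    show "((if t = s then Paired else if fst t = j then Active else label_of E t) = Fresh)
        = (fst t \<notin> ran ((tree_of E)(u \<mapsto> j)))"
      unfolding rt using label_Fresh[of t] by (auto simp: j_def)
    show "((if t = s then Paired else if fst t = j then Active else label_of E t) = Paired)
        = (t \<in> ran ((graph_of E)(x \<mapsto> s)))"
      unfolding rg using label_Paired[of t] label_Fresh[of t] j by (cases "label_of E t") auto
  next
    show "ran ((graph_of E)(x \<mapsto> s)) \<subseteq> out_stubs n D" unfolding rg using s ran_graph by simp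
    show "dom ((graph_of E)(x \<mapsto> s)) \<subseteq> set (in_stubs n N)" using h dom_graph by simp
    show "card (ran ((graph_of E)(x \<mapsto> s))) = card (dom ((graph_of E)(x \<mapsto> s)))"
      unfolding rg using card_graph fin sg h by (simp add: domIff)
    show "ran ((tree_of E)(u \<mapsto> j)) \<subseteq> {..<n}" unfolding rt using ran_tree jn by simp
    show "fst ` dom ((graph_of E)(x \<mapsto> s)) \<subseteq> ran ((tree_of E)(u \<mapsto> j))"
      unfolding rt using owners h(2,3) by (auto intro: ranI)
  next
    fix v b assume "((tree_of E)(u \<mapsto> j)) (v @ [b]) \<noteq> None"
    thus "((tree_of E)(u \<mapsto> j)) v \<noteq> None"
      using prefix_closed[of v b] h by (auto split: if_splits)
  next
    have "distinct (map snd q)" using distinct_queue q by simp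
    moreover have "distinct (map snd (enqueue N u j))"
      by (simp add: enqueue_def distinct_map inj_on_def comp_def)
    moreover have "set (map snd q) \<inter> set (map snd (enqueue N u j)) = {}"
    proof -
      have "fst y \<noteq> j" if "(v, y) \<in> set q" for v y
        using queue[OF qE[OF that]] j by (auto dest: ranI)
      thus ?thesis by (fastforce simp: enqueue_def)
    qed
    ultimately show "distinct (map snd (q @ enqueue N u j))" by simp
  next
    fix v y assume "(v, y) \<in> set (q @ enqueue N u j)"
    then consider "(v, y) \<in> set q" | b where "b < N j" "v = u @ [b]" "y = (j, b)"
      by (auto simp: set_enq)
    thus "((graph_of E)(x \<mapsto> s)) y = None \<and> ((tree_of E)(u \<mapsto> j)) v = None \<and>
       (\<exists>w i a. v = w @ [a] \<and> y = (i, a) \<and> ((tree_of E)(u \<mapsto> j)) w = Some i \<and> a < N i)"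
    proof cases
      case 1
      from queue[OF qE[OF 1]] obtain w' i' a' where
        *: "v = w' @ [a']" "y = (i', a')" "tree_of E w' = Some i'" "a' < N i'"
          "graph_of E y = None" "tree_of E v = None" by (elim conjE exE) (rule that)
      have "v \<noteq> u" using uq 1 by blast
      moreover have "y \<noteq> x" using 1 distinct_queue q by (force simp: image_iff)
      moreover have "w' \<noteq> u" using *(3) h by auto
      ultimately show ?thesis using * by auto
    next
      case 2
      have "v \<noteq> u" using 2 by auto
      moreover have "y \<noteq> x" using 2 h ij by auto
      ultimately show ?thesis using 2 graph_j tree_child by auto
    qed
  next
    show "sorted (map (length \<circ> fst) (q @ enqueue N u j))"
    proof -
      have "sorted (map (length \<circ> fst) q)" using sorted_queue q by simp
      moreover have "sorted (map (length \<circ> fst) (enqueue N u j))"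
        by (auto simp: enqueue_def comp_def sorted_iff_nth_mono)
      moreover have "\<forall>p\<in>set q. \<forall>p'\<in>set (enqueue N u j). length (fst p) \<le> length (fst p')"
        using lenq' by (auto simp: set_enq)
      ultimately show ?thesis by (simp add: sorted_append)
    qed
  next
    fix p p' assume "p \<in> set (q @ enqueue N u j)" "p' \<in> set (q @ enqueue N u j)"
    hence "length u \<le> length (fst p)" "length (fst p') \<le> Suc (length u)"
      using lenq[of p] lenq'[of p'] by (auto simp: set_enq)
    thus "length (fst p') \<le> Suc (length (fst p))" by linarith
  next
    fix v i' a' assume v: "((tree_of E)(u \<mapsto> j)) v = Some i'" and a': "a' < N i'"
    let ?R = "(v @ [a'], (i', a')) \<in> set (q @ enqueue N u j) \<or>
       (\<exists>j' b. ((tree_of E)(u \<mapsto> j)) (v @ [a']) = Some j' \<and> ((graph_of E)(x \<mapsto> s)) (i', a') = Some (j', b))"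
    show ?R
    proof (cases "v = u")
      case True
      thus ?thesis using v a' set_enq[of "(v @ [a'], (i', a'))"] by simp
    next
      case False
      hence v': "tree_of E v = Some i'" using v by simp
      from processed[OF v' a'] consider "(v @ [a'], (i', a')) \<in> set q" | "v @ [a'] = u" "(i', a') = x"
        | j' b where "tree_of E (v @ [a']) = Some j'" "graph_of E (i', a') = Some (j', b)"
        unfolding q by auto
      thus ?thesis
      proof cases
        case 2
        thus ?thesis by (cases s) (auto simp: j_def)
      next
        case 3
        have "v @ [a'] \<noteq> u" "(i', a') \<noteq> x" using 3 h by auto
        thus ?thesis using 3 by auto
      qed simp
    qed
  qed
qed

end

text \<open>A break in a later generation than \<open>k\<close> does no harm: what counts is that the tree
  and the graph coincide up to generation \<open>k\<close> when the joint exploration stops.\<close>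

definition agrees :: "nat \<Rightarrow> (nat \<Rightarrow> nat) \<Rightarrow> exploration \<Rightarrow> bool" where
  "agrees k N E \<longleftrightarrow> (\<forall>w i a. length w < k \<longrightarrow> tree_of E w = Some i \<longrightarrow> a < N i \<longrightarrow>
     (\<exists>j b. tree_of E (w @ [a]) = Some j \<and> graph_of E (i, a) = Some (j, b)))"

lemma (in bfs_invariant) agrees_if_done:
  assumes "\<And>p. p \<in> set (queue_of E) \<Longrightarrow> length (fst p) > k"
  shows "agrees k N E"
  unfolding agrees_def
proof (intro allI impI)
  fix w i a assume *: "length w < k" "tree_of E w = Some i" "a < N i"
  have "(w @ [a], (i, a)) \<notin> set (queue_of E)" using assms[of "(w @ [a], (i, a))"] * by auto
  thus "\<exists>j b. tree_of E (w @ [a]) = Some j \<and> graph_of E (i, a) = Some (j, b)"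
    using processed[OF *(2,3)] by blast
qed

text \<open>Meant for a break beyond generation k: the step writes only at an address longer than k
  and at an inbound stub that was unpaired, so no entry that agreement speaks of is touched.\<close>

lemma agrees_step:
  assumes "agrees k N E" "length u > k" "graph_of E x = None"
    and "tree_of E' = (tree_of E)(u \<mapsto> j)" "graph_of E' = (graph_of E)(x \<mapsto> s)"
  shows "agrees k N E'"
  unfolding agrees_def
proof (intro allI impI)
  fix w i a assume *: "length w < k" "tree_of E' w = Some i" "a < N i"
  have ne: "w \<noteq> u" "w @ [a] \<noteq> u" using * assms by auto
  hence "tree_of E w = Some i" using * assms by simp
  then obtain j b where "tree_of E (w @ [a]) = Some j" "graph_of E (i, a) = Some (j, b)"
    using assms(1) * unfolding agrees_def by blast
  moreover from this have "(i, a) \<noteq> x" using assms by auto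
  ultimately show "\<exists>j b. tree_of E' (w @ [a]) = Some j \<and> graph_of E' (i, a) = Some (j, b)"
    using ne assms by auto
qed

lemma bfs_invariant_init:
  assumes "v < n"
  shows "bfs_invariant n N D (init_exploration N v)"
  using assms
  by unfold_locales
    (auto simp: init_exploration_def enqueue_def distinct_map inj_on_def comp_def sorted_iff_nth_mono
          split: if_splits)

lemma explore_steps_broken: "broken E \<Longrightarrow> explore_steps r n N D E = return_pmf E"
  by (induction r) (simp_all add: explore_step_def bind_return_pmf)

lemma explore_steps_empty: "queue_of E = [] \<Longrightarrow> explore_steps r n N D E = return_pmf E"
  by (induction r) (simp_all add: explore_step_def bind_return_pmf)

lemma explore_step_idle: "broken E \<or> queue_of E = [] \<Longrightarrow> explore_step n N D E = return_pmf E"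
  by (auto simp: explore_step_def)

text \<open>The part of \<open>explore_step\<close> that follows the draw of s, separated so that
  the three labels can be treated apart from the uniform choice.\<close>

definition process_draw :: "nat \<Rightarrow> (nat \<Rightarrow> nat) \<Rightarrow> (nat \<Rightarrow> nat) \<Rightarrow> exploration \<Rightarrow>
    nat list \<Rightarrow> stub \<Rightarrow> (nat list \<times> stub) list \<Rightarrow> stub \<Rightarrow> exploration pmf" where
  "process_draw n N D E u x q s = (case label_of E s of
            Fresh \<Rightarrow> return_pmf
              \<lparr> graph_of = (graph_of E)(x \<mapsto> s), tree_of = (tree_of E)(u \<mapsto> fst s),
                label_of = (\<lambda>t. if t = s then Paired else if fst t = fst s then Active
                                else label_of E t),
                queue_of = q @ enqueue N u (fst s), broken = False \<rparr>
          | Active \<Rightarrow> return_pmf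
              \<lparr> graph_of = (graph_of E)(x \<mapsto> s), tree_of = (tree_of E)(u \<mapsto> fst s),
                label_of = (label_of E)(s := Paired),
                queue_of = q, broken = True \<rparr>
          | Paired \<Rightarrow>
              bind_pmf (pmf_of_set {t \<in> out_stubs n D. label_of E t \<noteq> Paired}) (\<lambda>t. return_pmf
              \<lparr> graph_of = (graph_of E)(x \<mapsto> t), tree_of = (tree_of E)(u \<mapsto> fst s),
                label_of = (label_of E)(t := Paired),
                queue_of = q, broken = True \<rparr>))"

lemma explore_step_head:
  assumes "queue_of E = (u, x) # q" "\<not> broken E"
  shows "explore_step n N D E = bind_pmf (pmf_of_set (out_stubs n D)) (process_draw n N D E u x q)"
  using assms by (simp add: explore_step_def process_draw_def[abs_def] Let_def)

lemma (in bfs_invariant) head_unpaired: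
  assumes "queue_of E = (u, x) # q"
  shows "graph_of E x = None" "u \<noteq> []" "x \<in> set (in_stubs n N)"
  by (rule head[OF assms], simp)+

text \<open>As far as the graph is concerned, a step is a uniform choice among the unpaired outbound
  stubs: labels 1 and 2 accept the draw, label 3 redraws. By the exchange of pairing orders this is
  a legitimate next pairing.\<close>

lemma (in bfs_invariant) step_complete_pairing:
  assumes sums: "(\<Sum>i<n. N i) = (\<Sum>i<n. D i)"
  shows "bind_pmf (explore_step n N D E) (\<lambda>E'. complete_pairing n N D (graph_of E'))
       = complete_pairing n N D (graph_of E)"
proof (cases "broken E \<or> queue_of E = []")
  case True
  thus ?thesis by (simp add: explore_step_idle bind_return_pmf)
next
  case False
  then obtain u x q where q: "queue_of E = (u, x) # q" "\<not> broken E"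
    by (cases "queue_of E") auto
  let ?S = "out_stubs n D" and ?G = "graph_of E"
  define f where "f s = complete_pairing n N D (?G(x \<mapsto> s))" for s
  have x: "x \<in> set (in_stubs n N)" "x \<notin> dom ?G" using head_unpaired[OF q(1)] by (simp_all add: domIff)
  note next_pair = complete_pairing_next[OF sums dom_graph ran_graph card_graph x]
  have unpaired: "{t \<in> ?S. label_of E t \<noteq> Paired} = ?S - ran ?G"
    using label_Paired by auto
  have "bind_pmf (explore_step n N D E) (\<lambda>E'. complete_pairing n N D (graph_of E'))
      = bind_pmf (pmf_of_set ?S) (\<lambda>s. if s \<in> ?S - ran ?G then f s else bind_pmf (pmf_of_set (?S - ran ?G)) f)"
    unfolding explore_step_head[OF q] bind_assoc_pmf
  proof (rule bind_pmf_cong[OF refl])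
    fix s assume "s \<in> set_pmf (pmf_of_set ?S)"
    moreover have "?S \<noteq> {}" using next_pair(2) by auto
    ultimately have s: "s \<in> ?S" by simp
    show "bind_pmf (process_draw n N D E u x q s) (\<lambda>E'. complete_pairing n N D (graph_of E'))
       = (if s \<in> ?S - ran ?G then f s else bind_pmf (pmf_of_set (?S - ran ?G)) f)"
      using s label_Paired[of s] unfolding process_draw_def unpaired f_def
      by (cases "label_of E s") (simp_all add: bind_return_pmf bind_assoc_pmf)
  qed
  also have "\<dots> = bind_pmf (pmf_of_set (?S - ran ?G)) f"
    by (rule bind_pmf_of_set_redraw) (use next_pair(2) in auto)
  also have "\<dots> = complete_pairing n N D ?G" unfolding f_def by (rule next_pair(1)[symmetric])
  finally show ?thesis .
qed

lemma explore_step_cases: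
  assumes "queue_of E = (u, x) # q" "\<not> broken E" "E' \<in> set_pmf (explore_step n N D E)"
    "out_stubs n D \<noteq> {}"
  obtains s where "s \<in> out_stubs n D" "label_of E s = Fresh"
      "E' = \<lparr> graph_of = (graph_of E)(x \<mapsto> s), tree_of = (tree_of E)(u \<mapsto> fst s),
                label_of = (\<lambda>t. if t = s then Paired else if fst t = fst s then Active
                                else label_of E t),
                queue_of = q @ enqueue N u (fst s), broken = False \<rparr>"
  | s j where "broken E'" "tree_of E' = (tree_of E)(u \<mapsto> j)" "graph_of E' = (graph_of E)(x \<mapsto> s)"
proof -
  obtain s where s: "s \<in> out_stubs n D" "E' \<in> set_pmf (process_draw n N D E u x q s)"
    using assms(3,4) unfolding explore_step_head[OF assms(1,2)] by auto
  note s = s(1) s(2)[unfolded process_draw_def]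
  show thesis
  proof (cases "label_of E s")
    case Fresh
    thus thesis using s that(1) by simp
  next
    case Active
    thus thesis using s by (intro that(2)[of "fst s" s]) simp_all
  next
    case Paired
    with s(2) obtain t where "E' = \<lparr> graph_of = (graph_of E)(x \<mapsto> t), tree_of = (tree_of E)(u \<mapsto> fst s),
                label_of = (label_of E)(t := Paired), queue_of = q, broken = True \<rparr>"
      by auto
    thus thesis by (intro that(2)[of "fst s" t]) simp_all
  qed
qed

lemma bfs_invariant_step:
  assumes "bfs_invariant n N D E" "E' \<in> set_pmf (explore_step n N D E)" "out_stubs n D \<noteq> {}"
    "\<not> broken E'"
  shows "bfs_invariant n N D E'"
proof (cases "broken E \<or> queue_of E = []")
  case True
  thus ?thesis using assms(1,2) by (simp add: explore_step_idle)
next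
  case False
  then obtain u x q where q: "queue_of E = (u, x) # q" "\<not> broken E"
    by (cases "queue_of E") auto
  from explore_step_cases[OF q assms(2,3)] assms(4) show ?thesis
  proof cases
    case (1 s)
    show ?thesis unfolding 1(3) by (rule bfs_invariant.attach[OF assms(1) q(1) 1(1,2)])
  qed simp
qed

text \<open>Exploring first does not change the law of the graph, by deferred decisions; hence the graph
  is independent of the root.\<close>

lemma explore_steps_complete_pairing:
  assumes sums: "(\<Sum>i<n. N i) = (\<Sum>i<n. D i)" and ne: "out_stubs n D \<noteq> {}"
    and inv: "bfs_invariant n N D E"
  shows "bind_pmf (explore_steps r n N D E) (\<lambda>E'. complete_pairing n N D (graph_of E'))
       = complete_pairing n N D (graph_of E)"
  using inv
proof (induction r arbitrary: E)
  case (Suc r)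
  have "bind_pmf (explore_steps (Suc r) n N D E) (\<lambda>E'. complete_pairing n N D (graph_of E'))
    = bind_pmf (explore_step n N D E) (\<lambda>E1. bind_pmf (explore_steps r n N D E1)
        (\<lambda>E'. complete_pairing n N D (graph_of E')))" by (simp add: bind_assoc_pmf)
  also have "\<dots> = bind_pmf (explore_step n N D E) (\<lambda>E1. complete_pairing n N D (graph_of E1))"
  proof (rule bind_pmf_cong[OF refl])
    fix E1 assume E1: "E1 \<in> set_pmf (explore_step n N D E)"
    show "bind_pmf (explore_steps r n N D E1) (\<lambda>E'. complete_pairing n N D (graph_of E'))
        = complete_pairing n N D (graph_of E1)"
    proof (cases "broken E1")
      case True
      thus ?thesis by (simp add: explore_steps_broken bind_return_pmf)
    next
      case False
      thus ?thesis by (intro Suc.IH bfs_invariant_step[OF Suc.prems E1 ne])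
    qed
  qed
  also have "\<dots> = complete_pairing n N D (graph_of E)"
    using bfs_invariant.step_complete_pairing[OF Suc.prems sums] .
  finally show ?case .
qed (simp add: bind_return_pmf)

lemma explore_complete_pairing:
  assumes "(\<Sum>i<n. N i) = (\<Sum>i<n. D i)" "out_stubs n D \<noteq> {}" "v < n"
  shows "bind_pmf (explore n N D v) (\<lambda>E. complete_pairing n N D (graph_of E))
       = complete_pairing n N D Map.empty"
  unfolding explore_def
  using explore_steps_complete_pairing[OF assms(1,2) bfs_invariant_init[OF assms(3)]]
  by (simp add: init_exploration_def)

lemma explore_steps_tree:
  assumes "out_stubs n D \<noteq> {}" "E' \<in> set_pmf (explore_steps r n N D E)" "finite (dom (tree_of E))"
  shows "finite (dom (tree_of E'))"
  using assms(2,3)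
proof (induction r arbitrary: E)
  case (Suc r)
  from Suc.prems(1) obtain E1 where
    E1: "E1 \<in> set_pmf (explore_step n N D E)" "E' \<in> set_pmf (explore_steps r n N D E1)"
    by auto
  have "finite (dom (tree_of E1))"
  proof (cases "broken E \<or> queue_of E = []")
    case True
    thus ?thesis using Suc.prems(2) E1(1) by (simp add: explore_step_idle)
  next
    case False
    then obtain u x q where q: "queue_of E = (u, x) # q" "\<not> broken E"
      by (cases "queue_of E") auto
    from explore_step_cases[OF q E1(1) assms(1)] show ?thesis
      by cases (use Suc.prems(2) in simp_all)
  qed
  thus ?case by (rule Suc.IH[OF E1(2)])
qed simp

lemma explore_steps_root:
  assumes "out_stubs n D \<noteq> {}" "E' \<in> set_pmf (explore_steps r n N D E)"
    "tree_of E [] = Some v" "bfs_invariant n N D E"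
  shows "tree_of E' [] = Some v"
  using assms(2,3,4)
proof (induction r arbitrary: E)
  case (Suc r)
  from Suc.prems(1) obtain E1 where
    E1: "E1 \<in> set_pmf (explore_step n N D E)" "E' \<in> set_pmf (explore_steps r n N D E1)"
    by auto
  have "tree_of E1 [] = Some v"
  proof (cases "broken E \<or> queue_of E = []")
    case True
    thus ?thesis using Suc.prems(2) E1(1) by (simp add: explore_step_idle)
  next
    case False
    then obtain u x q where q: "queue_of E = (u, x) # q" "\<not> broken E"
      by (cases "queue_of E") auto
    have "u \<noteq> []" by (rule bfs_invariant.head_unpaired[OF Suc.prems(3) q(1)])
    from explore_step_cases[OF q E1(1) assms(1)] show ?thesis
      by cases (use Suc.prems(2) \<open>u \<noteq> []\<close> in simp_all)
  qed
  thus ?case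
  proof (cases "broken E1")
    case True
    thus ?thesis using E1 \<open>tree_of E1 [] = Some v\<close> by (simp add: explore_steps_broken)
  next
    case False
    thus ?thesis using \<open>tree_of E1 [] = Some v\<close>
      by (intro Suc.IH[OF E1(2)] bfs_invariant_step[OF Suc.prems(3) E1(1) assms(1)])
  qed
qed simp

text \<open>With only addresses beyond generation k in the queue the first k generations are
  settled: a successful step appends still longer addresses, and a break is covered by
  \<open>agrees_step\<close>.\<close>

lemma explore_steps_agrees:
  assumes ne: "out_stubs n D \<noteq> {}" and inv: "bfs_invariant n N D E"
    and late: "\<And>p. p \<in> set (queue_of E) \<Longrightarrow> length (fst p) > k"
    and E': "E' \<in> set_pmf (explore_steps r n N D E)"
  shows "agrees k N E'"
  using inv late E'
proof (induction r arbitrary: E)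
  case 0
  have "agrees k N E" using 0(1,2) by (rule bfs_invariant.agrees_if_done)
  thus ?case using 0(3) by simp
next
  case (Suc r)
  have agE: "agrees k N E" using Suc.prems(1,2) by (rule bfs_invariant.agrees_if_done)
  from Suc.prems(3) obtain E1 where
    E1: "E1 \<in> set_pmf (explore_step n N D E)" "E' \<in> set_pmf (explore_steps r n N D E1)"
    by auto
  show ?case
  proof (cases "broken E \<or> queue_of E = []")
    case True
    hence "explore_steps (Suc r) n N D E = return_pmf E"
      using explore_steps_broken explore_steps_empty by blast
    hence "E' = E" using Suc.prems(3) by simp
    thus ?thesis using agE by simp
  next
    case False
    then obtain u x q where q: "queue_of E = (u, x) # q" "\<not> broken E"
      by (cases "queue_of E") auto
    have u: "length u > k" using Suc.prems(2)[of "(u, x)"] q by simp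
    from explore_step_cases[OF q E1(1) ne] show ?thesis
    proof cases
      case (1 s)
      have "bfs_invariant n N D E1"
        by (rule bfs_invariant_step[OF Suc.prems(1) E1(1) ne]) (simp add: 1(3))
      moreover have "length (fst p) > k" if "p \<in> set (queue_of E1)" for p
        using that Suc.prems(2)[of p] u unfolding 1(3) q(1) by (auto simp: enqueue_def)
      ultimately show ?thesis using E1(2) by (rule Suc.IH)
    next
      case (2 s j)
      have "graph_of E x = None" by (rule bfs_invariant.head_unpaired[OF Suc.prems(1) q(1)])
      have "agrees k N E1" by (rule agrees_step[OF agE u \<open>graph_of E x = None\<close> 2(2,3)])
      moreover have "E' = E1" using E1(2) unfolding explore_steps_broken[OF 2(1)] by simp
      ultimately show ?thesis by simp
    qed
  qed
qed

section \<open>The probability that the coupling breaks early\<close>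

text \<open>The expected number of individuals in generations g to k that descend from an individual
  of generation g, itself included, when the mean offspring number is m. Generations beyond k have
  weight 0.\<close>

definition progeny_weight :: "real \<Rightarrow> nat \<Rightarrow> nat \<Rightarrow> real" where
  "progeny_weight m k g = (if g \<le> k then \<Sum>j\<le>k - g. m ^ j else 0)"

lemma progeny_weight_nonneg: "m \<ge> 0 \<Longrightarrow> progeny_weight m k g \<ge> 0"
  by (auto simp: progeny_weight_def intro!: sum_nonneg)

text \<open>An individual counts itself and, on average, m children. This identity makes the queue
  weight drop by 1 in the mean.\<close>

lemma progeny_weight_rec:
  assumes "g \<le> k"
  shows "progeny_weight m k g = 1 + m * progeny_weight m k (Suc g)"
proof (cases "g = k")
  case False
  then obtain d where d: "k - g = Suc d" using assms by (metis Suc_diff_Suc le_neq_implies_less)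
  hence "k - Suc g = d" "Suc g \<le> k" using assms by auto
  thus ?thesis using assms d
    by (simp add: progeny_weight_def sum.atMost_Suc_shift sum_distrib_left del: sum.atMost_Suc)
qed (simp add: progeny_weight_def)

definition queue_weight :: "real \<Rightarrow> nat \<Rightarrow> exploration \<Rightarrow> real" where
  "queue_weight m k E = (\<Sum>p\<leftarrow>queue_of E. progeny_weight m k (length (fst p)))"

lemma queue_weight_nonneg: "m \<ge> 0 \<Longrightarrow> queue_weight m k E \<ge> 0"
  by (auto simp: queue_weight_def intro!: sum_list_nonneg progeny_weight_nonneg)

text \<open>Paired stubs are included: the draw is from all outbound stubs, and labels 2 and 3 both
  break the coupling.\<close>

definition attached_stubs :: "nat \<Rightarrow> (nat \<Rightarrow> nat) \<Rightarrow> exploration \<Rightarrow> stub set" where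
  "attached_stubs n D E = {s \<in> out_stubs n D. fst s \<in> ran (tree_of E)}"

lemma sum_list_enqueue:
  "(\<Sum>p\<leftarrow>enqueue N u j. f (length (fst p))) = real (N j) * (f (Suc (length u)) :: real)"
  by (simp add: enqueue_def comp_def sum_list_triv)

lemma (in bfs_invariant) card_attached_stubs_attach:
  assumes "tree_of E u = None" "j < n" "tree_of E' = (tree_of E)(u \<mapsto> j)"
  shows "card (attached_stubs n D E') \<le> card (attached_stubs n D E) + D j"
proof -
  have "attached_stubs n D E' \<subseteq> attached_stubs n D E \<union> ({j} \<times> {..<D j})"
    using assms by (auto simp: attached_stubs_def out_stubs_def)
  hence "card (attached_stubs n D E') \<le> card (attached_stubs n D E \<union> ({j} \<times> {..<D j}))"
    by (intro card_mono) (simp_all add: attached_stubs_def)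
  also have "\<dots> \<le> card (attached_stubs n D E) + card ({j} \<times> {..<D j})" by (rule card_Un_le)
  finally show ?thesis by simp
qed

text \<open>The right-hand side is a supermartingale along the exploration that dominates the indicator of
  a break in the first \<open>k\<close> generations. Here \<open>y\<close> is the number of steps left out of a budget of \<open>x\<close>.
  The first summand is at least 1 once the budget is used up; it stays controlled because the
  queue weight, the expected number of individuals still to come, drops by 1 on average in every
  step. The second summand pays for the break probabilities: with \<open>A\<close> stubs attached, the next
  step breaks with probability \<open>A / L\<close> and otherwise adds at most \<open>\<nu>\<close> stubs to \<open>A\<close> on average.\<close>

lemma prob_disagree:
  fixes m \<nu> L x :: real
  assumes L: "L = real (card (out_stubs n D))" "L > 0"
    and sumN: "(\<Sum>s\<in>out_stubs n D. real (N (fst s))) \<le> m * L"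
    and sumD: "(\<Sum>s\<in>out_stubs n D. real (D (fst s))) \<le> \<nu> * L"
    and m: "m \<ge> 0" and \<nu>: "\<nu> \<ge> 0" and x: "x > 0"
    and inv: "bfs_invariant n N D E" "\<not> broken E"
    and r: "(\<Sum>i<n. N i) \<le> r + card (dom (graph_of E))"
    and y: "real y \<le> x"
  shows "measure_pmf.prob (explore_steps r n N D E) {E'. \<not> agrees k N E'}
     \<le> (x - real y + queue_weight m k E) / x
        + (real y * real (card (attached_stubs n D E)) + \<nu> * (real y)\<^sup>2) / L"
  using inv r y
proof (induction r arbitrary: E y)
  case (0 E y)
  interpret bfs_invariant n N D E by fact
  have fin: "finite (dom (graph_of E))" using finite_subset[OF dom_graph] by simp
  \<comment> \<open>With no steps left, \<open>r\<close> says that all inbound stubs are paired,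
    whereas the head of a nonempty queue would be an unpaired one.\<close>
  have "queue_of E = []"
  proof (cases "queue_of E")
    case (Cons p q)
    obtain u z where p: "p = (u, z)" by (cases p)
    have z: "graph_of E z = None" "z \<in> set (in_stubs n N)"
      using head_unpaired[of u z q] Cons p by auto
    have "insert z (dom (graph_of E)) \<subseteq> set (in_stubs n N)" using z dom_graph by simp
    hence "card (insert z (dom (graph_of E))) \<le> card (set (in_stubs n N))" by (intro card_mono) auto
    also have "\<dots> = (\<Sum>i<n. N i)" using distinct_card[OF distinct_in_stubs] by (simp add: length_in_stubs)
    finally show ?thesis using 0(3) z fin by (simp add: domIff)
  qed simp
  hence "agrees k N E" by (intro agrees_if_done) simp
  hence "measure_pmf.prob (explore_steps 0 n N D E) {E'. \<not> agrees k N E'} = 0" by simp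
  also have "0 \<le> (x - real y + queue_weight m k E) / x
        + (real y * real (card (attached_stubs n D E)) + \<nu> * (real y)\<^sup>2) / L"
    using x L(2) \<nu> 0(4) queue_weight_nonneg[OF m] by (intro add_nonneg_nonneg divide_nonneg_pos) auto
  finally show ?case .
next
  case (Suc r E y)
  interpret bfs_invariant n N D E by fact
  let ?S = "out_stubs n D"
  have ne: "?S \<noteq> {}" using L by auto
  have nonneg: "0 \<le> (x - real y + queue_weight m k E) / x
        + (real y * real (card (attached_stubs n D E)) + \<nu> * (real y)\<^sup>2) / L"
    using x L(2) \<nu> Suc.prems(4) queue_weight_nonneg[OF m] by (intro add_nonneg_nonneg divide_nonneg_pos) auto
  show ?case
  proof (cases "\<forall>p\<in>set (queue_of E). length (fst p) > k")
    case True
    have "set_pmf (explore_steps (Suc r) n N D E) \<inter> {E'. \<not> agrees k N E'} = {}"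
      using explore_steps_agrees[OF ne Suc.prems(1), of k] True by blast
    hence "measure_pmf.prob (explore_steps (Suc r) n N D E) {E'. \<not> agrees k N E'} = 0"
      by (simp only: measure_pmf_zero_iff)
    thus ?thesis using nonneg by simp
  next
    case False
    then obtain u z q where q: "queue_of E = (u, z) # q" by (cases "queue_of E") auto
    have u: "length u \<le> k"
    proof -
      obtain p where p: "p \<in> set (queue_of E)" "length (fst p) \<le> k" using False by force
      have "length u \<le> length (fst p)" using sorted_queue p(1) q by auto
      thus ?thesis using p by simp
    qed
    let ?W = "queue_weight m k E" and ?A = "real (card (attached_stubs n D E))"
    let ?w = "progeny_weight m k (length u)" and ?w' = "progeny_weight m k (Suc (length u))"
    have w0: "?w' \<ge> 0" by (rule progeny_weight_nonneg[OF m])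
    have Ww: "?W \<ge> ?w"
      using q m by (auto simp: queue_weight_def intro!: sum_list_nonneg progeny_weight_nonneg)
    show ?thesis
    proof (cases y)
      case 0
      have "measure_pmf.prob (explore_steps (Suc r) n N D E) {E'. \<not> agrees k N E'} \<le> 1" by simp
      also have "1 \<le> (x - real y + ?W) / x + (real y * ?A + \<nu> * (real y)\<^sup>2) / L"
        using x 0 queue_weight_nonneg[OF m, of k E] by (simp add: field_simps)
      finally show ?thesis .
    next
      case (Suc y')
      define b where "b s = measure_pmf.prob (bind_pmf (process_draw n N D E u z q s) (explore_steps r n N D))
        {E'. \<not> agrees k N E'}" for s :: stub
      define f where "f s = (x - real y' + (?W - ?w + real (N (fst s)) * ?w')) / x
        + (real y' * (?A + real (D (fst s))) + \<nu> * (real y')\<^sup>2) / L" for s :: stub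
      have yx: "real y' \<le> x" using Suc.prems(4) Suc by simp
      have f0: "f s \<ge> 0" for s
        unfolding f_def using x L(2) \<nu> yx Ww w0 by (intro add_nonneg_nonneg divide_nonneg_pos) auto
      \<comment> \<open>A draw among the attached stubs breaks the coupling and is charged the
        trivial bound 1. Any other draw is fresh and leads to a state covered by the induction
        hypothesis with one step less in the budget.\<close>
      have b1: "b s \<le> (if s \<in> attached_stubs n D E then 1 else f s)" if s: "s \<in> ?S" for s
      proof (cases "s \<in> attached_stubs n D E")
        case True
        thus ?thesis by (simp add: b_def)
      next
        case False
        hence fresh: "label_of E s = Fresh" using label_Fresh[of s] s by (simp add: attached_stubs_def)
        define E' where "E' = \<lparr> graph_of = (graph_of E)(z \<mapsto> s), tree_of = (tree_of E)(u \<mapsto> fst s),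
                label_of = (\<lambda>t. if t = s then Paired else if fst t = fst s then Active
                                else label_of E t),
                queue_of = q @ enqueue N u (fst s), broken = False \<rparr>"
        have inv': "bfs_invariant n N D E'" unfolding E'_def by (rule attach[OF q s fresh])
        have hd: "graph_of E z = None" "tree_of E u = None" by (rule head[OF q], simp)+
        have fin: "finite (dom (graph_of E))" using finite_subset[OF dom_graph] by simp
        have W': "queue_weight m k E' = ?W - ?w + real (N (fst s)) * ?w'"
          unfolding queue_weight_def E'_def by (simp add: q sum_list_enqueue)
        have A': "real (card (attached_stubs n D E')) \<le> ?A + real (D (fst s))"
          using card_attached_stubs_attach[OF hd(2), of "fst s" E'] s
          by (auto simp: E'_def out_stubs_def)
        have "b s = measure_pmf.prob (explore_steps r n N D E') {E'. \<not> agrees k N E'}"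
          unfolding b_def process_draw_def fresh E'_def by (simp add: bind_return_pmf)
        also have "\<dots> \<le> (x - real y' + queue_weight m k E') / x
          + (real y' * real (card (attached_stubs n D E')) + \<nu> * (real y')\<^sup>2) / L"
        proof (rule Suc.IH[OF inv' _ _ yx])
          show "\<not> broken E'" by (simp add: E'_def)
          show "sum N {..<n} \<le> r + card (dom (graph_of E'))"
            using Suc.prems(3) hd fin by (simp add: E'_def domIff)
        qed
        also have "\<dots> \<le> f s"
          unfolding f_def W' using A' L(2)
          by (intro add_left_mono divide_right_mono add_right_mono mult_left_mono) auto
        finally show ?thesis using False by simp
      qed
      have "measure_pmf.prob (explore_steps (Suc r) n N D E) {E'. \<not> agrees k N E'} = (\<Sum>s\<in>?S. b s) / L"
        unfolding explore_steps.simps explore_step_head[OF q Suc.prems(2)] bind_assoc_pmf b_def L(1)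
        by (rule prob_bind_pmf_of_set[OF ne]) simp
      also have "(\<Sum>s\<in>?S. b s) \<le> (\<Sum>s\<in>?S. f s) + ?A"
      proof -
        have "(\<Sum>s\<in>?S. b s) \<le> (\<Sum>s\<in>?S. f s + (if s \<in> attached_stubs n D E then 1 else 0))"
        proof (rule sum_mono)
          fix s assume "s \<in> ?S"
          thus "b s \<le> f s + (if s \<in> attached_stubs n D E then 1 else 0)"
            using b1[of s] f0[of s] by (simp split: if_splits)
        qed
        also have "\<dots> = (\<Sum>s\<in>?S. f s) + ?A"
          by (simp add: sum.distrib sum.If_cases attached_stubs_def Int_def)
        finally show ?thesis .
      qed
      also have "(\<Sum>s\<in>?S. f s) = L * ((x - real y' + (?W - ?w)) / x) + (\<Sum>s\<in>?S. real (N (fst s))) * ?w' / x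
          + real y' * ?A + real y' * (\<Sum>s\<in>?S. real (D (fst s))) / L + \<nu> * (real y')\<^sup>2"
      proof -
        have f_eq: "f s = ((x - real y' + (?W - ?w)) / x + (real y' * ?A + \<nu> * (real y')\<^sup>2) / L)
            + real (N (fst s)) * (?w' / x) + real (D (fst s)) * (real y' / L)" for s
          unfolding f_def by (simp add: add_divide_distrib distrib_left distrib_right diff_divide_distrib mult.commute)
        have "(\<Sum>s\<in>?S. f s) = L * ((x - real y' + (?W - ?w)) / x + (real y' * ?A + \<nu> * (real y')\<^sup>2) / L)
            + (\<Sum>s\<in>?S. real (N (fst s))) * (?w' / x) + (\<Sum>s\<in>?S. real (D (fst s))) * (real y' / L)"
          unfolding f_eq sum.distrib sum_distrib_right[symmetric] sum_constant L(1)[symmetric] by (simp only: distrib_left)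
        also have "L * ((x - real y' + (?W - ?w)) / x + (real y' * ?A + \<nu> * (real y')\<^sup>2) / L)
            = L * ((x - real y' + (?W - ?w)) / x) + (real y' * ?A + \<nu> * (real y')\<^sup>2)"
          using L(2) unfolding distrib_left[of L "_ / x"] by simp
        finally show ?thesis by (simp add: mult.commute)
      qed
      also have "\<dots> \<le> L * ((x - real y' + (?W - ?w)) / x) + (m * L) * ?w' / x
          + real y' * ?A + real y' * (\<nu> * L) / L + \<nu> * (real y')\<^sup>2"
        using sumN sumD w0 x L(2)
        by (intro add_mono order_refl divide_right_mono mult_right_mono mult_left_mono) auto
      finally have "measure_pmf.prob (explore_steps (Suc r) n N D E) {E'. \<not> agrees k N E'} \<le>
         (L * ((x - real y' + (?W - ?w)) / x) + (m * L) * ?w' / x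
          + real y' * ?A + real y' * (\<nu> * L) / L + \<nu> * (real y')\<^sup>2 + ?A) / L"
        using L(2) by (simp add: divide_right_mono)
      also have "\<dots> = (x - real y' + (?W - ?w)) / x + m * ?w' / x + (real y' * ?A + real y' * \<nu> + \<nu> * (real y')\<^sup>2 + ?A) / L"
        using L(2) by (simp add: add_divide_distrib)
      \<comment> \<open>With y = y' + 1, the break term A joins y' A to form y A, and \<nu> y' +
        \<nu> y'^2 = \<nu> y' y, which fits below \<nu> y^2.\<close>
      also have "\<dots> = (x - real y' + (?W - ?w) + m * ?w') / x + (real y * ?A + \<nu> * (real y' * real y)) / L"
        unfolding Suc by (simp add: add_divide_distrib[symmetric] algebra_simps power2_eq_square)
      \<comment> \<open>The head loses \<open>?w\<close> = 1 + m \<open>?w'\<close>, its children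
        bring back m \<open>?w'\<close>, and the remaining 1 offsets the step taken from the
        budget.\<close>
      also have "\<dots> = (x - real y + ?W) / x + (real y * ?A + \<nu> * (real y' * real y)) / L"
      proof -
        have "x - real y' + (?W - ?w) + m * ?w' = x - real y + ?W"
          unfolding progeny_weight_rec[OF u] Suc by simp
        thus ?thesis by (simp only:)
      qed
      also have "\<dots> \<le> (x - real y + ?W) / x + (real y * ?A + \<nu> * (real y)\<^sup>2) / L"
        unfolding power2_eq_square using Suc L(2) \<nu>
        by (intro add_left_mono divide_right_mono mult_left_mono mult_right_mono) auto
      finally show ?thesis .
    qed
  qed
qed

text \<open>The supermartingale is started with its full budget, y = x, so the first numerator is
  just the weight of the initial queue and the attached stubs are those of the root.\<close>

lemma prob_explore_disagree:
  fixes m \<nu> L :: real and x :: nat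
  assumes L: "L = real (card (out_stubs n D))" "L > 0"
    and sumN: "(\<Sum>i<n. real (D i) * real (N i)) \<le> m * L"
    and sumD: "(\<Sum>i<n. real (D i) * real (D i)) \<le> \<nu> * L"
    and m: "m \<ge> 0" and \<nu>: "\<nu> \<ge> 0" and x: "x > 0" and v: "v < n"
  shows "measure_pmf.prob (explore n N D v) {E. \<not> agrees k N E}
     \<le> real (N v) * progeny_weight m k 1 / real x + (real x * real (D v) + \<nu> * (real x)\<^sup>2) / L"
proof -
  let ?E = "init_exploration N v"
  have "measure_pmf.prob (explore n N D v) {E. \<not> agrees k N E}
      \<le> (real x - real x + queue_weight m k ?E) / real x
        + (real x * real (card (attached_stubs n D ?E)) + \<nu> * (real x)\<^sup>2) / L"
    unfolding explore_def
    by (rule prob_disagree[OF L _ _ m \<nu> _ bfs_invariant_init[OF v]])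
       (use x sumN sumD in \<open>simp_all add: sum_out_stubs[where f = "\<lambda>i. real (N i)"]
          sum_out_stubs[where f = "\<lambda>i. real (D i)"] init_exploration_def\<close>)
  also have "queue_weight m k ?E = real (N v) * progeny_weight m k 1"
    by (simp add: queue_weight_def init_exploration_def sum_list_enqueue)
  also have "attached_stubs n D ?E = {v} \<times> {..<D v}"
    using v by (auto simp: attached_stubs_def init_exploration_def out_stubs_def)
  finally show ?thesis by simp
qed

section \<open>Power iterations on the graph and on the tree\<close>

primrec power_iteration :: "nat \<Rightarrow> real \<Rightarrow> real \<Rightarrow> (nat \<Rightarrow> nat \<Rightarrow> real) \<Rightarrow> nat \<Rightarrow> nat \<Rightarrow> real" where
  "power_iteration n c r\<^sub>0 M 0 i = r\<^sub>0"
| "power_iteration n c r\<^sub>0 M (Suc k) i = (\<Sum>j<n. power_iteration n c r\<^sub>0 M k j * M j i) + (1 - c)"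

lemma substochastic_contraction:
  fixes M :: "nat \<Rightarrow> nat \<Rightarrow> real"
  assumes "\<And>i j. i < n \<Longrightarrow> j < n \<Longrightarrow> M i j \<ge> 0" "\<And>i. i < n \<Longrightarrow> (\<Sum>j<n. M i j) \<le> c"
  shows "(\<Sum>i<n. \<bar>\<Sum>j<n. w j * M j i\<bar>) \<le> c * (\<Sum>j<n. \<bar>w j\<bar>)"
proof -
  have "(\<Sum>i<n. \<bar>\<Sum>j<n. w j * M j i\<bar>) \<le> (\<Sum>i<n. \<Sum>j<n. \<bar>w j\<bar> * M j i)"
    using assms(1) by (intro sum_mono order_trans[OF sum_abs]) (auto simp: abs_mult intro!: sum_mono)
  also have "\<dots> = (\<Sum>j<n. \<bar>w j\<bar> * (\<Sum>i<n. M j i))"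
    by (subst sum.swap) (simp add: sum_distrib_left)
  also have "\<dots> \<le> (\<Sum>j<n. \<bar>w j\<bar> * c)"
    using assms(2) by (intro sum_mono mult_left_mono) auto
  finally show ?thesis by (simp add: sum_distrib_left mult.commute)
qed

text \<open>The equation for R and the contraction give R an l1-norm of at most n; together with the
  norm n r_0 of the starting vector this yields the factor r_0 + 1, and each iteration contributes a
  factor c.\<close>

lemma power_iteration_error:
  fixes M :: "nat \<Rightarrow> nat \<Rightarrow> real"
  assumes c: "0 < c" "c < 1" and r: "r\<^sub>0 \<ge> 0"
    and M: "\<And>i j. i < n \<Longrightarrow> j < n \<Longrightarrow> M i j \<ge> 0" "\<And>i. i < n \<Longrightarrow> (\<Sum>j<n. M i j) \<le> c"
    and R: "pagerank_solution n c M R"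
  shows "(\<Sum>i<n. \<bar>R i - power_iteration n c r\<^sub>0 M k i\<bar>) \<le> real n * (r\<^sub>0 + 1) * c ^ k"
proof -
  have R_eq: "R i = (\<Sum>j<n. R j * M j i) + (1 - c)" if "i < n" for i
    using R that by (simp add: pagerank_solution_def)
  have "(\<Sum>i<n. \<bar>R i\<bar>) \<le> (\<Sum>i<n. \<bar>\<Sum>j<n. R j * M j i\<bar> + (1 - c))"
  proof (rule sum_mono)
    fix i assume "i \<in> {..<n}"
    thus "\<bar>R i\<bar> \<le> \<bar>\<Sum>j<n. R j * M j i\<bar> + (1 - c)" using R_eq[of i] c by auto
  qed
  also have "\<dots> = (\<Sum>i<n. \<bar>\<Sum>j<n. R j * M j i\<bar>) + real n * (1 - c)"
    by (simp add: sum.distrib)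
  also have "\<dots> \<le> c * (\<Sum>i<n. \<bar>R i\<bar>) + real n * (1 - c)"
    using substochastic_contraction[OF M] by (rule add_right_mono)
  finally have "(1 - c) * (\<Sum>i<n. \<bar>R i\<bar>) \<le> (1 - c) * real n" by (simp add: algebra_simps)
  hence normR: "(\<Sum>i<n. \<bar>R i\<bar>) \<le> real n" using c by simp
  show ?thesis
  proof (induction k)
    case 0
    have "(\<Sum>i<n. \<bar>R i - r\<^sub>0\<bar>) \<le> (\<Sum>i<n. \<bar>R i\<bar> + r\<^sub>0)" using r by (intro sum_mono) auto
    also have "\<dots> \<le> real n * (r\<^sub>0 + 1)" using normR by (simp add: sum.distrib algebra_simps)
    finally show ?case by simp
  next
    case (Suc k)
    have "(\<Sum>i<n. \<bar>R i - power_iteration n c r\<^sub>0 M (Suc k) i\<bar>)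
        = (\<Sum>i<n. \<bar>\<Sum>j<n. (R j - power_iteration n c r\<^sub>0 M k j) * M j i\<bar>)"
    proof (rule sum.cong)
      fix i assume "i \<in> {..<n}"
      thus "\<bar>R i - power_iteration n c r\<^sub>0 M (Suc k) i\<bar>
         = \<bar>\<Sum>j<n. (R j - power_iteration n c r\<^sub>0 M k j) * M j i\<bar>"
        using R_eq[of i] by (simp add: left_diff_distrib sum_subtractf)
    qed simp
    also have "\<dots> \<le> c * (\<Sum>i<n. \<bar>R i - power_iteration n c r\<^sub>0 M k i\<bar>)"
      by (rule substochastic_contraction[OF M])
    also have "\<dots> \<le> c * (real n * (r\<^sub>0 + 1) * c ^ k)" using Suc.IH c by (intro mult_left_mono) auto
    finally show ?case by (simp add: mult_ac)
  qed
qed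

lemma map_leD: "f \<subseteq>\<^sub>m g \<Longrightarrow> f x = Some y \<Longrightarrow> g x = Some y"
  by (metis domI map_le_def)

locale complete_graph =
  fixes n :: nat and N D :: "nat \<Rightarrow> nat" and c :: real and G :: pairing
  assumes c: "0 < c" "c < 1"
    and dom_G: "dom G = (SIGMA i:{..<n}. {..<N i})"
    and ran_G: "ran G \<subseteq> out_stubs n D"
    and inj_G: "inj_on G (dom G)"
begin

abbreviation "M \<equiv> pagerank_matrix D c G"

lemma M_eq: "M i j = real (edge_count G i j) * c / real (D i)"
  by (cases "edge_count G i j") (simp_all add: pagerank_matrix_def)

lemma edge_tail: "G (i, a) = Some (j, b) \<Longrightarrow> i < n \<and> a < N i \<and> j < n \<and> b < D j"
proof -
  assume *: "G (i, a) = Some (j, b)"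
  hence "(i, a) \<in> dom G" "(j, b) \<in> ran G" by (auto intro: ranI)
  thus ?thesis using ran_G unfolding dom_G by (auto simp: out_stubs_def)
qed

text \<open>Injectivity of the pairing gives every edge leaving i its own outbound stub, so there
  are at most \<open>D i\<close> of them. A node without outbound stubs has a zero row and obeys the
  same bound.\<close>

lemma row_sum: "(\<Sum>j<n. M i j) \<le> c"
proof -
  have sub: "{a. \<exists>b. G (j, a) = Some (i, b)} \<subseteq> {..<N j}" for j using edge_tail by blast
  let ?A = "SIGMA j:{..<n}. {a. \<exists>b. G (j, a) = Some (i, b)}"
  have "(\<Sum>j<n. edge_count G i j) = card ?A"
    unfolding edge_count_def using finite_subset[OF sub] by (subst card_SigmaI) auto
  also have "\<dots> \<le> card ((\<lambda>b. Some (i, b)) ` {..<D i})"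
  proof (rule card_inj_on_le)
    show "inj_on G ?A" by (rule inj_on_subset[OF inj_G]) auto
    show "G ` ?A \<subseteq> (\<lambda>b. Some (i, b)) ` {..<D i}" using edge_tail by auto
  qed simp
  also have "\<dots> \<le> D i" using card_image_le[of "{..<D i}"] by auto
  finally have "real (\<Sum>j<n. edge_count G i j) \<le> real (D i)" by (simp only: of_nat_le_iff)
  hence "(\<Sum>j<n. real (edge_count G i j)) \<le> real (D i)" by simp
  hence "(\<Sum>j<n. real (edge_count G i j)) * c / real (D i) \<le> real (D i) * c / real (D i)"
    using c by (intro divide_right_mono mult_right_mono) auto
  also have "\<dots> \<le> c" using c by simp
  finally show ?thesis by (simp add: M_eq sum_distrib_right sum_divide_distrib)
qed

text \<open>A sum over source nodes weighted by edge multiplicities becomes a sum over the inbound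
  stubs of i, the shape of the recursion on the tree.\<close>

lemma column_sum:
  assumes "i < n"
  shows "(\<Sum>j<n. r j * M j i) = (\<Sum>a<N i. c / real (D (fst (the (G (i, a))))) * r (fst (the (G (i, a)))))"
proof -
  define own where "own a = fst (the (G (i, a)))" for a
  have G: "\<exists>j b. G (i, a) = Some (j, b)" if "a < N i" for a
  proof -
    have "(i, a) \<in> dom G" unfolding dom_G using assms that by simp
    thus ?thesis by auto
  qed
  have own: "G (i, a) = Some (j, b) \<Longrightarrow> own a = j" for a j b by (simp add: own_def)
  have "own ` {..<N i} \<subseteq> {..<n}" using G own edge_tail by fastforce
  hence "(\<Sum>a<N i. c / real (D (own a)) * r (own a))
      = (\<Sum>j<n. \<Sum>a\<in>{a \<in> {..<N i}. own a = j}. c / real (D (own a)) * r (own a))"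
    by (subst sum.group) auto
  also have "\<dots> = (\<Sum>j<n. real (card {a \<in> {..<N i}. own a = j}) * (c / real (D j) * r j))"
    by (intro sum.cong refl) simp
  also have "\<dots> = (\<Sum>j<n. r j * M j i)"
  proof (intro sum.cong refl)
    fix j
    have "{a \<in> {..<N i}. own a = j} = {a. \<exists>b. G (i, a) = Some (j, b)}"
    proof (rule set_eqI)
      fix a
      show "a \<in> {a \<in> {..<N i}. own a = j} \<longleftrightarrow> a \<in> {a. \<exists>b. G (i, a) = Some (j, b)}"
      proof
        assume "a \<in> {a \<in> {..<N i}. own a = j}"
        hence "a < N i" "own a = j" by auto
        moreover from G[OF this(1)] obtain j' b where "G (i, a) = Some (j', b)" by blast
        ultimately show "a \<in> {a. \<exists>b. G (i, a) = Some (j, b)}" using own[of a j' b] by simp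
      next
        assume "a \<in> {a. \<exists>b. G (i, a) = Some (j, b)}"
        then obtain b where "G (i, a) = Some (j, b)" by blast
        thus "a \<in> {a \<in> {..<N i}. own a = j}" using edge_tail own by simp
      qed
    qed
    thus "real (card {a \<in> {..<N i}. own a = j}) * (c / real (D j) * r j) = r j * M j i"
      by (simp add: M_eq edge_count_def)
  qed
  finally show ?thesis unfolding own_def ..
qed

lemma pagerank_error:
  assumes "r\<^sub>0 \<ge> 0"
  shows "(\<Sum>i<n. \<bar>pagerank n D c G i - power_iteration n c r\<^sub>0 M k i\<bar>) \<le> real n * (r\<^sub>0 + 1) * c ^ k"
proof (rule power_iteration_error[OF c assms])
  show M0: "M i j \<ge> 0" for i j using c by (simp add: M_eq)
  have "\<exists>!R. pagerank_solution n c M R"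
    by (rule pagerank_solution_ex1[OF c]) (auto intro: M0 row_sum)
  thus "pagerank_solution n c M (pagerank n D c G)" unfolding pagerank_def by (rule theI')
qed (rule row_sum)

text \<open>Agreement identifies, stub by stub, the children of u with the sources of the edges into
  i, so both recursions coincide. The bound on \<open>length u + l\<close> keeps every individual
  that is consulted within the agreed generations.\<close>

lemma tree_pagerank_eq:
  assumes ag: "agrees k N E" and T: "tree_of E \<subseteq>\<^sub>m T" and gr: "graph_of E \<subseteq>\<^sub>m G"
    and u: "tree_of E u = Some i" "i < n" "length u + l \<le> k"
  shows "tree_pagerank N D c r\<^sub>0 T l u = power_iteration n c r\<^sub>0 M l i"
  using u
proof (induction l arbitrary: u i)
  case (Suc l)
  have Tu: "T u = Some i" using map_leD[OF T] Suc.prems by blast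
  have child: "c / real (D (the (T (u @ [a])))) * tree_pagerank N D c r\<^sub>0 T l (u @ [a])
      = c / real (D (fst (the (G (i, a))))) * power_iteration n c r\<^sub>0 M l (fst (the (G (i, a))))"
    if a: "a < N i" for a
  proof -
    have "length u < k" using Suc.prems by simp
    then obtain j b where j: "tree_of E (u @ [a]) = Some j" "graph_of E (i, a) = Some (j, b)"
      using ag[unfolded agrees_def, rule_format, OF \<open>length u < k\<close> Suc.prems(1) a] by blast
    have *: "T (u @ [a]) = Some j" "G (i, a) = Some (j, b)" using j map_leD[OF T] map_leD[OF gr] by blast+
    have "tree_pagerank N D c r\<^sub>0 T l (u @ [a]) = power_iteration n c r\<^sub>0 M l j"
      using Suc.IH[OF j(1)] edge_tail[OF *(2)] Suc.prems(3) by simp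
    thus ?thesis using * by simp
  qed
  have "tree_pagerank N D c r\<^sub>0 T (Suc l) u
     = (\<Sum>a<N i. c / real (D (the (T (u @ [a])))) * tree_pagerank N D c r\<^sub>0 T l (u @ [a])) + (1 - c)"
    by (simp add: Tu)
  also have "(\<Sum>a<N i. c / real (D (the (T (u @ [a])))) * tree_pagerank N D c r\<^sub>0 T l (u @ [a]))
     = (\<Sum>a<N i. c / real (D (fst (the (G (i, a))))) * power_iteration n c r\<^sub>0 M l (fst (the (G (i, a)))))"
    by (intro sum.cong refl child) simp
  also have "\<dots> = (\<Sum>j<n. power_iteration n c r\<^sub>0 M l j * M j i)"
    by (rule column_sum[OF Suc.prems(2), symmetric])
  finally show ?case by simp
qed simp

end

section \<open>Truncation and coupling error for a fixed bi-degree sequence\<close>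

lemma prob_bind_pmf_le:
  assumes "\<And>x. x \<in> set_pmf p \<Longrightarrow> good x \<Longrightarrow> measure_pmf.prob (f x) B \<le> b" "b \<ge> 0"
  shows "measure_pmf.prob (bind_pmf p f) B \<le> b + measure_pmf.prob p {x. \<not> good x}"
proof -
  have "measure_pmf.prob (bind_pmf p f) B = measure_pmf.expectation p (\<lambda>x. measure_pmf.prob (f x) B)"
    by (rule prob_bind_pmf)
  also have "\<dots> \<le> measure_pmf.expectation p (\<lambda>x. b + indicator {x. \<not> good x} x)"
  proof (rule integral_mono_AE)
    show "integrable (measure_pmf p) (\<lambda>x. measure_pmf.prob (f x) B)"
      by (rule measure_pmf.integrable_const_bound[where B = 1]) auto
    show "integrable (measure_pmf p) (\<lambda>x. b + indicator {x. \<not> good x} x)"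
      by (rule measure_pmf.integrable_const_bound[where B = "\<bar>b\<bar> + 1"]) (auto simp: indicator_def)
    show "AE x in p. measure_pmf.prob (f x) B \<le> b + indicator {x. \<not> good x} x"
      unfolding AE_measure_pmf_iff
    proof
      fix x assume x: "x \<in> set_pmf p"
      show "measure_pmf.prob (f x) B \<le> b + indicator {x. \<not> good x} x"
      proof (cases "good x")
        case False
        hence "indicator {x. \<not> good x} x = (1 :: real)" by simp
        thus ?thesis using assms(2) measure_pmf.prob_le_1[of "f x" B] by linarith
      qed (use assms(1)[OF x] in simp)
    qed
  qed
  also have "\<dots> = b + measure_pmf.prob p {x. \<not> good x}"
    by (subst Bochner_Integration.integral_add) (auto simp: measure_pmf.emeasure_eq_measure)
  finally show ?thesis .
qed

text \<open>Outside a disagreement the tree value is the k-th power iteration, so the event splits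
  into a truncation error, which depends on (v, G), and a disagreement, which depends on (v, E).
  Neither of these laws depends on how \<open>K\<close> joins graph and tree, and a union bound
  covers every continuation.\<close>

lemma prob_fixed_degrees:
  fixes m \<nu> L \<epsilon> c r\<^sub>0 :: real and x :: nat
  assumes n: "n > 0" and c: "0 < c" "c < 1" and r0: "r\<^sub>0 \<ge> 0" and eps: "\<epsilon> > 0"
    and K: "is_continuation n k K"
    and sums: "(\<Sum>i<n. N i) = (\<Sum>i<n. D i)"
    and L: "L = real (\<Sum>i<n. D i)" "L > 0"
    and sumN: "(\<Sum>i<n. real (D i) * real (N i)) \<le> m * L"
    and sumD: "(\<Sum>i<n. real (D i) * real (D i)) \<le> \<nu> * L"
    and m: "m \<ge> 0" and \<nu>: "\<nu> \<ge> 0" and x: "x > 0"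
  shows "measure_pmf.prob
       (bind_pmf (pmf_of_set {..<n}) (\<lambda>v. bind_pmf (explore n N D v) (\<lambda>E.
          bind_pmf (K N D E) (\<lambda>(G, T). return_pmf (N, D, v, G, T)))))
       {(N, D, v, G, T). \<bar>pagerank n D c G v - tree_pagerank N D c r\<^sub>0 T k []\<bar> > \<epsilon>}
     \<le> (r\<^sub>0 + 1) * inverse \<epsilon> * c ^ k
        + (L / real n * progeny_weight m k 1 / real x + (real x / real n + \<nu> * (real x)\<^sup>2 / L))"
proof -
  \<comment> \<open>The exploration is kept as a component here, since agreement is a property of
    \<open>E\<close> that the final outcome no longer shows.\<close>
  define J where "J = bind_pmf (pmf_of_set {..<n}) (\<lambda>v. bind_pmf (explore n N D v) (\<lambda>E.
          bind_pmf (K N D E) (\<lambda>(G, T). return_pmf (v, E, G, T))))"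
  have ne: "{..<n} \<noteq> {}" using n by (auto simp: lessThan_empty_iff)
  have S: "out_stubs n D \<noteq> {}" "L = real (card (out_stubs n D))"
    using L by (auto simp: card_out_stubs[symmetric])
  have K1: "map_pmf fst (K N D E) = complete_pairing n N D (graph_of E)"
    and K2: "map_pmf snd (K N D E) = grow_tree n N D k (tree_of E)" for E
    using K unfolding is_continuation_def by blast+
  let ?Q = "complete_pairing n N D Map.empty"
  \<comment> \<open>For each v the explored and then completed graph has the law of a pairing from
    scratch. That law is free of v, so the two draws commute and v is uniform given G.\<close>
  have law_vG: "map_pmf (\<lambda>(v, E, G, T). (v, G)) J = bind_pmf ?Q (\<lambda>G. map_pmf (\<lambda>v. (v, G)) (pmf_of_set {..<n}))"
  proof -
    have "map_pmf (\<lambda>(v, E, G, T). (v, G)) J = bind_pmf (pmf_of_set {..<n}) (\<lambda>v. bind_pmf (explore n N D v)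
        (\<lambda>E. bind_pmf (complete_pairing n N D (graph_of E)) (\<lambda>G. return_pmf (v, G))))"
      unfolding J_def K1[symmetric]
      by (simp add: map_bind_pmf bind_map_pmf case_prod_unfold)
    also have "\<dots> = bind_pmf (pmf_of_set {..<n}) (\<lambda>v. bind_pmf (bind_pmf (explore n N D v)
        (\<lambda>E. complete_pairing n N D (graph_of E))) (\<lambda>G. return_pmf (v, G)))"
      by (simp add: bind_assoc_pmf)
    also have "\<dots> = bind_pmf (pmf_of_set {..<n}) (\<lambda>v. bind_pmf ?Q (\<lambda>G. return_pmf (v, G)))"
      using ne by (intro bind_pmf_cong refl) (simp add: explore_complete_pairing[OF sums S(1)])
    also have "\<dots> = bind_pmf ?Q (\<lambda>G. bind_pmf (pmf_of_set {..<n}) (\<lambda>v. return_pmf (v, G)))"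
      by (rule bind_commute_pmf)
    finally show ?thesis by (simp add: map_pmf_def)
  qed
  have law_vE: "map_pmf (\<lambda>(v, E, G, T). (v, E)) J = bind_pmf (pmf_of_set {..<n}) (\<lambda>v. map_pmf (Pair v) (explore n N D v))"
    unfolding J_def by (simp add: case_prod_unfold map_pmf_def bind_assoc_pmf bind_return_pmf)
  have cg: "complete_graph n N D c G" if "G \<in> set_pmf ?Q" for G
    using complete_pairing_support[OF sums that] c by unfold_locales
  let ?pi = "\<lambda>G. power_iteration n c r\<^sub>0 (pagerank_matrix D c G) k"
  let ?B = "{(v, E, G, T). \<bar>pagerank n D c G v - tree_pagerank N D c r\<^sub>0 T k []\<bar> > \<epsilon>}"
  let ?B1 = "(\<lambda>(v, E :: exploration, G, T :: labelled_tree). (v, G)) -` {(v, G). \<bar>pagerank n D c G v - ?pi G v\<bar> > \<epsilon>}"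
  let ?B2 = "(\<lambda>(v, E, G :: pairing, T :: labelled_tree). (v, E)) -` {(v :: nat, E). \<not> agrees k N E}"
  have "measure_pmf.prob
       (bind_pmf (pmf_of_set {..<n}) (\<lambda>v. bind_pmf (explore n N D v) (\<lambda>E.
          bind_pmf (K N D E) (\<lambda>(G, T). return_pmf (N, D, v, G, T)))))
       {(N, D, v, G, T). \<bar>pagerank n D c G v - tree_pagerank N D c r\<^sub>0 T k []\<bar> > \<epsilon>}
     = measure_pmf.prob (map_pmf (\<lambda>(v, E, G, T). (N, D, v, G, T)) J)
       {(N, D, v, G, T). \<bar>pagerank n D c G v - tree_pagerank N D c r\<^sub>0 T k []\<bar> > \<epsilon>}"
    unfolding J_def by (simp add: map_bind_pmf case_prod_unfold)
  also have "\<dots> = measure_pmf.prob J ?B"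
    unfolding measure_map_pmf by (rule arg_cong[where f = "measure_pmf.prob J"]) auto
  also have "\<dots> \<le> measure_pmf.prob J (?B1 \<union> ?B2)"
  proof (rule measure_pmf.finite_measure_mono_AE)
    show "AE z in J. z \<in> ?B \<longrightarrow> z \<in> ?B1 \<union> ?B2"
      unfolding AE_measure_pmf_iff
    proof
      fix z assume z: "z \<in> set_pmf J"
      obtain v E G T where z_eq: "z = (v, E, G, T)" by (cases z)
      from z have v: "v < n" and E: "E \<in> set_pmf (explore n N D v)" and GT: "(G, T) \<in> set_pmf (K N D E)"
        unfolding J_def z_eq using ne by auto
      have "fst (G, T) \<in> set_pmf (map_pmf fst (K N D E))" using GT by (metis image_eqI set_map_pmf)
      hence "graph_of E \<subseteq>\<^sub>m G" unfolding K1 using complete_pairing_extends by simp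
      have "snd (G, T) \<in> set_pmf (map_pmf snd (K N D E))" using GT by (metis image_eqI set_map_pmf)
      hence "T \<in> set_pmf (grow_tree n N D k (tree_of E))" unfolding K2 by simp
      moreover have "finite (dom (tree_of E))"
        using explore_steps_tree[OF S(1) E[unfolded explore_def]] by (simp add: init_exploration_def)
      ultimately have "tree_of E \<subseteq>\<^sub>m T" using grow_tree_extends by blast
      have root: "tree_of E [] = Some v"
        using explore_steps_root[OF S(1) E[unfolded explore_def] _ bfs_invariant_init[OF v]]
        by (simp add: init_exploration_def)
      \<comment> \<open>The support of the law just computed shows that G is a full pairing of all
        stubs, although it was built in two stages.\<close>
      have "(v, G) \<in> set_pmf (map_pmf (\<lambda>(v, E, G, T). (v, G)) J)"
        using z unfolding z_eq set_map_pmf by force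
      hence "G \<in> set_pmf ?Q" unfolding law_vG by auto
      then interpret complete_graph n N D c G by (rule cg)
      show "z \<in> ?B \<longrightarrow> z \<in> ?B1 \<union> ?B2"
        using tree_pagerank_eq[OF _ \<open>tree_of E \<subseteq>\<^sub>m T\<close> \<open>graph_of E \<subseteq>\<^sub>m G\<close> root v, of k k r\<^sub>0]
        by (auto simp: z_eq)
    qed
  qed auto
  also have "\<dots> \<le> measure_pmf.prob J ?B1 + measure_pmf.prob J ?B2"
    by (rule measure_Un_le) auto
  also have "measure_pmf.prob J ?B1 \<le> (r\<^sub>0 + 1) * inverse \<epsilon> * c ^ k"
  proof -
    have "measure_pmf.prob J ?B1 = measure_pmf.prob (map_pmf (\<lambda>(v, E, G, T). (v, G)) J)
        {(v, G). \<bar>pagerank n D c G v - ?pi G v\<bar> > \<epsilon>}" by simp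
    also have "\<dots> \<le> (r\<^sub>0 + 1) * inverse \<epsilon> * c ^ k + measure_pmf.prob ?Q {x. \<not> True}"
      unfolding law_vG
    proof (rule prob_bind_pmf_le)
      fix G assume G: "G \<in> set_pmf ?Q"
      interpret complete_graph n N D c G by (rule cg[OF G])
      \<comment> \<open>Markov's inequality for the uniform node: the l1-error bounds the number of
        nodes whose error exceeds \<epsilon>.\<close>
      let ?V = "{v \<in> {..<n}. \<bar>pagerank n D c G v - ?pi G v\<bar> > \<epsilon>}"
      have "real (card ?V) * \<epsilon> = (\<Sum>v\<in>?V. \<epsilon>)" by simp
      also have "\<dots> \<le> (\<Sum>v\<in>?V. \<bar>pagerank n D c G v - ?pi G v\<bar>)" by (intro sum_mono) auto
      also have "\<dots> \<le> (\<Sum>v<n. \<bar>pagerank n D c G v - ?pi G v\<bar>)" by (intro sum_mono2) auto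
      also have "\<dots> \<le> real n * (r\<^sub>0 + 1) * c ^ k" by (rule pagerank_error[OF r0])
      finally have "real (card ?V) / real n \<le> (r\<^sub>0 + 1) * inverse \<epsilon> * c ^ k"
        using eps n by (simp add: field_simps)
      moreover have "measure_pmf.prob (map_pmf (\<lambda>v. (v, G)) (pmf_of_set {..<n}))
          {(v, G). \<bar>pagerank n D c G v - ?pi G v\<bar> > \<epsilon>} = real (card ?V) / real n"
        using ne by (simp add: measure_pmf_of_set vimage_def Int_def)
      ultimately show "measure_pmf.prob (map_pmf (\<lambda>v. (v, G)) (pmf_of_set {..<n}))
          {(v, G). \<bar>pagerank n D c G v - ?pi G v\<bar> > \<epsilon>} \<le> (r\<^sub>0 + 1) * inverse \<epsilon> * c ^ k" by simp
    qed (use r0 eps c in simp)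
    finally show ?thesis by simp
  qed
  also have "measure_pmf.prob J ?B2 \<le> L / real n * progeny_weight m k 1 / real x + (real x / real n + \<nu> * (real x)\<^sup>2 / L)"
  proof -
    let ?w = "progeny_weight m k 1"
    have Ncard: "(\<Sum>i<n. real (N i)) = L" "(\<Sum>i<n. real (D i)) = L"
      using L(1) sums by (simp_all flip: of_nat_sum)
    have "measure_pmf.prob J ?B2 = measure_pmf.prob (map_pmf (\<lambda>(v, E, G, T). (v, E)) J)
        {(v, E). \<not> agrees k N E}" by simp
    also have "\<dots> = (\<Sum>v<n. measure_pmf.prob (explore n N D v) {E. \<not> agrees k N E}) / real n"
      unfolding law_vE using ne by (subst prob_bind_pmf_of_set) (simp_all add: vimage_def)
    finally have J: "measure_pmf.prob J ?B2
        = (\<Sum>v<n. measure_pmf.prob (explore n N D v) {E. \<not> agrees k N E}) / real n" .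
    have "(\<Sum>v<n. measure_pmf.prob (explore n N D v) {E. \<not> agrees k N E})
       \<le> (\<Sum>v<n. real (N v) * ?w / real x + (real x * real (D v) + \<nu> * (real x)\<^sup>2) / L)"
      by (intro sum_mono prob_explore_disagree S(2) L(2) sumN sumD m \<nu> x) simp
    also have "\<dots> = (\<Sum>v<n. real (N v)) * ?w / real x + (real x * (\<Sum>v<n. real (D v)) + real n * (\<nu> * (real x)\<^sup>2)) / L"
      by (simp add: sum.distrib sum_distrib_left sum_distrib_right sum_divide_distrib add_divide_distrib)
    also have "\<dots> = (L / real n * ?w / real x + (real x / real n + \<nu> * (real x)\<^sup>2 / L)) * real n"
      unfolding Ncard using n L(2) x by (simp add: field_simps)
    finally show ?thesis unfolding J using n by (simp add: pos_divide_le_eq)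
  qed
  finally show ?thesis by simp
qed

section \<open>Typical bi-degree sequences\<close>

abbreviation iid_pair :: "nat pmf \<Rightarrow> nat pmf \<Rightarrow> nat \<Rightarrow> ((nat \<Rightarrow> nat) \<times> (nat \<Rightarrow> nat)) pmf" where
  "iid_pair Fin Fout n \<equiv> pair_pmf (Pi_pmf {..<n} 0 (\<lambda>_. Fin)) (Pi_pmf {..<n} 0 (\<lambda>_. Fout))"

text \<open>Estimates for the i.i.d. sample carry over to the accepted one at the price of a factor
  2; the same lower bound gives \<open>cond_pmf\<close> its intended meaning.\<close>

lemma prob_cond_pmf_le:
  assumes "measure_pmf.prob p A \<ge> 1 / 2"
  shows "set_pmf (cond_pmf p A) = set_pmf p \<inter> A"
    and "measure_pmf.prob (cond_pmf p A) B \<le> 2 * measure_pmf.prob p B"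
proof -
  have ne: "set_pmf p \<inter> A \<noteq> {}"
  proof
    assume "set_pmf p \<inter> A = {}"
    hence "measure_pmf.prob p A = 0" by (simp add: measure_pmf_zero_iff)
    thus False using assms by simp
  qed
  thus "set_pmf (cond_pmf p A) = set_pmf p \<inter> A" by simp
  have "emeasure p A \<noteq> 0" using assms by (simp add: measure_pmf.emeasure_eq_measure)
  hence "measure_pmf.prob (cond_pmf p A) B = measure_pmf.prob p (A \<inter> B) / measure_pmf.prob p A"
    using ne by (simp add: cond_pmf.rep_eq measure_pmf.emeasure_eq_measure)
  also have "\<dots> \<le> measure_pmf.prob p B / (1 / 2)"
    using assms by (intro frac_le measure_pmf.finite_measure_mono) auto
  finally show "measure_pmf.prob (cond_pmf p A) B \<le> 2 * measure_pmf.prob p B" by simp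
qed

lemma expectation_pair_pmf_mult:
  fixes g :: "'a \<Rightarrow> real" and h :: "'b \<Rightarrow> real"
  assumes "integrable (measure_pmf p) g" "integrable (measure_pmf q) h" "\<And>x. g x \<ge> 0" "\<And>y. h y \<ge> 0"
  shows "integrable (measure_pmf (pair_pmf p q)) (\<lambda>z. g (fst z) * h (snd z))"
    and "measure_pmf.expectation (pair_pmf p q) (\<lambda>z. g (fst z) * h (snd z))
       = measure_pmf.expectation p g * measure_pmf.expectation q h"
proof -
  have g: "(\<integral>\<^sup>+x. ennreal (g x) \<partial>p) = ennreal (measure_pmf.expectation p g)"
    and h: "(\<integral>\<^sup>+y. ennreal (h y) \<partial>q) = ennreal (measure_pmf.expectation q h)"
    using assms by (auto intro!: nn_integral_eq_integral)
  have g0: "measure_pmf.expectation p g \<ge> 0" and h0: "measure_pmf.expectation q h \<ge> 0"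
    using assms by (auto intro!: integral_nonneg_AE)
  have "(\<integral>\<^sup>+z. ennreal (g (fst z) * h (snd z)) \<partial>pair_pmf p q)
      = (\<integral>\<^sup>+x. ennreal (g x) * (\<integral>\<^sup>+y. ennreal (h y) \<partial>q) \<partial>p)"
    using assms by (simp add: nn_integral_pair_pmf' ennreal_mult nn_integral_cmult)
  also have "\<dots> = ennreal (measure_pmf.expectation p g * measure_pmf.expectation q h)"
    using g0 h0 by (simp add: h nn_integral_multc g ennreal_mult)
  finally have *: "(\<integral>\<^sup>+z. ennreal (g (fst z) * h (snd z)) \<partial>pair_pmf p q)
      = ennreal (measure_pmf.expectation p g * measure_pmf.expectation q h)" .
  have "integrable (measure_pmf (pair_pmf p q)) (\<lambda>z. g (fst z) * h (snd z)) \<and>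
      measure_pmf.expectation (pair_pmf p q) (\<lambda>z. g (fst z) * h (snd z))
       = measure_pmf.expectation p g * measure_pmf.expectation q h"
    by (subst nn_integral_eq_integrable[symmetric]) (use * g0 h0 assms in auto)
  thus "integrable (measure_pmf (pair_pmf p q)) (\<lambda>z. g (fst z) * h (snd z))"
    and "measure_pmf.expectation (pair_pmf p q) (\<lambda>z. g (fst z) * h (snd z))
       = measure_pmf.expectation p g * measure_pmf.expectation q h" by auto
qed

lemma weak_law_rate_pair:
  fixes X :: "nat \<times> nat \<Rightarrow> real"
  assumes p: "1 < p" "p \<le> 2"
    and intp: "integrable (measure_pmf (pair_pmf Fin Fout)) (\<lambda>z. \<bar>X z\<bar> powr p)"
    and int: "integrable (measure_pmf (pair_pmf Fin Fout)) X"
    and mean: "measure_pmf.expectation (pair_pmf Fin Fout) X = m"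
  obtains C where "C \<ge> 0" "\<And>(n::nat) t. t > 0 \<Longrightarrow>
     measure_pmf.prob (iid_pair Fin Fout n)
       {(x, y). \<bar>(\<Sum>i<n. X (x i, y i)) - real n * m\<bar> > t} \<le> C * real n * t powr (- p)"
proof -
  obtain C where C: "C \<ge> 0" "\<And>(n::nat) t. t > 0 \<Longrightarrow>
     measure_pmf.prob (Pi_pmf {..<n} (0, 0) (\<lambda>_. pair_pmf Fin Fout))
       {f. \<bar>(\<Sum>i<n. X (f i)) - real n * m\<bar> > t} \<le> C * real n * t powr (- p)"
    using weak_law_rate[OF p intp int mean, of "(0, 0)"] by blast
  show thesis
  proof (rule that[OF C(1)])
    fix n :: nat and t :: real assume "t > 0"
    from C(2)[OF this, of n] show "measure_pmf.prob (iid_pair Fin Fout n)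
       {(x, y). \<bar>(\<Sum>i<n. X (x i, y i)) - real n * m\<bar> > t} \<le> C * real n * t powr (- p)"
      by (simp add: pair_Pi_pmf vimage_def)
  qed
qed

lemma nn_integral_sum_iid_pair:
  fixes g h :: "nat \<Rightarrow> real"
  assumes "integrable (measure_pmf Fin) g" "integrable (measure_pmf Fout) h" "\<And>x. g x \<ge> 0" "\<And>y. h y \<ge> 0"
  shows "(\<integral>\<^sup>+z. ennreal (\<Sum>i<n. g (fst z i) + h (snd z i)) \<partial>iid_pair Fin Fout n)
     = ennreal (real n * (measure_pmf.expectation Fin g + measure_pmf.expectation Fout h))"
proof -
  have comp: "(\<integral>\<^sup>+x. ennreal (f (x i)) \<partial>Pi_pmf {..<n} 0 (\<lambda>_. F)) = ennreal (measure_pmf.expectation F f)"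
    if "i < n" "integrable (measure_pmf F) f" "\<And>x. f x \<ge> 0" for F :: "nat pmf" and f :: "nat \<Rightarrow> real" and i
  proof -
    have "(\<integral>\<^sup>+x. ennreal (f (x i)) \<partial>Pi_pmf {..<n} 0 (\<lambda>_. F))
        = (\<integral>\<^sup>+x. ennreal (f x) \<partial>map_pmf (\<lambda>x. x i) (Pi_pmf {..<n} 0 (\<lambda>_. F)))" by simp
    also have "map_pmf (\<lambda>x. x i) (Pi_pmf {..<n} 0 (\<lambda>_. F)) = F"
      using that(1) by (simp add: Pi_pmf_component)
    also have "(\<integral>\<^sup>+x. ennreal (f x) \<partial>F) = ennreal (measure_pmf.expectation F f)"
      using that by (intro nn_integral_eq_integral) auto
    finally show ?thesis .
  qed
  have g0: "measure_pmf.expectation Fin g \<ge> 0" and h0: "measure_pmf.expectation Fout h \<ge> 0"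
    using assms by (auto intro!: integral_nonneg_AE)
  have "(\<integral>\<^sup>+z. ennreal (\<Sum>i<n. g (fst z i) + h (snd z i)) \<partial>iid_pair Fin Fout n)
     = (\<integral>\<^sup>+z. (\<Sum>i<n. ennreal (g (fst z i)) + ennreal (h (snd z i))) \<partial>iid_pair Fin Fout n)"
    using assms by (simp add: ennreal_plus flip: sum_ennreal)
  also have "\<dots> = (\<Sum>i<n. (\<integral>\<^sup>+x. ennreal (g (x i)) \<partial>Pi_pmf {..<n} 0 (\<lambda>_. Fin))
        + (\<integral>\<^sup>+y. ennreal (h (y i)) \<partial>Pi_pmf {..<n} 0 (\<lambda>_. Fout)))"
    by (simp add: nn_integral_sum nn_integral_add nn_integral_pair_pmf')
  also have "\<dots> = (\<Sum>i<n. ennreal (measure_pmf.expectation Fin g + measure_pmf.expectation Fout h))"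
    using comp assms g0 h0 by (intro sum.cong refl) (simp add: ennreal_plus)
  also have "\<dots> = ennreal (real n * (measure_pmf.expectation Fin g + measure_pmf.expectation Fout h))"
    using g0 h0 by (simp add: ennreal_mult ennreal_of_nat_eq_real_of_nat)
  finally show ?thesis .
qed

text \<open>The gap governs acceptance, the first sum the number of stubs, the mixed sum the mean
  offspring number. The last sum controls both the squares of the out-degrees and the effect of
  balancing; it is bounded by Markov's inequality for the first moment, hence the rate 1 /
  t.\<close>

lemma iid_pair_estimates:
  assumes p: "1 < p" "p \<le> 2"
    and Fp: "integrable (measure_pmf Fin) (\<lambda>j. real j powr p)" "integrable (measure_pmf Fout) (\<lambda>j. real j powr p)"
    and F2: "integrable (measure_pmf Fout) (\<lambda>j. (real j)\<^sup>2)"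
    and F1: "integrable (measure_pmf Fin) real" "integrable (measure_pmf Fout) real"
    and mean: "measure_pmf.expectation Fin real = \<mu>" "measure_pmf.expectation Fout real = \<mu>"
  obtains C where "C \<ge> 0"
    "\<And>(n::nat) t. t > 0 \<Longrightarrow> measure_pmf.prob (iid_pair Fin Fout n)
       {(x, y). real_of_int \<bar>degree_gap n x y\<bar> > t} \<le> C * real n * t powr (- p)"
    "\<And>(n::nat) t. t > 0 \<Longrightarrow> measure_pmf.prob (iid_pair Fin Fout n)
       {(x, y). \<bar>(\<Sum>i<n. real (x i)) - real n * \<mu>\<bar> > t} \<le> C * real n * t powr (- p)"
    "\<And>(n::nat) t. t > 0 \<Longrightarrow> measure_pmf.prob (iid_pair Fin Fout n)
       {(x, y). \<bar>(\<Sum>i<n. real (x i) * real (y i)) - real n * \<mu>\<^sup>2\<bar> > t} \<le> C * real n * t powr (- p)"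
    "\<And>(n::nat) t. t > 0 \<Longrightarrow> measure_pmf.prob (iid_pair Fin Fout n)
       {(x, y). (\<Sum>i<n. real (x i) powr p + (real (y i))\<^sup>2) \<ge> t} \<le> C * real n / t"
proof -
  let ?F = "pair_pmf Fin Fout"
  have fst_int: "integrable (measure_pmf ?F) (\<lambda>z. real (fst z))"
      "measure_pmf.expectation ?F (\<lambda>z. real (fst z)) = \<mu>"
    using expectation_pair_pmf_mult[where g = real and h = "\<lambda>_. 1" and p = Fin and q = Fout] F1 mean by auto
  have snd_int: "integrable (measure_pmf ?F) (\<lambda>z. real (snd z))"
      "measure_pmf.expectation ?F (\<lambda>z. real (snd z)) = \<mu>"
    using expectation_pair_pmf_mult[where h = real and g = "\<lambda>_. 1" and p = Fin and q = Fout] F1 mean by auto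
  have fst_p: "integrable (measure_pmf ?F) (\<lambda>z. real (fst z) powr p)"
    using expectation_pair_pmf_mult[where g = "\<lambda>j. real j powr p" and h = "\<lambda>_. 1" and p = Fin and q = Fout] Fp by auto
  have snd_p: "integrable (measure_pmf ?F) (\<lambda>z. real (snd z) powr p)"
    using expectation_pair_pmf_mult[where h = "\<lambda>j. real j powr p" and g = "\<lambda>_. 1" and p = Fin and q = Fout] Fp by auto
  have prod_int: "integrable (measure_pmf ?F) (\<lambda>z. real (fst z) * real (snd z))"
      "measure_pmf.expectation ?F (\<lambda>z. real (fst z) * real (snd z)) = \<mu>\<^sup>2"
    using expectation_pair_pmf_mult[where g = real and h = real and p = Fin and q = Fout] F1 mean
    by (auto simp: power2_eq_square)
  \<comment> \<open>By independence the product inherits its p-th moment from the two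
    factors.\<close>
  have prod_p: "integrable (measure_pmf ?F) (\<lambda>z. real (fst z) powr p * real (snd z) powr p)"
    using expectation_pair_pmf_mult[where g = "\<lambda>j. real j powr p" and h = "\<lambda>j. real j powr p" and p = Fin and q = Fout] Fp by auto
  have diff_p: "integrable (measure_pmf ?F) (\<lambda>z. \<bar>real (fst z) - real (snd z)\<bar> powr p)"
  proof (rule Bochner_Integration.integrable_bound)
    show "integrable (measure_pmf ?F) (\<lambda>z. real (fst z) powr p + real (snd z) powr p)"
      using fst_p snd_p by auto
    show "AE z in ?F. norm (\<bar>real (fst z) - real (snd z)\<bar> powr p) \<le> norm (real (fst z) powr p + real (snd z) powr p)"
    proof (rule AE_I2)
      fix z :: "nat \<times> nat"
      have "\<bar>real (fst z) - real (snd z)\<bar> powr p \<le> (max (real (fst z)) (real (snd z))) powr p"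
        using p by (intro powr_mono2) auto
      also have "\<dots> \<le> real (fst z) powr p + real (snd z) powr p" by (simp add: max_def)
      finally show "norm (\<bar>real (fst z) - real (snd z)\<bar> powr p) \<le> norm (real (fst z) powr p + real (snd z) powr p)"
        by simp
    qed
  qed simp
  obtain C1 where C1: "C1 \<ge> 0" "\<And>(n::nat) t. t > 0 \<Longrightarrow> measure_pmf.prob (iid_pair Fin Fout n)
       {(x, y). \<bar>(\<Sum>i<n. (\<lambda>z. real (fst z) - real (snd z)) (x i, y i)) - real n * 0\<bar> > t} \<le> C1 * real n * t powr (- p)"
    by (rule weak_law_rate_pair[OF p diff_p, of 0]) (use fst_int snd_int in auto)
  obtain C2 where C2: "C2 \<ge> 0" "\<And>(n::nat) t. t > 0 \<Longrightarrow> measure_pmf.prob (iid_pair Fin Fout n)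
       {(x, y). \<bar>(\<Sum>i<n. (\<lambda>z. real (fst z)) (x i, y i)) - real n * \<mu>\<bar> > t} \<le> C2 * real n * t powr (- p)"
    by (rule weak_law_rate_pair[OF p, of Fin Fout "\<lambda>z. real (fst z)" \<mu>]) (use fst_int fst_p in auto)
  obtain C3 where C3: "C3 \<ge> 0" "\<And>(n::nat) t. t > 0 \<Longrightarrow> measure_pmf.prob (iid_pair Fin Fout n)
       {(x, y). \<bar>(\<Sum>i<n. (\<lambda>z. real (fst z) * real (snd z)) (x i, y i)) - real n * \<mu>\<^sup>2\<bar> > t} \<le> C3 * real n * t powr (- p)"
    by (rule weak_law_rate_pair[OF p, of Fin Fout "\<lambda>z. real (fst z) * real (snd z)" "\<mu>\<^sup>2"])
       (use prod_int prod_p in \<open>auto simp: abs_mult powr_mult\<close>)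
  define C4 where "C4 = measure_pmf.expectation Fin (\<lambda>j. real j powr p) + measure_pmf.expectation Fout (\<lambda>j. (real j)\<^sup>2)"
  have C4: "C4 \<ge> 0" unfolding C4_def by (intro add_nonneg_nonneg integral_nonneg_AE) auto
  define C where "C = C1 + C2 + C3 + C4"
  have le: "C1 \<le> C" "C2 \<le> C" "C3 \<le> C" "C4 \<le> C" using C1(1) C2(1) C3(1) C4 by (auto simp: C_def)
  have mono: "c * real n * t powr (- p) \<le> C * real n * t powr (- p)" if "c \<le> C" for c t and n :: nat
    using that by (intro mult_right_mono) auto
  show thesis
  proof (rule that[of C])
    show "C \<ge> 0" using C1(1) le by linarith
    fix n :: nat and t :: real assume t: "t > 0"
    have gap: "real_of_int \<bar>degree_gap n x y\<bar> = \<bar>\<Sum>i<n. real (x i) - real (y i)\<bar>" for x y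
      by (simp add: degree_gap_def)
    show "measure_pmf.prob (iid_pair Fin Fout n)
       {(x, y). real_of_int \<bar>degree_gap n x y\<bar> > t} \<le> C * real n * t powr (- p)"
      using order_trans[OF C1(2)[OF t] mono[OF le(1)]] unfolding gap by simp
    show "measure_pmf.prob (iid_pair Fin Fout n)
       {(x, y). \<bar>(\<Sum>i<n. real (x i)) - real n * \<mu>\<bar> > t} \<le> C * real n * t powr (- p)"
      using order_trans[OF C2(2)[OF t] mono[OF le(2)]] by simp
    show "measure_pmf.prob (iid_pair Fin Fout n)
       {(x, y). \<bar>(\<Sum>i<n. real (x i) * real (y i)) - real n * \<mu>\<^sup>2\<bar> > t} \<le> C * real n * t powr (- p)"
      using order_trans[OF C3(2)[OF t] mono[OF le(3)]] by simp
    have "measure_pmf.prob (iid_pair Fin Fout n) {z. (\<Sum>i<n. real (fst z i) powr p + (real (snd z i))\<^sup>2) \<ge> t}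
        \<le> real n * C4 / t"
      by (rule prob_le_of_nn_integral[OF _ t])
         (use nn_integral_sum_iid_pair[OF Fp(1) F2, of n] C4 in \<open>simp_all add: C4_def\<close>)
    also have "\<dots> \<le> C * real n / t" using le(4) t by (simp add: divide_right_mono mult_right_mono mult.commute[of "real n"])
    finally show "measure_pmf.prob (iid_pair Fin Fout n)
       {(x, y). (\<Sum>i<n. real (x i) powr p + (real (y i))\<^sup>2) \<ge> t} \<le> C * real n / t"
      by (simp add: case_prod_unfold)
  qed
qed

text \<open>The parameter m bounds the mean offspring number of a non-root individual. The sum of
  squares may exceed the order n by n^e, so that a first-moment bound already yields a polynomially
  small failure probability.\<close>

definition good_degrees :: "real \<Rightarrow> real \<Rightarrow> real \<Rightarrow> nat \<Rightarrow> (nat \<Rightarrow> nat) \<Rightarrow> (nat \<Rightarrow> nat) \<Rightarrow> bool" where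
  "good_degrees m b e n N D \<longleftrightarrow> (\<Sum>i<n. N i) = (\<Sum>i<n. D i) \<and>
     real n \<le> real (\<Sum>i<n. D i) \<and> real (\<Sum>i<n. D i) \<le> b * real n \<and>
     (\<Sum>i<n. real (D i) * real (N i)) \<le> m * real (\<Sum>i<n. D i) \<and>
     (\<Sum>i<n. real (D i) * real (D i)) \<le> 4 * real n powr (1 + e)"

text \<open>Above \<open>K\<close> one has j = j powr (1 - p) * j powr p, where the first factor is
  at most \<open>K powr (1 - p)\<close> because p > 1.\<close>

lemma le_cutoff:
  fixes K p z :: real and j :: nat
  assumes "K \<ge> 1" "1 < p" and z: "real j powr p \<le> z"
  shows "real j \<le> K + K powr (1 - p) * z"
proof (cases "real j \<le> K")
  case True
  have "z \<ge> 0" using z powr_ge_zero[of "real j" p] by linarith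
  hence "0 \<le> K powr (1 - p) * z" by simp
  thus ?thesis using True by linarith
next
  case False
  hence j: "real j > 0" using assms by linarith
  have "real j = real j powr (1 - p) * real j powr p" using j by (simp add: powr_add[symmetric])
  also have "\<dots> \<le> K powr (1 - p) * z"
    using False assms by (intro mult_mono powr_mono2') auto
  also have "\<dots> \<le> K + \<dots>" using assms by simp
  finally show ?thesis .
qed

text \<open>No randomness of \<open>I\<close> is used: the contribution of few nodes to the sums is bounded by cutting
  the degrees off at \<open>K\<close>.\<close>

lemma good_degrees_adjusted:
  fixes x y N D :: "nat \<Rightarrow> nat"
  assumes I: "I \<subseteq> {..<n}" "card I = nat \<bar>degree_gap n x y\<bar>"
    and N: "N = (\<lambda>i. if degree_gap n x y < 0 \<and> i \<in> I then x i + 1 else x i)"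
    and D: "D = (\<lambda>i. if degree_gap n x y \<ge> 0 \<and> i \<in> I then y i + 1 else y i)"
    and p: "1 < p" "p \<le> 2" and \<mu>: "\<mu> > 1" and m: "m \<ge> 0"
    and S1: "\<bar>(\<Sum>i<n. real (x i)) - real n * \<mu>\<bar> \<le> \<eta> * real n"
    and S2: "\<bar>(\<Sum>i<n. real (x i) * real (y i)) - real n * \<mu>\<^sup>2\<bar> \<le> \<eta> * real n"
    and S3: "(\<Sum>i<n. real (x i) powr p + (real (y i))\<^sup>2) \<le> real n powr (1 + e)"
    and card: "card I \<le> n" and K: "K \<ge> 1"
    and slack: "2 * K * real (card I) + K powr (1 - p) * real n powr (1 + e) \<le> \<eta> * real n"
    and \<eta>: "\<eta> \<le> \<mu> - 1" "\<eta> \<le> 1" "\<mu>\<^sup>2 + 2 * \<eta> \<le> m * (\<mu> - \<eta>)"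
    and Q: "real n \<le> real n powr (1 + e)"
  shows "good_degrees m (\<mu> + 2) e n N D"
proof -
  let ?g = "degree_gap n x y"
  have fI: "finite I" using I(1) finite_subset by blast
  have gap: "?g = int (\<Sum>i<n. x i) - int (\<Sum>i<n. y i)" by (simp add: degree_gap_def sum_subtractf)
  have ind: "(\<Sum>i<n. if P \<and> i \<in> I then f i + 1 else f i) = (\<Sum>i<n. f i) + (if P then card I else 0)"
    for P and f :: "nat \<Rightarrow> nat"
  proof -
    have "(\<Sum>i<n. if P \<and> i \<in> I then f i + 1 else f i) = (\<Sum>i<n. f i + (if P \<and> i \<in> I then 1 else 0))"
      by (intro sum.cong) auto
    also have "\<dots> = (\<Sum>i<n. f i) + (\<Sum>i<n. if P \<and> i \<in> I then 1 else 0)" by (rule sum.distrib)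
    also have "(\<Sum>i<n. if P \<and> i \<in> I then 1 else 0) = (if P then card I else (0 :: nat))"
      using I(1) by (simp add: sum.If_cases Int_absorb1)
    finally show ?thesis .
  qed
  have sumN: "(\<Sum>i<n. N i) = (\<Sum>i<n. x i) + (if ?g < 0 then card I else 0)"
    and sumD: "(\<Sum>i<n. D i) = (\<Sum>i<n. y i) + (if ?g \<ge> 0 then card I else 0)"
    unfolding N D by (rule ind)+
  have "a + (if d < 0 then c else 0) = b + (if d \<ge> 0 then c else 0)"
    if "d = int a - int b" "c = nat \<bar>d\<bar>" for a b c d
    using that by auto
  from this[OF gap I(2)] have eq: "(\<Sum>i<n. N i) = (\<Sum>i<n. D i)" unfolding sumN sumD .
  have Lx: "real (\<Sum>i<n. D i) = (\<Sum>i<n. real (x i)) + (if ?g < 0 then real (card I) else 0)"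
    unfolding eq[symmetric] sumN by simp
  have lower: "real n * (\<mu> - \<eta>) \<le> real (\<Sum>i<n. D i)"
    using S1 unfolding Lx by (auto simp: algebra_simps abs_le_iff)
  have "real n * 1 \<le> real n * (\<mu> - \<eta>)" using \<eta> by (intro mult_left_mono) auto
  hence L1: "real n \<le> real (\<Sum>i<n. D i)" using lower by linarith
  \<comment> \<open>In the constant \<mu> + 2 one unit pays for the fluctuation \<eta> and one for
    the added stubs, at most n in number.\<close>
  have "\<eta> * real n \<le> 1 * real n" using \<eta> by (intro mult_right_mono) auto
  hence L2: "real (\<Sum>i<n. D i) \<le> (\<mu> + 2) * real n"
    using S1 card unfolding Lx by (auto simp: algebra_simps abs_le_iff)
  have cut: "real (x i) + real (y i) \<le> 2 * K + K powr (1 - p) * (real (x i) powr p + (real (y i))\<^sup>2)" for i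
  proof -
    have "real (y i) powr p \<le> (real (y i))\<^sup>2"
    proof (cases "y i")
      case (Suc j)
      hence "real (y i) powr p \<le> real (y i) powr 2" using p by (intro powr_mono) auto
      thus ?thesis using Suc by (simp add: powr_numeral)
    qed (use p in simp)
    from le_cutoff[OF K p(1) this] le_cutoff[OF K p(1) order_refl, of "x i"]
    show ?thesis by (simp add: algebra_simps)
  qed
  \<comment> \<open>The sign of the gap decides which of the two degrees is raised, so never both: a
    product with i in I grows by x i or by y i, without a cross term.\<close>
  have "(\<Sum>i<n. real (D i) * real (N i)) \<le> (\<Sum>i<n. real (x i) * real (y i) + (if i \<in> I then real (x i) + real (y i) else 0))"
    unfolding N D by (intro sum_mono) (auto simp: algebra_simps)
  also have "\<dots> = (\<Sum>i<n. real (x i) * real (y i)) + (\<Sum>i\<in>I. real (x i) + real (y i))"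
    using I(1) by (simp add: sum.distrib sum.If_cases Int_absorb1)
  also have "(\<Sum>i\<in>I. real (x i) + real (y i)) \<le> (\<Sum>i\<in>I. 2 * K + K powr (1 - p) * (real (x i) powr p + (real (y i))\<^sup>2))"
    by (intro sum_mono cut)
  also have "\<dots> = 2 * K * real (card I) + K powr (1 - p) * (\<Sum>i\<in>I. real (x i) powr p + (real (y i))\<^sup>2)"
    by (simp add: sum.distrib sum_distrib_left algebra_simps)
  also have "(\<Sum>i\<in>I. real (x i) powr p + (real (y i))\<^sup>2) \<le> (\<Sum>i<n. real (x i) powr p + (real (y i))\<^sup>2)"
    using I(1) by (intro sum_mono2) auto
  also note S3
  also note slack
  finally have "(\<Sum>i<n. real (D i) * real (N i)) \<le> (\<Sum>i<n. real (x i) * real (y i)) + \<eta> * real n"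
    by (simp add: mult_left_mono)
  also have "\<dots> \<le> real n * (\<mu>\<^sup>2 + 2 * \<eta>)" using S2 by (simp add: algebra_simps abs_le_iff)
  also have "\<dots> \<le> real n * (m * (\<mu> - \<eta>))" using \<eta> by (intro mult_left_mono) auto
  also have "\<dots> = m * (real n * (\<mu> - \<eta>))" by simp
  also have "\<dots> \<le> m * real (\<Sum>i<n. D i)" using m by (intro mult_left_mono lower)
  finally have DN: "(\<Sum>i<n. real (D i) * real (N i)) \<le> m * real (\<Sum>i<n. D i)" .
  have "(\<Sum>i<n. real (D i) * real (D i)) \<le> (\<Sum>i<n. 2 * (real (x i) powr p + (real (y i))\<^sup>2) + 2)"
  proof (rule sum_mono)
    fix i
    have "real (D i) * real (D i) \<le> (real (y i) + 1) * (real (y i) + 1)"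
      unfolding D by (intro mult_mono) auto
    also have "\<dots> \<le> 2 * (real (y i))\<^sup>2 + 2"
      using sum_squares_ge_zero[of "real (y i) - 1" 0] by (simp add: power2_eq_square algebra_simps)
    also have "\<dots> \<le> 2 * (real (x i) powr p + (real (y i))\<^sup>2) + 2" by simp
    finally show "real (D i) * real (D i) \<le> 2 * (real (x i) powr p + (real (y i))\<^sup>2) + 2" .
  qed
  also have "\<dots> = 2 * (\<Sum>i<n. real (x i) powr p + (real (y i))\<^sup>2) + 2 * real n"
    unfolding sum.distrib[of _ "\<lambda>_. 2"] sum_distrib_left[symmetric] by simp
  \<comment> \<open>Both the sum of moments and n are at most n powr (1 + e), and each enters with
    the factor 2 from (y + 1)^2 \<le> 2 y^2 + 2.\<close>
  also have "\<dots> \<le> 4 * real n powr (1 + e)" using S3 Q by linarith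
  finally show ?thesis using eq L1 L2 DN unfolding good_degrees_def by blast
qed

lemma eventually_powr_le:
  fixes s t c d :: real
  assumes "s < t" "d > 0"
  shows "eventually (\<lambda>n. c * real n powr s \<le> d * real n powr t) sequentially"
proof -
  have "((\<lambda>n. real n powr (s - t)) \<longlongrightarrow> 0) sequentially"
    using assms by (intro tendsto_neg_powr filterlim_real_sequentially) auto
  hence "((\<lambda>n. c * real n powr (s - t)) \<longlongrightarrow> c * 0) sequentially"
    by (intro tendsto_intros)
  hence "eventually (\<lambda>n. c * real n powr (s - t) < d) sequentially"
    using assms(2) by (simp add: order_tendstoD(2))
  moreover have "eventually (\<lambda>n::nat. n > 0) sequentially" by (rule eventually_gt_at_top)
  ultimately show ?thesis
  proof eventually_elim
    case (elim n)
    have "c * real n powr s = c * real n powr (s - t) * real n powr t"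
      using elim(2) by (simp add: powr_diff)
    also have "\<dots> \<le> d * real n powr t" using elim(1) by (intro mult_right_mono) auto
    finally show ?case .
  qed
qed

text \<open>As p times the threshold exponent exceeds 1, rejection becomes unlikely and conditioning
  on acceptance costs a factor 2. As that exponent is below 1, an accepted sample needs only a
  sublinear number of corrections.\<close>

lemma bi_degree_good:
  assumes p: "1 < p" "p \<le> 2"
    and Fp: "integrable (measure_pmf Fin) (\<lambda>j. real j powr p)" "integrable (measure_pmf Fout) (\<lambda>j. real j powr p)"
    and F2: "integrable (measure_pmf Fout) (\<lambda>j. (real j)\<^sup>2)"
    and F1: "integrable (measure_pmf Fin) real" "integrable (measure_pmf Fout) real"
    and mean: "measure_pmf.expectation Fin real = \<mu>" "measure_pmf.expectation Fout real = \<mu>"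
    and \<mu>: "\<mu> > 1" and m: "m > \<mu>"
    and \<theta>: "1 - \<kappa> + \<delta>\<^sub>0 < 1" "p * (1 - \<kappa> + \<delta>\<^sub>0) > 1"
    and e: "0 < e" "2 * e \<le> (1 - (1 - \<kappa> + \<delta>\<^sub>0)) * (p - 1) / 2"
  obtains C \<delta> where "C \<ge> 0" "\<delta> > 0" "eventually (\<lambda>n. measure_pmf.prob (bi_degree \<kappa> \<delta>\<^sub>0 Fin Fout n)
      {q. \<not> (case q of (N, D) \<Rightarrow> good_degrees m (\<mu> + 2) e n N D)} \<le> C * real n powr (- \<delta>)) sequentially"
proof -
  define \<theta> where "\<theta> = 1 - \<kappa> + \<delta>\<^sub>0"
  \<comment> \<open>The cutoff will be n powr a. Half of the gap 1 - \<theta> makes n powr (a +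
    \<theta>) sublinear, and the bound on e, which reads 2 e \<le> a (p - 1), makes n powr (a (1 -
    p) + 1 + e) sublinear too.\<close>
  define a where "a = (1 - \<theta>) / 2"
  \<comment> \<open>The last entry is the solution of \<mu>^2 + 2 \<eta> = m (\<mu> - \<eta>), the
    margin under which the perturbed mean offspring number stays below m.\<close>
  define \<eta> where "\<eta> = min (min (\<mu> - 1) 1) (\<mu> * (m - \<mu>) / (2 + m))"
  have \<theta>1: "\<theta> < 1" "p * \<theta> > 1" using \<theta> by (simp_all add: \<theta>_def)
  have a: "a > 0" "a + \<theta> < 1" using \<theta>1 by (auto simp: a_def field_simps)
  have e2: "a * (1 - p) + (1 + e) < 1"
    using e unfolding \<theta>_def[symmetric] a_def by (simp add: field_simps)
  have \<eta>: "\<eta> > 0" "\<eta> \<le> \<mu> - 1" "\<eta> \<le> 1" using \<mu> m by (simp_all add: \<eta>_def)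
  have "\<eta> \<le> \<mu> * (m - \<mu>) / (2 + m)" by (simp add: \<eta>_def)
  hence \<eta>4: "\<mu>\<^sup>2 + 2 * \<eta> \<le> m * (\<mu> - \<eta>)"
    using \<mu> m by (simp add: pos_le_divide_eq power2_eq_square algebra_simps)
  obtain C where C: "C \<ge> 0"
    "\<And>(n::nat) t. t > 0 \<Longrightarrow> measure_pmf.prob (iid_pair Fin Fout n)
       {(x, y). real_of_int \<bar>degree_gap n x y\<bar> > t} \<le> C * real n * t powr (- p)"
    "\<And>(n::nat) t. t > 0 \<Longrightarrow> measure_pmf.prob (iid_pair Fin Fout n)
       {(x, y). \<bar>(\<Sum>i<n. real (x i)) - real n * \<mu>\<bar> > t} \<le> C * real n * t powr (- p)"
    "\<And>(n::nat) t. t > 0 \<Longrightarrow> measure_pmf.prob (iid_pair Fin Fout n)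
       {(x, y). \<bar>(\<Sum>i<n. real (x i) * real (y i)) - real n * \<mu>\<^sup>2\<bar> > t} \<le> C * real n * t powr (- p)"
    "\<And>(n::nat) t. t > 0 \<Longrightarrow> measure_pmf.prob (iid_pair Fin Fout n)
       {(x, y). (\<Sum>i<n. real (x i) powr p + (real (y i))\<^sup>2) \<ge> t} \<le> C * real n / t"
    using iid_pair_estimates[OF p Fp F2 F1 mean] by blast
  \<comment> \<open>The weak law at level \<eta> n fails with probability of order n powr (1 - p),
    Markov's inequality at level n powr (1 + e) with order n powr (- e).\<close>
  define \<delta> where "\<delta> = min (p - 1) e"
  have \<delta>: "\<delta> > 0" using p e by (simp add: \<delta>_def)
  let ?C = "2 * (2 * C * \<eta> powr (- p) + C)"
  show thesis
  proof (rule that[of ?C \<delta>])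
    show "?C \<ge> 0" "\<delta> > 0" using C(1) \<delta> by auto
    have "eventually (\<lambda>n. C * real n powr (1 - \<theta> * p) \<le> 1 / 2 * real n powr 0) sequentially"
      using \<theta>1 by (intro eventually_powr_le) (auto simp: mult.commute)
    moreover have "eventually (\<lambda>n. 2 * real n powr (a + \<theta>) \<le> \<eta> / 2 * real n powr 1) sequentially"
      using a \<eta> by (intro eventually_powr_le) auto
    moreover have "eventually (\<lambda>n. 1 * real n powr (a * (1 - p) + (1 + e)) \<le> \<eta> / 2 * real n powr 1) sequentially"
      using e2 \<eta> by (intro eventually_powr_le) auto
    moreover have "eventually (\<lambda>n::nat. n \<ge> 1) sequentially" by (rule eventually_ge_at_top)
    ultimately show "eventually (\<lambda>n. measure_pmf.prob (bi_degree \<kappa> \<delta>\<^sub>0 Fin Fout n)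
      {q. \<not> (case q of (N, D) \<Rightarrow> good_degrees m (\<mu> + 2) e n N D)} \<le> ?C * real n powr (- \<delta>)) sequentially"
    proof eventually_elim
      case (elim n)
      let ?P = "iid_pair Fin Fout n"
      let ?A = "{(x, y). real_of_int \<bar>degree_gap n x y\<bar> \<le> real n powr (1 - \<kappa> + \<delta>\<^sub>0)}"
      have n: "real n \<ge> 1" "n > 0" using elim(4) by auto
      have "measure_pmf.prob ?P (- ?A) \<le> C * real n * (real n powr \<theta>) powr (- p)"
      proof -
        have "- ?A = {(x, y). real_of_int \<bar>degree_gap n x y\<bar> > real n powr \<theta>}" by (auto simp: \<theta>_def)
        thus ?thesis using C(2)[of "real n powr \<theta>" n] n by simp
      qed
      also have "\<dots> = C * real n powr (1 - \<theta> * p)"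
        using n by (simp add: powr_powr powr_diff powr_minus divide_inverse)
      also have "\<dots> \<le> 1 / 2" using elim(1) n by simp
      finally have "measure_pmf.prob ?P (- ?A) \<le> 1 / 2" .
      moreover have "measure_pmf.prob ?P (- ?A) = 1 - measure_pmf.prob ?P ?A"
        using measure_pmf.prob_compl[of ?A ?P] unfolding Compl_eq_Diff_UNIV by simp
      ultimately have PA: "measure_pmf.prob ?P ?A \<ge> 1 / 2" by linarith
      define good where "good = (\<lambda>(x, y). \<bar>(\<Sum>i<n. real (x i)) - real n * \<mu>\<bar> \<le> \<eta> * real n \<and>
         \<bar>(\<Sum>i<n. real (x i) * real (y i)) - real n * \<mu>\<^sup>2\<bar> \<le> \<eta> * real n \<and>
         (\<Sum>i<n. real (x i) powr p + (real (y i))\<^sup>2) \<le> real n powr (1 + e))"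
      let ?B1 = "{(x, y). \<bar>(\<Sum>i<n. real (x i)) - real n * \<mu>\<bar> > \<eta> * real n} :: ((nat \<Rightarrow> nat) \<times> (nat \<Rightarrow> nat)) set"
      let ?B2 = "{(x, y). \<bar>(\<Sum>i<n. real (x i) * real (y i)) - real n * \<mu>\<^sup>2\<bar> > \<eta> * real n}"
      let ?B3 = "{(x, y). (\<Sum>i<n. real (x i) powr p + (real (y i))\<^sup>2) \<ge> real n powr (1 + e)}"
      have "measure_pmf.prob ?P {q. \<not> good q} \<le> measure_pmf.prob ?P (?B1 \<union> (?B2 \<union> ?B3))"
        by (intro measure_pmf.finite_measure_mono) (auto simp: good_def)
      also have "\<dots> \<le> measure_pmf.prob ?P ?B1 + (measure_pmf.prob ?P ?B2 + measure_pmf.prob ?P ?B3)"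
        by (intro order_trans[OF measure_Un_le] add_left_mono) auto
      also have "\<dots> \<le> C * real n * (\<eta> * real n) powr (- p) + (C * real n * (\<eta> * real n) powr (- p)
          + C * real n / (real n powr (1 + e)))"
        using n \<eta> by (intro add_mono C) auto
      also have "\<dots> = 2 * C * \<eta> powr (- p) * real n powr (- (p - 1)) + C * real n powr (- e)"
        using n \<eta> by (simp add: powr_mult powr_add powr_diff powr_minus field_simps)
      also have "\<dots> \<le> 2 * C * \<eta> powr (- p) * real n powr (- \<delta>) + C * real n powr (- \<delta>)"
        using n C(1) by (intro add_mono mult_left_mono powr_mono) (auto simp: \<delta>_def)
      finally have bad: "measure_pmf.prob ?P {q. \<not> good q} \<le> (2 * C * \<eta> powr (- p) + C) * real n powr (- \<delta>)"
        by (simp add: algebra_simps)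
      have slack: "2 * n powr a * real j + (n powr a) powr (1 - p) * real n powr (1 + e) \<le> \<eta> * real n"
        if "real j \<le> real n powr \<theta>" for j
      proof -
        have "2 * n powr a * real j \<le> 2 * n powr a * n powr \<theta>"
          using that by (intro mult_left_mono) auto
        also have "\<dots> = 2 * real n powr (a + \<theta>)" by (simp add: powr_add)
        also have "\<dots> \<le> \<eta> / 2 * real n" using elim(2) n by simp
        finally have "2 * n powr a * real j \<le> \<eta> / 2 * real n" .
        moreover have "(n powr a) powr (1 - p) * real n powr (1 + e) = real n powr (a * (1 - p) + (1 + e))"
          unfolding powr_powr powr_add ..
        moreover have "\<dots> \<le> \<eta> / 2 * real n" using elim(3) n by simp
        ultimately show ?thesis by linarith
      qed
      have "measure_pmf.prob (bi_degree \<kappa> \<delta>\<^sub>0 Fin Fout n)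
          {q. \<not> (case q of (N, D) \<Rightarrow> good_degrees m (\<mu> + 2) e n N D)}
        \<le> 0 + measure_pmf.prob (accepted_sample \<kappa> \<delta>\<^sub>0 Fin Fout n) {q. \<not> good q}"
        unfolding bi_degree_def
      \<comment> \<open>For a good accepted sample every choice of the corrected nodes gives good
        degrees, so the failure probability is 0 there and only bad samples are charged.\<close>
      proof (rule prob_bind_pmf_le)
        fix q assume q: "q \<in> set_pmf (accepted_sample \<kappa> \<delta>\<^sub>0 Fin Fout n)" "good q"
        obtain x y where xy: "q = (x, y)" by (cases q)
        have "q \<in> ?A" using q(1) prob_cond_pmf_le(1)[OF PA] unfolding accepted_sample_def by blast
        hence gap: "real_of_int \<bar>degree_gap n x y\<bar> \<le> real n powr \<theta>" by (simp add: xy \<theta>_def)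
        also have "\<dots> \<le> real n powr 1" using n \<theta>1 by (intro powr_mono) auto
        finally have gapn: "nat \<bar>degree_gap n x y\<bar> \<le> n" using n by simp
        let ?I = "{I. I \<subseteq> {..<n} \<and> card I = nat \<bar>degree_gap n x y\<bar>}"
        have finI: "finite ?I" by (rule finite_subset[of _ "Pow {..<n}"]) auto
        have neI: "?I \<noteq> {}" using obtain_subset_with_card_n[of "nat \<bar>degree_gap n x y\<bar>" "{..<n}"] gapn by auto
        let ?f = "\<lambda>I. (\<lambda>i. if degree_gap n x y < 0 \<and> i \<in> I then x i + 1 else x i,
            \<lambda>i. if degree_gap n x y \<ge> 0 \<and> i \<in> I then y i + 1 else y i)"
        have "case ?f I of (N, D) \<Rightarrow> good_degrees m (\<mu> + 2) e n N D" if I: "I \<in> ?I" for I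
          unfolding prod.case
        proof (rule good_degrees_adjusted[OF _ _ refl refl p \<mu>])
          show "real n powr a \<ge> 1" using n a by (simp add: ge_one_powr_ge_zero)
          show "2 * real n powr a * real (card I) + (real n powr a) powr (1 - p) * real n powr (1 + e) \<le> \<eta> * real n"
            using I gap by (intro slack) simp
          have "real n powr 1 \<le> real n powr (1 + e)" using n e by (intro powr_mono) auto
          thus "real n \<le> real n powr (1 + e)" using n by simp
        qed (use I gapn q(2) \<eta> \<eta>4 \<mu> m in \<open>auto simp: good_def xy\<close>)
        hence "set_pmf (bind_pmf (pmf_of_set ?I) (\<lambda>I. return_pmf (?f I)))
            \<inter> {q. \<not> (case q of (N, D) \<Rightarrow> good_degrees m (\<mu> + 2) e n N D)} = {}"
          using finI neI by auto
        thus "measure_pmf.prob (case q of (x, y) \<Rightarrow>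
            bind_pmf (pmf_of_set {I. I \<subseteq> {..<n} \<and> card I = nat \<bar>degree_gap n x y\<bar>}) (\<lambda>I.
            return_pmf (\<lambda>i. if degree_gap n x y < 0 \<and> i \<in> I then x i + 1 else x i,
               \<lambda>i. if degree_gap n x y \<ge> 0 \<and> i \<in> I then y i + 1 else y i)))
            {q. \<not> (case q of (N, D) \<Rightarrow> good_degrees m (\<mu> + 2) e n N D)} \<le> 0"
          unfolding xy prod.case by (simp only: measure_pmf_zero_iff[THEN iffD2] order_refl)
      qed simp
      also have "\<dots> \<le> 2 * measure_pmf.prob ?P {q. \<not> good q}"
        using prob_cond_pmf_le(2)[OF PA] unfolding accepted_sample_def by simp
      also have "\<dots> \<le> 2 * ((2 * C * \<eta> powr (- p) + C) * real n powr (- \<delta>))"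
        using bad by (intro mult_left_mono) auto
      also have "\<dots> = ?C * real n powr (- \<delta>)" by (simp only: mult.assoc)
      finally show ?case .
    qed
  qed
qed

section \<open>The exploration budget and the choice of exponents\<close>

lemma progeny_weight_le:
  assumes "m > 1" "k \<ge> 1"
  shows "progeny_weight m k 1 \<le> m ^ k / (m - 1)"
proof -
  have "{..k - 1} = {..<k}" using assms(2) by auto
  hence "progeny_weight m k 1 = (m ^ k - 1) / (m - 1)"
    using assms by (simp add: progeny_weight_def geometric_sum)
  also have "\<dots> \<le> m ^ k / (m - 1)" using assms by (intro divide_right_mono) auto
  finally show ?thesis .
qed

text \<open>The budget is n powr s. Since m^k \<le> n powr (h ln m), the three summands have orders
  n powr (h ln m - s), n powr (s - 1) and n powr (2 s + e - 1); the hypotheses on s and e make all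
  exponents negative.\<close>

lemma coupling_error_rate:
  fixes k :: "nat \<Rightarrow> nat"
  assumes m: "m > 1" and h: "h * ln m < 1 / 2" and s: "h * ln m < s"
    and e: "e < 1 - 2 * s" and s2: "s < 1" and b: "b \<ge> 0"
    and k: "eventually (\<lambda>n. 1 \<le> k n \<and> real (k n) \<le> h * ln (real n)) sequentially"
  obtains C \<delta> where "C \<ge> 0" "\<delta> > 0"
    "eventually (\<lambda>n. \<forall>L. real n \<le> L \<longrightarrow> L \<le> b * real n \<longrightarrow>
       L / real n * progeny_weight m (k n) 1 / real (nat \<lceil>real n powr s\<rceil>)
        + (real (nat \<lceil>real n powr s\<rceil>) / real n
           + 4 * real n powr (1 + e) / L * (real (nat \<lceil>real n powr s\<rceil>))\<^sup>2 / L)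
       \<le> C * real n powr (- \<delta>)) sequentially"
proof -
  define \<delta> where "\<delta> = min (s - h * ln m) (min (1 - s) (1 - 2 * s - e))"
  have \<delta>: "\<delta> > 0" using s e s2 by (simp add: \<delta>_def)
  let ?C = "b / (m - 1) + 2 + 16"
  have C0: "?C \<ge> 0" using b m by simp
  have "eventually (\<lambda>n::nat. n \<ge> 1) sequentially" by (rule eventually_ge_at_top)
  with k have "eventually (\<lambda>n. \<forall>L. real n \<le> L \<longrightarrow> L \<le> b * real n \<longrightarrow>
       L / real n * progeny_weight m (k n) 1 / real (nat \<lceil>real n powr s\<rceil>)
        + (real (nat \<lceil>real n powr s\<rceil>) / real n
           + 4 * real n powr (1 + e) / L * (real (nat \<lceil>real n powr s\<rceil>))\<^sup>2 / L)
       \<le> ?C * real n powr (- \<delta>)) sequentially"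
  proof eventually_elim
    case (elim n)
    have n: "real n \<ge> 1" using elim(2) by simp
    \<comment> \<open>The bounds on k n force h > 0 and with it s > 0. Then n powr s is at least 1
      and rounding it up at most doubles it.\<close>
    have "h * ln (real n) \<ge> 1" using elim(1) by linarith
    have "h > 0"
    proof (rule ccontr)
      assume "\<not> h > 0"
      hence "h * ln (real n) \<le> 0" using n by (intro mult_nonpos_nonneg) auto
      thus False using \<open>h * ln (real n) \<ge> 1\<close> by linarith
    qed
    hence "h * ln m > 0" using m by simp
    hence "s > 0" using s by linarith
    define x where "x = real (nat \<lceil>real n powr s\<rceil>)"
    have ns: "real n powr s \<ge> 1" using n \<open>s > 0\<close> by (simp add: ge_one_powr_ge_zero)
    have x1: "real n powr s \<le> x" and x2: "x \<le> 2 * real n powr s"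
      unfolding x_def using ns by linarith+
    have x0: "x > 0" using x1 ns by linarith
    have "m ^ k n = exp (real (k n) * ln m)" using m by (simp add: exp_of_nat_mult)
    also have "\<dots> \<le> exp (h * ln (real n) * ln m)"
      using elim(1) m by (simp add: mult_right_mono)
    also have "\<dots> = real n powr (h * ln m)" using n by (simp add: powr_def mult_ac)
    finally have mk: "m ^ k n \<le> real n powr (h * ln m)" .
    have w: "progeny_weight m (k n) 1 \<le> real n powr (h * ln m) / (m - 1)"
      using progeny_weight_le[OF m, of "k n"] elim(1) divide_right_mono[OF mk, of "m - 1"] m by simp
    have w0: "progeny_weight m (k n) 1 \<ge> 0" using m by (intro progeny_weight_nonneg) simp
    show ?case
      unfolding x_def[symmetric]
    proof (intro allI impI)
      fix L assume L: "real n \<le> L" "L \<le> b * real n"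
      have "L / real n * progeny_weight m (k n) 1 / x \<le> b * (real n powr (h * ln m) / (m - 1)) / (real n powr s)"
        using L n w w0 x1 ns b m by (intro frac_le mult_mono) (auto simp: pos_divide_le_eq)
      also have "\<dots> = b / (m - 1) * real n powr (- (s - h * ln m))"
        using n by (simp add: powr_diff)
      also have "\<dots> \<le> b / (m - 1) * real n powr (- \<delta>)"
        using n b m by (intro mult_left_mono powr_mono) (auto simp: \<delta>_def)
      finally have 1: "L / real n * progeny_weight m (k n) 1 / x \<le> b / (m - 1) * real n powr (- \<delta>)" .
      have "x / real n \<le> 2 * real n powr s / real n" using x2 n by (intro divide_right_mono) auto
      also have "\<dots> = 2 * real n powr (- (1 - s))" using n by (simp add: powr_diff)
      also have "\<dots> \<le> 2 * real n powr (- \<delta>)"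
        using n by (intro mult_left_mono powr_mono) (auto simp: \<delta>_def)
      finally have 2: "x / real n \<le> 2 * real n powr (- \<delta>)" .
      have "4 * real n powr (1 + e) / L * x\<^sup>2 / L = 4 * real n powr (1 + e) * x\<^sup>2 / (L * L)" by simp
      also have "\<dots> \<le> 4 * real n powr (1 + e) * (2 * real n powr s)\<^sup>2 / (real n * real n)"
        using L n x0 x2 by (intro frac_le mult_mono power_mono) auto
      also have "\<dots> = 16 * real n powr (- (1 - 2 * s - e))"
        using n by (simp add: power2_eq_square powr_add powr_diff powr_minus field_simps)
          (simp add: powr_add[symmetric] mult.commute)
      also have "\<dots> \<le> 16 * real n powr (- \<delta>)"
        using n by (intro mult_left_mono powr_mono) (auto simp: \<delta>_def)
      finally have 3: "4 * real n powr (1 + e) / L * x\<^sup>2 / L \<le> 16 * real n powr (- \<delta>)" .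
      from 1 2 3 show "L / real n * progeny_weight m (k n) 1 / x + (x / real n + 4 * real n powr (1 + e) / L * x\<^sup>2 / L)
        \<le> ?C * real n powr (- \<delta>)" unfolding distrib_right by linarith
    qed
  qed
  thus thesis using that[OF C0 \<delta>] by blast
qed

theorem theorem1:
  fixes Fin Fout :: "nat pmf"
    and \<alpha> \<beta> \<delta>\<^sub>0 \<mu> c r\<^sub>0 \<epsilon> h :: real
    and L\<^sub>i\<^sub>n L\<^sub>o\<^sub>u\<^sub>t :: "real \<Rightarrow> real"
    and k :: "nat \<Rightarrow> nat"
    and K :: "nat \<Rightarrow> continuation"
  assumes "\<alpha> > 1" and "\<beta> > 2"
    and "slowly_varying L\<^sub>i\<^sub>n" and "tail_bound Fin \<alpha> L\<^sub>i\<^sub>n"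
    and "slowly_varying L\<^sub>o\<^sub>u\<^sub>t" and "tail_bound Fout \<beta> L\<^sub>o\<^sub>u\<^sub>t"
    and "integrable (measure_pmf Fin) real" and "measure_pmf.expectation Fin real = \<mu>"
    and "integrable (measure_pmf Fout) real" and "measure_pmf.expectation Fout real = \<mu>"
    and "\<mu> > 1"
    and "0 < \<delta>\<^sub>0" and "\<delta>\<^sub>0 < kappa0 \<alpha> \<beta>"
    and "0 < c" and "c < 1"
    and "r\<^sub>0 \<ge> 0"
    and "\<epsilon> > 0"
    and "0 < h" and "h < 1 / (2 * ln \<mu>)"
    and "eventually (\<lambda>n. 1 \<le> k n \<and> real (k n) \<le> h * ln (real n)) sequentially"
    and "\<And>n. is_continuation n (k n) (K n)"
  shows "\<exists>\<delta>>0. \<exists>g :: nat \<Rightarrow> real. g \<in> O(\<lambda>n. real n powr (- \<delta>)) \<and>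
           eventually (\<lambda>n.
             measure_pmf.prob (coupled_model (kappa0 \<alpha> \<beta>) \<delta>\<^sub>0 Fin Fout n (K n))
               {(N, D, v, G, T).
                  \<bar>pagerank n D c G v - tree_pagerank N D c r\<^sub>0 T (k n) []\<bar> > \<epsilon>}
             \<le> (r\<^sub>0 + 1) * inverse \<epsilon> * c ^ k n + g n) sequentially"
proof -
  define \<kappa> where "\<kappa> = kappa0 \<alpha> \<beta>"
  define \<theta> where "\<theta> = 1 - \<kappa> + \<delta>\<^sub>0"
  \<comment> \<open>The midpoint between 1 / \<theta> and min \<alpha> 2. This range is nonempty
    because \<theta> > 1 - \<kappa>, which is at least 1 / \<alpha> and 1 / 2. Its lower end makes
    acceptance likely, its upper end provides the p-th moment of the in-degree.\<close>
  define p where "p = (1 / \<theta> + min \<alpha> 2) / 2"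
  have \<kappa>: "\<kappa> \<le> 1 - 1 / \<alpha>" "\<kappa> \<le> 1 / 2" unfolding \<kappa>_def kappa0_def by linarith+
  have \<theta>: "0 < \<theta>" "\<theta> < 1" "1 / \<alpha> < \<theta>" "1 / 2 < \<theta>"
    using assms(12,13) \<kappa> unfolding \<kappa>_def[symmetric] by (simp_all add: \<theta>_def)
  have "1 / \<theta> < \<alpha>" "1 / \<theta> < 2" "1 < 1 / \<theta>"
    using \<theta> assms(1) by (simp_all add: field_simps)
  moreover have "i < (i + min \<alpha> 2) / 2 \<and> 1 < (i + min \<alpha> 2) / 2 \<and> (i + min \<alpha> 2) / 2 < \<alpha> \<and> (i + min \<alpha> 2) / 2 < 2"
    if "i < \<alpha>" "i < 2" "1 < i" for i
    using that by (auto simp: min_def)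
  ultimately have p: "1 / \<theta> < p" "1 < p" "p < \<alpha>" "p < 2" unfolding p_def by blast+
  hence p\<theta>: "p * \<theta> > 1" using \<theta> by (simp add: field_simps)
  have moments: "integrable (measure_pmf Fin) (\<lambda>j. real j powr p)"
    "integrable (measure_pmf Fout) (\<lambda>j. real j powr p)"
    using p assms(2) by (auto intro!: tail_bound_moment[OF assms(3,4)] tail_bound_moment[OF assms(5,6)])
  have "integrable (measure_pmf Fout) (\<lambda>j. real j powr 2)"
    by (rule tail_bound_moment[OF assms(5,6)]) (use assms(2) in auto)
  hence F2: "integrable (measure_pmf Fout) (\<lambda>j. (real j)\<^sup>2)" by simp

  \<comment> \<open>The logarithm of m, halfway between ln \<mu> and 1 / (2 h): thus m > \<mu> while
    h ln m is still below 1 / 2.\<close>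
  define l where "l = (ln \<mu> + 1 / (2 * h)) / 2"
  define m where "m = exp l"
  have ln\<mu>: "ln \<mu> > 0" using assms(11) by simp
  have h\<mu>: "h * ln \<mu> < 1 / 2" using assms(19) ln\<mu> by (simp add: field_simps)
  have "a < b \<Longrightarrow> a < (a + b) / 2" for a b :: real by simp
  moreover have "ln \<mu> < 1 / (2 * h)" using h\<mu> assms(18) by (simp add: field_simps)
  ultimately have hl1: "ln \<mu> < l" unfolding l_def by blast
  have hl_eq: "h * l = (h * ln \<mu> + 1 / 2) / 2" using assms(18) by (simp add: l_def field_simps)
  have "a < 1 / 2 \<Longrightarrow> (a + 1 / 2) / 2 < 1 / 2" for a :: real by simp
  from this[OF h\<mu>] have hl2: "h * l < 1 / 2" unfolding hl_eq .
  note hl = hl1 hl2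
  have m: "m > \<mu>" using hl(1) assms(11) unfolding m_def by (metis exp_less_cancel_iff exp_ln less_trans zero_less_one)
  have m1: "m > 1" using m assms(11) by linarith
  have lnm: "ln m = l" by (simp add: m_def)
  \<comment> \<open>The budget exponent, halfway between the growth exponent h ln m and 1 /
    2.\<close>
  define s where "s = (h * l + 1 / 2) / 2"
  have s: "h * l < s" "s < 1 / 2" using hl(2) by (auto simp: s_def)
  \<comment> \<open>The first entry keeps 2 s + e below 1, the second is the loss that the degree
    cutoff tolerates.\<close>
  define e where "e = min ((1 - 2 * s) / 2) ((1 - \<theta>) * (p - 1) / 4)"
  have e: "0 < e" "e < 1 - 2 * s" "2 * e \<le> (1 - \<theta>) * (p - 1) / 2"
  proof -
    define r where "r = (1 - \<theta>) * (p - 1)"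
    have "r > 0" unfolding r_def using \<theta> p by simp
    moreover have "e = min ((1 - 2 * s) / 2) (r / 4)" by (simp add: e_def r_def)
    ultimately show "0 < e" "e < 1 - 2 * s" "2 * e \<le> (1 - \<theta>) * (p - 1) / 2"
      using s unfolding r_def[symmetric] by (auto simp: min_def)
  qed

  obtain C1 \<delta>1 where deg: "C1 \<ge> 0" "\<delta>1 > 0"
    "eventually (\<lambda>n. measure_pmf.prob (bi_degree \<kappa> \<delta>\<^sub>0 Fin Fout n)
      {q. \<not> (case q of (N, D) \<Rightarrow> good_degrees m (\<mu> + 2) e n N D)} \<le> C1 * real n powr (- \<delta>1)) sequentially"
    using bi_degree_good[OF p(2) less_imp_le[OF p(4)] moments F2 assms(7,9,8,10,11) m, of \<kappa> \<delta>\<^sub>0 e]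
      \<theta> p\<theta> e unfolding \<theta>_def by blast
  obtain C2 \<delta>2 where rate: "C2 \<ge> 0" "\<delta>2 > 0"
    "eventually (\<lambda>n. \<forall>L. real n \<le> L \<longrightarrow> L \<le> (\<mu> + 2) * real n \<longrightarrow>
       L / real n * progeny_weight m (k n) 1 / real (nat \<lceil>real n powr s\<rceil>)
        + (real (nat \<lceil>real n powr s\<rceil>) / real n
           + 4 * real n powr (1 + e) / L * (real (nat \<lceil>real n powr s\<rceil>))\<^sup>2 / L)
       \<le> C2 * real n powr (- \<delta>2)) sequentially"
    using coupling_error_rate[OF m1 _ _ e(2) _ _ assms(20), of "\<mu> + 2"] hl s assms(11) unfolding lnm by auto
  define \<delta> where "\<delta> = min \<delta>1 \<delta>2"
  have "\<delta> > 0" using deg rate by (simp add: \<delta>_def)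
  define g where "g n = (C1 + C2) * real n powr (- \<delta>)" for n :: nat
  have "g \<in> O(\<lambda>n. real n powr (- \<delta>))" unfolding g_def by simp
  moreover have "eventually (\<lambda>n.
             measure_pmf.prob (coupled_model (kappa0 \<alpha> \<beta>) \<delta>\<^sub>0 Fin Fout n (K n))
               {(N, D, v, G, T).
                  \<bar>pagerank n D c G v - tree_pagerank N D c r\<^sub>0 T (k n) []\<bar> > \<epsilon>}
             \<le> (r\<^sub>0 + 1) * inverse \<epsilon> * c ^ k n + g n) sequentially"
    using deg(3) rate(3) eventually_gt_at_top[of "0::nat"]
  proof eventually_elim
    case (elim n)
    have n: "real n \<ge> 1" using elim(3) by simp
    let ?x = "nat \<lceil>real n powr s\<rceil>" and ?main = "(r\<^sub>0 + 1) * inverse \<epsilon> * c ^ k n"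
    have main0: "?main \<ge> 0" using assms(14,16,17) by simp
    have x: "?x > 0" using n by simp
    have "measure_pmf.prob (coupled_model (kappa0 \<alpha> \<beta>) \<delta>\<^sub>0 Fin Fout n (K n))
               {(N, D, v, G, T).
                  \<bar>pagerank n D c G v - tree_pagerank N D c r\<^sub>0 T (k n) []\<bar> > \<epsilon>}
        \<le> (?main + C2 * real n powr (- \<delta>2)) + measure_pmf.prob (bi_degree \<kappa> \<delta>\<^sub>0 Fin Fout n)
            {q. \<not> (case q of (N, D) \<Rightarrow> good_degrees m (\<mu> + 2) e n N D)}"
      unfolding coupled_model_def \<kappa>_def[symmetric]
    proof (rule prob_bind_pmf_le)
      fix q assume "case q of (N, D) \<Rightarrow> good_degrees m (\<mu> + 2) e n N D"
      then obtain N D where q: "q = (N, D)" and good: "good_degrees m (\<mu> + 2) e n N D" by (cases q) auto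
      define L where "L = real (\<Sum>i<n. D i)"
      have L: "real n \<le> L" "L \<le> (\<mu> + 2) * real n" "L > 0"
        using good n unfolding good_degrees_def L_def by linarith+
      \<comment> \<open>This fixes \<nu> as \<open>4 * real n powr (1 + e) / L\<close>, at most 4 n
        powr e because L \<ge> n.\<close>
      have D2: "(\<Sum>i<n. real (D i) * real (D i)) \<le> 4 * real n powr (1 + e) / L * L"
        using good L(3) unfolding good_degrees_def by simp
      have "measure_pmf.prob
         (bind_pmf (pmf_of_set {..<n}) (\<lambda>v. bind_pmf (explore n N D v) (\<lambda>E.
            bind_pmf (K n N D E) (\<lambda>(G, T). return_pmf (N, D, v, G, T)))))
         {(N, D, v, G, T). \<bar>pagerank n D c G v - tree_pagerank N D c r\<^sub>0 T (k n) []\<bar> > \<epsilon>}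
       \<le> ?main + (L / real n * progeny_weight m (k n) 1 / real ?x
            + (real ?x / real n + 4 * real n powr (1 + e) / L * (real ?x)\<^sup>2 / L))"
        by (rule prob_fixed_degrees[OF elim(3) assms(14-17) assms(21) _ L_def L(3) _ D2 _ _ x])
           (use good L m1 in \<open>auto simp: good_degrees_def L_def\<close>)
      also have "\<dots> \<le> ?main + C2 * real n powr (- \<delta>2)" using elim(2) L by simp
      finally show "measure_pmf.prob (case q of (N, D) \<Rightarrow>
         bind_pmf (pmf_of_set {..<n}) (\<lambda>v. bind_pmf (explore n N D v) (\<lambda>E.
            bind_pmf (K n N D E) (\<lambda>(G, T). return_pmf (N, D, v, G, T)))))
         {(N, D, v, G, T). \<bar>pagerank n D c G v - tree_pagerank N D c r\<^sub>0 T (k n) []\<bar> > \<epsilon>}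
         \<le> ?main + C2 * real n powr (- \<delta>2)" unfolding q prod.case .
    qed (use main0 rate(1) in simp)
    also have "\<dots> \<le> ?main + (C2 * real n powr (- \<delta>) + C1 * real n powr (- \<delta>))"
    proof -
      have "C2 * real n powr (- \<delta>2) \<le> C2 * real n powr (- \<delta>)"
        using n rate(1) by (intro mult_left_mono powr_mono) (auto simp: \<delta>_def)
      moreover have "C1 * real n powr (- \<delta>1) \<le> C1 * real n powr (- \<delta>)"
        using n deg(1) by (intro mult_left_mono powr_mono) (auto simp: \<delta>_def)
      ultimately show ?thesis using elim(1) by linarith
    qed
    finally show ?case by (simp add: g_def algebra_simps)
  qed
  ultimately show ?thesis using \<open>\<delta> > 0\<close> by blast
qed

end
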